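(* The optimization problem MinDim is NP-hard.
   Context: A $d$-dimensional quantum state is a positive semidefinite matrix $\rho \in \mathbb{C}^{d\times d}$ with $\mathrm{tr}(\rho)=1$. A $d$-dimensional measurement with $Z$ outcomes is a tuple $(E_z)_{z\in[Z]}$ of positive semidefinite matrices in $\mathbb{C}^{d\times d}$ with $\sum_{z=1}^Z E_z = I_d$. Here $[n]=\{1,\dots,n\}$. MinDim is the following optimization problem. Instance: $X,Y,Z\in\mathbb{N}$, a set $\Omega\subseteq [X]\times[Y]\times[Z]$, and scalars $(p_{xyz})_{(x,y,z)\in\Omega}$ (rational numbers, encoded in binary). Objective: compute the minimal $d$ such that there exist $d$-dimensional states $\rho_x$ ($x\in[X]$) and $d$-dimensional measurements $(E_{yz})_{z\in[Z]}$ ($y\in[Y]$) with $p_{xyz}=\mathrm{tr}(\rho_x E_{yz})$ for all $(x,y,z)\in\Omega$ (value $+\infty$ if no such $d$ exists). A decision problem $B$ is reducible to a decision problem $A$ if there is a polynomial-time algorithm mapping instances $i$ of $B$ to instances $\mathcal{R}(i)$ of $A$ such that $i$ is a yes-instance of $B$ if and only if $\mathcal{R}(i)$ is a yes-instance of $A$. A decision problem is NP-hard if every problem in NP is reducible to it. The minimization problem MinDim is called NP-hard if every problem in NP can be solved in polynomial time given access to a procedure that returns the optimal value of MinDim on any instance (for example by comparing that optimal value with a fixed threshold). *)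

theory Defs
  imports
    "HOL-Computational_Algebra.Polynomial"
    "HOL-Library.Extended_Nat"
    "Jordan_Normal_Form.Schur_Decomposition"
begin

section \<open>Polynomial-time computation\<close>

text \<open>
  Programs consist of a finite control (labels are positions in the program) acting on stacks of
  bits, one elementary stack operation per time step. This is the multi-tape Turing machine in
  the form where each tape is split at its head into two stacks. A program mentions only finitely
  many stacks, and every instruction names its successor label(s). \<open>Pop r e l0 l1\<close> continues
  at \<open>e\<close> if stack \<open>r\<close> is empty, and otherwise removes the top bit and continues
  at \<open>l0\<close> or \<open>l1\<close> according to its value. \<open>Query r l\<close> replaces the content
  of stack \<open>r\<close> by the answer of the oracle, in one step.
\<close>

datatype instr =
    Push nat bool nat
  | Pop nat nat nat nat
  | Query nat nat
  | Halt bool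

type_synonym program = "instr list"
type_synonym config = "nat \<times> (nat \<Rightarrow> bool list)"

fun exec :: "(bool list \<Rightarrow> bool list) \<Rightarrow> instr \<Rightarrow> config \<Rightarrow> config" where
  "exec f (Push r b l) (pc, s) = (l, s(r := b # s r))"
| "exec f (Pop r e l0 l1) (pc, s) =
     (case s r of [] \<Rightarrow> (e, s) | b # w \<Rightarrow> (if b then l1 else l0, s(r := w)))"
| "exec f (Query r l) (pc, s) = (l, s(r := f (s r)))"
| "exec f (Halt b) (pc, s) = (pc, s)"

definition step :: "(bool list \<Rightarrow> bool list) \<Rightarrow> program \<Rightarrow> config \<Rightarrow> config" where
  "step f P c = (if fst c < length P then exec f (P ! fst c) c else c)"

definition init_config :: "bool list list \<Rightarrow> config" where
  "init_config ws = (0, \<lambda>r. if r < length ws then ws ! r else [])"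

text \<open>A run that leaves the program without reaching a \<open>Halt\<close> instruction has no outcome.\<close>

definition outcome_at ::
  "(bool list \<Rightarrow> bool list) \<Rightarrow> program \<Rightarrow> bool list list \<Rightarrow> nat \<Rightarrow> bool \<Rightarrow> bool" where
  "outcome_at f P ws t b \<longleftrightarrow>
     (let pc = fst ((step f P ^^ t) (init_config ws)) in pc < length P \<and> P ! pc = Halt b)"

definition decides_in_time ::
  "(bool list \<Rightarrow> bool list) \<Rightarrow> program \<Rightarrow> nat poly \<Rightarrow> nat \<Rightarrow> (bool list list \<Rightarrow> bool) \<Rightarrow> bool" where
  "decides_in_time f P q k A \<longleftrightarrow>
     (\<forall>ws. length ws = k \<longrightarrow>
        (\<exists>t \<le> poly q (sum_list (map length ws)). outcome_at f P ws t (A ws)))"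

definition query_free :: "program \<Rightarrow> bool" where
  "query_free P \<longleftrightarrow> (\<forall>r l. Query r l \<notin> set P)"

text \<open>The oracle argument is irrelevant for query-free programs; the identity is a dummy.\<close>

definition NP :: "bool list set set" where
  "NP = {L. \<exists>V P q p. query_free P \<and> decides_in_time id P q 2 V \<and>
            (\<forall>w. w \<in> L \<longleftrightarrow> (\<exists>c. length c \<le> poly p (length w) \<and> V [w, c]))}"

text \<open>
  A function problem is given by its pairs of an encoded instance and the encoded answer. An
  oracle answers it if it is correct on all encoded instances; nothing is assumed about its
  behaviour on other strings. NP-hardness is meant with respect to polynomial-time oracle
  reductions, and the program and the time bound do not depend on the oracle.
\<close>

definition answers :: "(bool list \<Rightarrow> bool list) \<Rightarrow> (bool list \<times> bool list) set \<Rightarrow> bool" where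
  "answers f R \<longleftrightarrow> (\<forall>(w, a) \<in> R. f w = a)"

definition NP_hard :: "(bool list \<times> bool list) set \<Rightarrow> bool" where
  "NP_hard R \<longleftrightarrow>
     (\<forall>L \<in> NP. \<exists>P q. \<forall>f. answers f R \<longrightarrow> decides_in_time f P q 1 (\<lambda>ws. hd ws \<in> L))"


section \<open>States and measurements\<close>

definition psd :: "nat \<Rightarrow> complex mat \<Rightarrow> bool" where
  "psd d A \<longleftrightarrow> A \<in> carrier_mat d d \<and> mat_adjoint A = A \<and>
     (\<forall>v \<in> carrier_vec d. 0 \<le> Re ((A *\<^sub>v v) \<bullet>c v))"

definition mat_trace :: "complex mat \<Rightarrow> complex" where
  "mat_trace A = (\<Sum>i<dim_row A. A $$ (i, i))"

definition quantum_state :: "nat \<Rightarrow> complex mat \<Rightarrow> bool" where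
  "quantum_state d \<rho> \<longleftrightarrow> psd d \<rho> \<and> mat_trace \<rho> = 1"

definition measurement :: "nat \<Rightarrow> nat \<Rightarrow> (nat \<Rightarrow> complex mat) \<Rightarrow> bool" where
  "measurement d Z E \<longleftrightarrow> (\<forall>z \<in> {1..Z}. psd d (E z)) \<and>
     mat d d (\<lambda>(i, j). \<Sum>z = 1..Z. E z $$ (i, j)) = 1\<^sub>m d"


section \<open>The problem MinDim\<close>

text \<open>The values of \<open>prob\<close> outside \<open>Omega\<close> are irrelevant.\<close>

record mindim_instance =
  nX :: nat
  nY :: nat
  nZ :: nat
  Omega :: "(nat \<times> nat \<times> nat) set"
  prob :: "nat \<times> nat \<times> nat \<Rightarrow> rat"

definition valid_instance :: "mindim_instance \<Rightarrow> bool" where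
  "valid_instance I \<longleftrightarrow> nX I \<ge> 1 \<and> nY I \<ge> 1 \<and> nZ I \<ge> 1 \<and>
     Omega I \<subseteq> {1..nX I} \<times> {1..nY I} \<times> {1..nZ I}"

definition realizable :: "mindim_instance \<Rightarrow> nat \<Rightarrow> bool" where
  "realizable I d \<longleftrightarrow> (\<exists>\<rho> E.
     (\<forall>x \<in> {1..nX I}. quantum_state d (\<rho> x)) \<and>
     (\<forall>y \<in> {1..nY I}. measurement d (nZ I) (E y)) \<and>
     (\<forall>(x, y, z) \<in> Omega I. of_rat (prob I (x, y, z)) = mat_trace (\<rho> x * E y z)))"

text \<open>The infimum is attained unless the set is empty, in which case it is \<open>\<infinity>\<close>.\<close>

definition min_dim :: "mindim_instance \<Rightarrow> enat" where
  "min_dim I = Inf {enat d | d. realizable I d}"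


subsection \<open>Binary encoding\<close>

text \<open>Least significant bit first, without leading zeros.\<close>

fun bin :: "nat \<Rightarrow> bool list" where
  "bin n = (if n = 0 then [] else odd n # bin (n div 2))"

declare bin.simps [simp del]

text \<open>Each bit is preceded by \<open>True\<close> and the end is marked by \<open>False\<close>, so that
  concatenated fields can be told apart.\<close>

definition field_code :: "bool list \<Rightarrow> bool list" where
  "field_code bs = concat (map (\<lambda>b. [True, b]) bs) @ [False]"

definition nat_code :: "nat \<Rightarrow> bool list" where
  "nat_code n = field_code (bin n)"

definition rat_code :: "rat \<Rightarrow> bool list" where
  "rat_code r = (case quotient_of r of (a, b) \<Rightarrow>
     (a < 0) # nat_code (nat \<bar>a\<bar>) @ nat_code (nat b))"

definition entry_code :: "(nat \<times> nat \<times> nat \<Rightarrow> rat) \<Rightarrow> nat \<times> nat \<times> nat \<Rightarrow> bool list" where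
  "entry_code p = (\<lambda>(x, y, z). nat_code x @ nat_code y @ nat_code z @ rat_code (p (x, y, z)))"

text \<open>The entries may be listed in any order, so an instance has several encodings.\<close>

definition instance_codes :: "mindim_instance \<Rightarrow> bool list set" where
  "instance_codes I = {nat_code (nX I) @ nat_code (nY I) @ nat_code (nZ I) @
      concat (map (entry_code (prob I)) ts) | ts. distinct ts \<and> set ts = Omega I}"

fun value_code :: "enat \<Rightarrow> bool list" where
  "value_code (enat d) = True # bin d"
| "value_code \<infinity> = []"

definition MinDim :: "(bool list \<times> bool list) set" where
  "MinDim = {(w, value_code (min_dim I)) | w I. valid_instance I \<and> w \<in> instance_codes I}"


subsection \<open>The encoding is unambiguous\<close>

lemma bin_inj: "bin m = bin n \<Longrightarrow> m = n"
proof (induction m arbitrary: n rule: less_induct)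
  case (less m)
  show ?case
  proof (cases "m = 0 \<or> n = 0")
    case True
    with less.prems show ?thesis
      by (auto simp: bin.simps[of m] bin.simps[of n] split: if_splits)
  next
    case False
    with less.prems have eq: "odd m = odd n" "bin (m div 2) = bin (n div 2)"
      by (simp_all add: bin.simps[of m] bin.simps[of n])
    from False have "m div 2 < m" by simp
    with less.IH eq have "m div 2 = n div 2" by blast
    with eq(1) show ?thesis
      by (metis even_two_times_div_two odd_two_times_div_two_succ)
  qed
qed

lemma field_code_append_inj: "field_code a @ u = field_code b @ v \<Longrightarrow> a = b \<and> u = v"
proof (induction a arbitrary: b)
  case Nil
  then show ?case by (cases b) (auto simp: field_code_def)
next
  case (Cons x a)
  then show ?case by (cases b) (auto simp: field_code_def)
qed

lemma nat_code_append_inj: "nat_code m @ u = nat_code n @ v \<Longrightarrow> m = n \<and> u = v"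
  unfolding nat_code_def using field_code_append_inj bin_inj by blast

lemma rat_code_append_inj:
  assumes "rat_code r @ u = rat_code s @ v"
  shows "r = s \<and> u = v"
proof -
  obtain a b where r: "quotient_of r = (a, b)" by fastforce
  obtain c d where s: "quotient_of s = (c, d)" by fastforce
  from assms have eq: "(a < 0) = (c < 0)"
    and "nat_code (nat \<bar>a\<bar>) @ nat_code (nat b) @ u = nat_code (nat \<bar>c\<bar>) @ nat_code (nat d) @ v"
    by (simp_all add: rat_code_def r s)
  then have "nat \<bar>a\<bar> = nat \<bar>c\<bar>" "nat b = nat d" "u = v"
    using nat_code_append_inj by blast+
  moreover have "b > 0" "d > 0"
    using r s by (auto dest: quotient_of_denom_pos)
  ultimately have "(a, b) = (c, d)"
    using eq by (auto simp: abs_if split: if_splits)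
  with r s have "quotient_of r = quotient_of s" by simp
  then show ?thesis
    using \<open>u = v\<close> by (metis quotient_of_inject)
qed

lemma entry_code_append_inj:
  assumes "entry_code p t @ u = entry_code p' t' @ v"
  shows "t = t' \<and> p t = p' t' \<and> u = v"
proof -
  obtain x y z x' y' z' where t: "t = (x, y, z)" "t' = (x', y', z')"
    by (metis prod_cases3)
  have "nat_code x @ nat_code y @ nat_code z @ rat_code (p t) @ u =
        nat_code x' @ nat_code y' @ nat_code z' @ rat_code (p' t') @ v"
    using assms by (simp add: entry_code_def t)
  then show ?thesis
    unfolding t using nat_code_append_inj rat_code_append_inj by metis
qed

lemma entry_code_nonempty: "entry_code p t \<noteq> []"
  by (cases t) (simp add: entry_code_def nat_code_def field_code_def)

lemma entries_code_inj:
  "concat (map (entry_code p) ts) = concat (map (entry_code p') ts') \<Longrightarrow>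
   ts = ts' \<and> (\<forall>t \<in> set ts. p t = p' t)"
proof (induction ts arbitrary: ts')
  case Nil
  then show ?case by (cases ts') (auto simp: entry_code_nonempty)
next
  case (Cons t ts)
  then obtain t' us where ts': "ts' = t' # us"
    by (cases ts') (auto simp: entry_code_nonempty)
  with Cons.prems have "entry_code p t @ concat (map (entry_code p) ts) =
      entry_code p' t' @ concat (map (entry_code p') us)" by simp
  from entry_code_append_inj[OF this] Cons.IH[of us] show ?case
    unfolding ts' by auto
qed

lemma instance_codes_unambiguous:
  assumes "w \<in> instance_codes I" "w \<in> instance_codes J"
  shows "nX I = nX J \<and> nY I = nY J \<and> nZ I = nZ J \<and> Omega I = Omega J \<and>
    (\<forall>t \<in> Omega I. prob I t = prob J t)"
proof -
  obtain ts us where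
    "nat_code (nX I) @ nat_code (nY I) @ nat_code (nZ I) @ concat (map (entry_code (prob I)) ts) =
     nat_code (nX J) @ nat_code (nY J) @ nat_code (nZ J) @ concat (map (entry_code (prob J)) us)"
    and "set ts = Omega I" "set us = Omega J"
    using assms unfolding instance_codes_def by auto
  then show ?thesis
    using nat_code_append_inj entries_code_inj by metis
qed

lemma single_valued_MinDim: "single_valued MinDim"
proof (rule single_valuedI)
  fix w a b
  assume "(w, a) \<in> MinDim" "(w, b) \<in> MinDim"
  then obtain I J where "w \<in> instance_codes I" "w \<in> instance_codes J"
    and ab: "a = value_code (min_dim I)" "b = value_code (min_dim J)"
    unfolding MinDim_def by auto
  then have "nX I = nX J" "nY I = nY J" "nZ I = nZ J" "Omega I = Omega J"
    "\<forall>t \<in> Omega I. prob I t = prob J t"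
    using instance_codes_unambiguous by blast+
  then have dims: "nX I = nX J" "nY I = nY J" "nZ I = nZ J"
    and om: "Omega I = Omega J" and pr: "\<forall>t \<in> Omega J. prob I t = prob J t"
    by auto
  have "(\<forall>(x, y, z) \<in> Omega I. of_rat (prob I (x, y, z)) = mat_trace (\<rho> x * E y z)) =
        (\<forall>(x, y, z) \<in> Omega J. of_rat (prob J (x, y, z)) = mat_trace (\<rho> x * E y z))" for \<rho> E
    unfolding om using pr by (intro ball_cong) auto
  then have "realizable I d = realizable J d" for d
    unfolding realizable_def dims by simp
  then show "a = b" by (simp add: ab min_dim_def)
qed

text \<open>Hence the quantification over oracles in \<open>NP_hard MinDim\<close> is not vacuous.\<close>

lemma ex_answers_MinDim: "\<exists>f. answers f MinDim"
proof
  show "answers (\<lambda>w. THE a. (w, a) \<in> MinDim) MinDim"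
    unfolding answers_def
    using single_valued_MinDim by (auto simp: single_valued_def intro!: the_equality)
qed

end

theory Submission
  imports Defs "HOL-Analysis.Euclidean_Space"
begin

text \<open>
  The accepting computations of a polynomial-time verifier on \<open>(w, c)\<close>, with the witness \<open>c\<close>
  unknown, are the solutions of a uniform family of disjunctions of at most four literals: stacks
  are written with the top at position 0, so a time step only shifts them. This tableau is
  turned directly into an instance with five outcomes that is realisable in dimension 2 iff
  the tableau is satisfiable.

  In dimension 2 write a positive semidefinite matrix as \<open>(t + r \<cdot> \<sigma>) / 2\<close> with
  \<open>|r| \<le> t\<close>. If a state with Bloch vector \<open>r\<close> gives outcome \<open>z\<close> probability 0, then the effect
  of \<open>z\<close> has Bloch vector \<open>- t\<^sub>z r\<close>. Requiring probability 0 for five states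
  \<open>r\<^sub>1, \<dots>, r\<^sub>5\<close> and the five outcomes of one measurement therefore gives
  \<open>\<Sum> t\<^sub>z = 2\<close> and \<open>\<Sum> t\<^sub>z r\<^sub>z = 0\<close>. For the states \<open>x', x, x, x, x\<close> this means that \<open>x\<close> and \<open>x'\<close> are
  pure and opposite to each other; this is negation. Two such pairs at right angles serve as a
  frame, and probability \<open>1/2\<close> with respect to both of them forces the state of every variable
  onto one common axis. For states on the axis the five zeros say that they are not all equal, so
  with a constant false literal among them they express a disjunction of the other four.
\<close>

section \<open>Structured programs for the stack machine\<close>

text \<open>Dimensions below 2 are excluded by any five zeros, so the optimum is 2 exactly when the
  tableau is satisfiable, and comparing the answer to one query with 2 suffices. The number five
  comes from the longest disjunction, that for a pop on an empty stack: its label, the absence of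
  either bit on top, and the successor make four literals, and the constant false is the fifth. Each
  clause has its own measurement, so clauses interact through the states only. Without a common
  axis, five zeros would merely put the origin into the convex hull of the Bloch vectors, as with
  three vectors at angles of 120 degrees. The frame removes this freedom; the first effect of each
  of its two measurements is forced to be a projector, which is why probability 1/2 means a right
  angle. The instance must be written by a stack machine. Therefore the number of a state or
  measurement spells out unary coordinates in its bits, and the instance announces 2^N - 1 of each:
  a huge number with a code of linear length. As an encoding lists every entry once, each variable
  is declared by exactly one block.\<close>

type_synonym store = "nat \<Rightarrow> bool list"

datatype com =
    Skip
  | PushC nat bool
  | Seq com com
  | IfPop nat com com com
  | Loop nat com com

inductive big :: "com \<Rightarrow> store \<Rightarrow> nat \<Rightarrow> store \<Rightarrow> bool" where
  big_Skip: "big Skip s 0 s"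
| big_Push: "big (PushC r b) s 1 (s(r := b # s r))"
| big_Seq: "big c s m s' \<Longrightarrow> big d s' n s'' \<Longrightarrow> big (Seq c d) s (m + n) s''"
| big_If_Nil: "s r = [] \<Longrightarrow> big ce s n s' \<Longrightarrow> big (IfPop r ce cf ct) s (Suc n) s'"
| big_If_Cons: "s r = b # w \<Longrightarrow> big (if b then ct else cf) (s(r := w)) n s' \<Longrightarrow>
    big (IfPop r ce cf ct) s (Suc n) s'"
| big_Loop_Nil: "s r = [] \<Longrightarrow> big (Loop r cf ct) s 1 s"
| big_Loop_Cons: "s r = b # w \<Longrightarrow> big (if b then ct else cf) (s(r := w)) m s' \<Longrightarrow>
    big (Loop r cf ct) s' n s'' \<Longrightarrow> big (Loop r cf ct) s (Suc (m + n)) s''"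

fun size_com :: "com \<Rightarrow> nat" where
  "size_com Skip = 0"
| "size_com (PushC r b) = 1"
| "size_com (Seq c d) = size_com c + size_com d"
| "size_com (IfPop r ce cf ct) = Suc (size_com ce + size_com cf + size_com ct)"
| "size_com (Loop r cf ct) = Suc (size_com cf + size_com ct)"

text \<open>There is no jump instruction, so code is generated relative to the label at which it is
  to continue; code of size 0 is entered at that label.\<close>

definition entry :: "com \<Rightarrow> nat \<Rightarrow> nat \<Rightarrow> nat" where
  "entry c off nxt = (if size_com c = 0 then nxt else off)"

fun comp :: "com \<Rightarrow> nat \<Rightarrow> nat \<Rightarrow> instr list" where
  "comp Skip off nxt = []"
| "comp (PushC r b) off nxt = [Push r b nxt]"
| "comp (Seq c d) off nxt =
     (let m = off + size_com c in comp c off (entry d m nxt) @ comp d m nxt)"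
| "comp (IfPop r ce cf ct) off nxt =
     (let o1 = Suc off; o2 = o1 + size_com ce; o3 = o2 + size_com cf in
      Pop r (entry ce o1 nxt) (entry cf o2 nxt) (entry ct o3 nxt) #
      comp ce o1 nxt @ comp cf o2 nxt @ comp ct o3 nxt)"
| "comp (Loop r cf ct) off nxt =
     (let o1 = Suc off; o2 = o1 + size_com cf in
      Pop r nxt (entry cf o1 off) (entry ct o2 off) # comp cf o1 off @ comp ct o2 off)"

lemma length_comp [simp]: "length (comp c off nxt) = size_com c"
  by (induction c off nxt rule: comp.induct) (auto simp: Let_def)

definition code_at :: "program \<Rightarrow> nat \<Rightarrow> instr list \<Rightarrow> bool" where
  "code_at P off is \<longleftrightarrow> off + length is \<le> length P \<and> (\<forall>j<length is. P ! (off + j) = is ! j)"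

lemma code_at_append:
  "code_at P off (xs @ ys) \<longleftrightarrow> code_at P off xs \<and> code_at P (off + length xs) ys"
proof
  assume a: "code_at P off (xs @ ys)"
  have "P ! (off + j) = xs ! j" if "j < length xs" for j
    using a that by (auto simp: code_at_def nth_append dest!: spec[of _ j])
  moreover have "P ! (off + length xs + j) = ys ! j" if "j < length ys" for j
    using a that by (auto simp: code_at_def nth_append add.assoc dest!: spec[of _ "length xs + j"])
  ultimately show "code_at P off xs \<and> code_at P (off + length xs) ys"
    using a by (auto simp: code_at_def)
next
  assume a: "code_at P off xs \<and> code_at P (off + length xs) ys"
  have "P ! (off + j) = (xs @ ys) ! j" if "j < length (xs @ ys)" for j
  proof (cases "j < length xs")
    case True
    with a show ?thesis by (auto simp: code_at_def nth_append)
  next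
    case False
    then have "P ! (off + length xs + (j - length xs)) = ys ! (j - length xs)"
      using a that unfolding code_at_def by (metis add_diff_inverse_nat length_append nat_add_left_cancel_less)
    with False show ?thesis by (simp add: nth_append)
  qed
  with a show "code_at P off (xs @ ys)" by (auto simp: code_at_def)
qed

lemma code_at_Cons:
  "code_at P off (x # ys) \<longleftrightarrow> off < length P \<and> P ! off = x \<and> code_at P (Suc off) ys"
  using code_at_append[of P off "[x]" ys] by (auto simp: code_at_def)

lemma step_code: "code_at P off (x # ys) \<Longrightarrow> step f P (off, s) = exec f x (off, s)"
  by (simp add: code_at_Cons step_def)

lemma entry_Seq: "entry (Seq c d) off nxt = entry c off (entry d (off + size_com c) nxt)"
  by (auto simp: entry_def)

text \<open>Sequencing and returning to a loop head are free because labels are passed down, so the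
  step counts agree exactly. Compiled code consists of pushes and pops, so the oracle
  \<open>f\<close> is arbitrary.\<close>

lemma comp_correct:
  assumes "big c s n s'" "code_at P off (comp c off nxt)"
  shows "(step f P ^^ n) (entry c off nxt, s) = (nxt, s')"
  using assms
proof (induction arbitrary: off nxt rule: big.induct)
  case (big_Skip s)
  then show ?case by (simp add: entry_def)
next
  case (big_Push r b s)
  then show ?case by (simp add: entry_def step_code fun_upd_def)
next
  case (big_Seq c s m s' d n s'')
  then show ?case
    by (simp add: entry_Seq Let_def code_at_append funpow_add add.commute[of m])
next
  case (big_If_Nil s r ce n s' cf ct)
  then have "(step f P ^^ n) (entry ce (Suc off) nxt, s) = (nxt, s')"
    by (simp add: Let_def code_at_append code_at_Cons)
  moreover have "step f P (off, s) = (entry ce (Suc off) nxt, s)"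
    using big_If_Nil by (simp add: Let_def step_code)
  ultimately show ?case by (simp add: entry_def[of "IfPop r ce cf ct"] funpow_swap1)
next
  case (big_If_Cons s r b w ct cf n s' ce)
  let ?c = "if b then ct else cf"
  let ?o = "if b then Suc off + size_com ce + size_com cf else Suc off + size_com ce"
  have "(step f P ^^ n) (entry ?c ?o nxt, s(r := w)) = (nxt, s')"
    using big_If_Cons.prems by (intro big_If_Cons.IH) (simp add: Let_def code_at_append code_at_Cons)
  moreover have "step f P (off, s) = (entry ?c ?o nxt, s(r := w))"
    using big_If_Cons by (simp add: Let_def step_code)
  ultimately show ?case by (simp add: entry_def[of "IfPop r ce cf ct"] funpow_swap1)
next
  case (big_Loop_Nil s r cf ct)
  then show ?case by (simp add: Let_def step_code entry_def[of "Loop r cf ct"])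
next
  case (big_Loop_Cons s r b w ct cf m s' n s'')
  let ?c = "if b then ct else cf"
  let ?o = "if b then Suc off + size_com cf else Suc off"
  have "(step f P ^^ m) (entry ?c ?o off, s(r := w)) = (off, s')"
    using big_Loop_Cons.prems by (intro big_Loop_Cons.IH) (simp add: Let_def code_at_append code_at_Cons)
  moreover have "(step f P ^^ n) (off, s') = (nxt, s'')"
    using big_Loop_Cons.IH(2)[OF big_Loop_Cons.prems] by (simp add: entry_def)
  moreover have "step f P (off, s) = (entry ?c ?o off, s(r := w))"
    using big_Loop_Cons by (simp add: Let_def step_code)
  ultimately show ?case
    by (simp add: entry_def[of "Loop r cf ct"] funpow_swap1 funpow_add add.commute[of m])
qed

section \<open>Running time bounds\<close>

definition runs :: "com \<Rightarrow> store \<Rightarrow> store \<Rightarrow> nat \<Rightarrow> bool" where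
  "runs c s s' B \<longleftrightarrow> (\<exists>n\<le>B. big c s n s')"

lemma runs_mono: "runs c s s' B \<Longrightarrow> B \<le> B' \<Longrightarrow> runs c s s' B'"
  unfolding runs_def using le_trans by blast

lemma runs_Skip: "runs Skip s s B"
  unfolding runs_def using big_Skip by blast

lemma runs_Push: "s' = s(r := b # s r) \<Longrightarrow> 1 \<le> B \<Longrightarrow> runs (PushC r b) s s' B"
  unfolding runs_def using big_Push by blast

lemma runs_Seq: "runs c s s' A \<Longrightarrow> runs d s' s'' B \<Longrightarrow> A + B \<le> C \<Longrightarrow> runs (Seq c d) s s'' C"
  unfolding runs_def using big_Seq by (meson add_mono le_trans)

lemma runs_IfPop:
  assumes "runs (case s r of [] \<Rightarrow> ce | b # w \<Rightarrow> if b then ct else cf) (s(r := tl (s r))) s' B" "Suc B \<le> C"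
  shows "runs (IfPop r ce cf ct) s s' C"
proof (cases "s r")
  case Nil
  with assms(1) have "runs ce s s' B" by (simp add: fun_upd_idem)
  then show ?thesis unfolding runs_def using big_If_Nil[of s r ce _ s' cf ct] Nil assms(2)
    by (meson Suc_le_mono le_trans)
next
  case (Cons b w)
  with assms(1) have "runs (if b then ct else cf) (s(r := w)) s' B" by simp
  then show ?thesis unfolding runs_def using big_If_Cons[of s r b w ct cf _ s' ce] Cons assms(2)
    by (meson Suc_le_mono le_trans)
qed

text \<open>The family \<open>\<sigma>\<close> gives the store at the head of round
  \<open>k\<close>. The induction is on the number \<open>j\<close> of remaining rounds, since
  \<open>big_Loop_Cons\<close> peels off the first of them.\<close>

lemma runs_Loop_drop:
  assumes "\<And>k. k \<le> length xs \<Longrightarrow> \<sigma> k r = drop k xs"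
    and "\<And>k. k < length xs \<Longrightarrow>
      runs (if xs ! k then ct else cf) ((\<sigma> k)(r := drop (Suc k) xs)) (\<sigma> (Suc k)) B"
    and "j \<le> length xs"
  shows "runs (Loop r cf ct) (\<sigma> (length xs - j)) (\<sigma> (length xs)) (Suc (j * Suc B))"
  using assms(3)
proof (induction j)
  case 0
  have "\<sigma> (length xs) r = []" using assms(1)[of "length xs"] by simp
  then show ?case unfolding runs_def using big_Loop_Nil by fastforce
next
  case (Suc j)
  let ?k = "length xs - Suc j"
  from Suc.prems have k: "?k < length xs" "Suc ?k = length xs - j" by auto
  obtain m where m: "m \<le> B"
    "big (if xs ! ?k then ct else cf) ((\<sigma> ?k)(r := drop (Suc ?k) xs)) m (\<sigma> (Suc ?k))"
    using assms(2)[OF k(1)] unfolding runs_def by blast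
  obtain n where n: "n \<le> Suc (j * Suc B)"
    "big (Loop r cf ct) (\<sigma> (Suc ?k)) n (\<sigma> (length xs))"
    using Suc k(2) unfolding runs_def by auto
  have "\<sigma> ?k r = xs ! ?k # drop (Suc ?k) xs"
    using assms(1)[of ?k] k(1) by (simp add: Cons_nth_drop_Suc)
  from big_Loop_Cons[OF this m(2) n(2)] have
    "big (Loop r cf ct) (\<sigma> ?k) (Suc (m + n)) (\<sigma> (length xs))" .
  moreover have "Suc (m + n) \<le> Suc (Suc j * Suc B)" using m(1) n(1) by simp
  ultimately show ?case unfolding runs_def by blast
qed

lemma runs_Loop:
  assumes "s = \<sigma> 0" "s' = \<sigma> (length xs)"
    and "\<And>k. k \<le> length xs \<Longrightarrow> \<sigma> k r = drop k xs"
    and "\<And>k. k < length xs \<Longrightarrow>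
      runs (if xs ! k then ct else cf) ((\<sigma> k)(r := drop (Suc k) xs)) (\<sigma> (Suc k)) B"
    and "Suc (length xs * Suc B) \<le> C"
  shows "runs (Loop r cf ct) s s' C"
  using runs_Loop_drop[of xs \<sigma> r ct cf B "length xs"] assms(1-4)
  by (auto intro: runs_mono[OF _ assms(5)])

abbreviation ones :: "nat \<Rightarrow> bool list" where
  "ones n \<equiv> replicate n True"

lemma runs_Loop_ones:
  assumes "s = \<sigma> 0" "s' = \<sigma> n"
    and "\<And>k. k \<le> n \<Longrightarrow> \<sigma> k r = ones (n - k)"
    and "\<And>k. k < n \<Longrightarrow> runs c ((\<sigma> k)(r := ones (n - Suc k))) (\<sigma> (Suc k)) B"
    and "Suc (n * Suc B) \<le> C"
  shows "runs (Loop r c c) s s' C"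
  by (rule runs_Loop[where xs="ones n" and \<sigma>=\<sigma> and B=B]) (use assms in auto)

section \<open>Arithmetic on unary counters\<close>

abbreviation loop1 :: "nat \<Rightarrow> com \<Rightarrow> com" where
  "loop1 r c \<equiv> Loop r c c"

definition move :: "nat \<Rightarrow> nat \<Rightarrow> com" where
  "move r r' = loop1 r (PushC r' True)"

text \<open>Reading a stack destroys it, so a second copy is made on scratch stack 10, from which
  \<open>r\<close> is restored.\<close>

definition dup :: "nat \<Rightarrow> nat \<Rightarrow> com" where
  "dup r r' = Seq (loop1 r (Seq (PushC 10 True) (PushC r' True))) (move 10 r)"

text \<open>The product is collected on stack 11 because \<open>acc\<close> itself controls the
  loop.\<close>

definition mul :: "nat \<Rightarrow> nat \<Rightarrow> com" where
  "mul src acc = Seq (loop1 acc (dup src 11)) (move 11 acc)"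

fun push_ones :: "nat \<Rightarrow> nat \<Rightarrow> com" where
  "push_ones r 0 = Skip"
| "push_ones r (Suc n) = Seq (push_ones r n) (PushC r True)"

text \<open>Coefficients come lowest first, so the tail is evaluated before the multiplication; on
  \<open>coeffs p\<close> this yields the value of \<open>p\<close> in unary.\<close>

fun horner :: "nat \<Rightarrow> nat \<Rightarrow> nat list \<Rightarrow> com" where
  "horner src acc [] = Skip"
| "horner src acc (a # as) = Seq (horner src acc as) (Seq (mul src acc) (push_ones acc a))"

definition hval :: "nat list \<Rightarrow> nat \<Rightarrow> nat" where
  "hval as = foldr (\<lambda>a f x. a + x * f x) as (\<lambda>x. 0)"

fun hcost :: "nat list \<Rightarrow> nat \<Rightarrow> nat" where
  "hcost [] m = 0"
| "hcost (a # as) m = hcost as m + (hval as m * (7 * m + 3) + 2) + a"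

lemma hval_coeffs: "hval (coeffs p) = poly p"
  by (induction p) (auto simp: hval_def cCons_def fun_eq_iff)

lemma runs_move:
  assumes "s r = ones n" "r \<noteq> r'" "2 * n + 1 \<le> B"
  shows "runs (move r r') s (s(r := [], r' := ones n @ s r')) B"
  unfolding move_def
  by (rule runs_Loop_ones[where \<sigma>="\<lambda>k. s(r := ones (n - k), r' := ones k @ s r')" and n=n and B=1])
    (use assms in \<open>auto simp: fun_eq_iff intro!: runs_Push\<close>)

lemma runs_dup:
  assumes "s r = ones n" "s 10 = []" "r \<noteq> r'" "r \<noteq> 10" "r' \<noteq> 10" "5 * n + 2 \<le> B"
  shows "runs (dup r r') s (s(r' := ones n @ s r')) B"
  unfolding dup_def
proof (rule runs_Seq)
  let ?s = "s(r := [], 10 := ones n, r' := ones n @ s r')"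
  show "runs (loop1 r (Seq (PushC 10 True) (PushC r' True))) s ?s (3 * n + 1)"
    by (rule runs_Loop_ones[where \<sigma>="\<lambda>k. s(r := ones (n - k), 10 := ones k, r' := ones k @ s r')"
          and n=n and B=2])
      (use assms in \<open>auto simp: fun_eq_iff intro!: runs_Seq[OF runs_Push[OF refl] runs_Push]\<close>)
  have "runs (move 10 r) ?s (?s(10 := [], r := ones n @ ?s r)) (2 * n + 1)"
    by (rule runs_move) (use assms in auto)
  also have "?s(10 := [], r := ones n @ ?s r) = s(r' := ones n @ s r')"
    using assms by (auto simp: fun_eq_iff)
  finally show "runs (move 10 r) ?s \<dots> (2 * n + 1)" .
qed (use assms in simp)

lemma runs_mul:
  assumes "s src = ones m" "s acc = ones v" "s 10 = []" "s 11 = []"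
    and "src \<noteq> acc" "src \<notin> {10, 11}" "acc \<notin> {10, 11}" "v * (7 * m + 3) + 2 \<le> B"
  shows "runs (mul src acc) s (s(acc := ones (v * m))) B"
  unfolding mul_def
proof (rule runs_Seq)
  let ?s = "s(acc := [], 11 := ones (v * m))"
  show "runs (loop1 acc (dup src 11)) s ?s (v * (5 * m + 3) + 1)"
  proof (rule runs_Loop_ones[where \<sigma>="\<lambda>k. s(acc := ones (v - k), 11 := ones (k * m))"
          and n=v and B="5 * m + 2"])
    fix k assume "k < v"
    let ?t = "s(acc := ones (v - Suc k), 11 := ones (k * m))"
    have "runs (dup src 11) ?t (?t(11 := ones m @ ?t 11)) (5 * m + 2)"
      by (rule runs_dup) (use assms in auto)
    then show "runs (dup src 11) ((s(acc := ones (v - k), 11 := ones (k * m)))(acc := ones (v - Suc k)))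
        (s(acc := ones (v - Suc k), 11 := ones (Suc k * m))) (5 * m + 2)"
      using assms by (simp add: fun_upd_twist replicate_add)
  qed (use assms in \<open>auto simp: add_mult_distrib2\<close>)
  have "runs (move 11 acc) ?s (?s(11 := [], acc := ones (v * m) @ ?s acc)) (2 * (v * m) + 1)"
    by (rule runs_move) (use assms in auto)
  also have "?s(11 := [], acc := ones (v * m) @ ?s acc) = s(acc := ones (v * m))"
    using assms by (auto simp: fun_eq_iff)
  finally show "runs (move 11 acc) ?s \<dots> (2 * (v * m) + 1)" .
qed (use assms in \<open>simp add: algebra_simps\<close>)

lemma runs_push_ones: "n \<le> B \<Longrightarrow> runs (push_ones r n) s (s(r := ones n @ s r)) B"
proof (induction n arbitrary: B)
  case 0
  then show ?case by (simp add: runs_Skip)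
next
  case (Suc n)
  from Suc.prems show ?case
    by (auto intro!: runs_Seq[OF Suc.IH[OF order_refl] runs_Push[OF _ order_refl]])
qed

lemma runs_horner:
  assumes "s src = ones m" "s acc = []" "s 10 = []" "s 11 = []"
    and "src \<noteq> acc" "src \<notin> {10, 11}" "acc \<notin> {10, 11}" "hcost as m \<le> B"
  shows "runs (horner src acc as) s (s(acc := ones (hval as m))) B"
  using assms(8)
proof (induction as arbitrary: B)
  case Nil
  have "s(acc := ones (hval [] m)) = s" using assms(2) by (auto simp: hval_def)
  then show ?case by (simp add: runs_Skip)
next
  case (Cons a as)
  let ?s = "s(acc := ones (hval as m))"
  have "runs (mul src acc) ?s (?s(acc := ones (hval as m * m))) (hval as m * (7 * m + 3) + 2)"
    by (rule runs_mul) (use assms in auto)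
  moreover have "runs (push_ones acc a) (?s(acc := ones (hval as m * m)))
      (s(acc := ones (hval (a # as) m))) a"
    using runs_push_ones[of a a acc "s(acc := ones (hval as m * m))"]
    by (simp add: hval_def replicate_add mult.commute)
  ultimately have "runs (Seq (mul src acc) (push_ones acc a)) ?s (s(acc := ones (hval (a # as) m)))
      (hval as m * (7 * m + 3) + 2 + a)"
    by (rule runs_Seq) simp
  then show ?case
    unfolding horner.simps by (rule runs_Seq[OF Cons.IH[OF order_refl]]) (use Cons.prems in simp)
qed

section \<open>Output\<close>

text \<open>A template of output text; \<open>TokI\<close> and \<open>TokT\<close> stand for the unary contents of the
  counter stacks 2 and 3, written as fields of \<open>field_code\<close>. Output goes to stack 13.\<close>

datatype tok = Bit bool | TokI | TokT

fun render_tok :: "nat \<Rightarrow> nat \<Rightarrow> tok \<Rightarrow> bool list" where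
  "render_tok i t (Bit b) = [b]"
| "render_tok i t TokI = ones (2 * i)"
| "render_tok i t TokT = ones (2 * t)"

definition render :: "nat \<Rightarrow> nat \<Rightarrow> tok list \<Rightarrow> bool list" where
  "render i t xs = concat (map (render_tok i t) xs)"

definition emit_counter :: "nat \<Rightarrow> com" where
  "emit_counter r = Seq (loop1 r (Seq (PushC 4 True) (Seq (PushC 13 True) (PushC 13 True)))) (move 4 r)"

fun emit_tok :: "tok \<Rightarrow> com" where
  "emit_tok (Bit b) = PushC 13 b"
| "emit_tok TokI = emit_counter 2"
| "emit_tok TokT = emit_counter 3"

text \<open>The top of the output stack is the beginning of the text, so everything is written from
  back to front.\<close>

fun emit :: "tok list \<Rightarrow> com" where
  "emit [] = Skip"
| "emit (x # xs) = Seq (emit xs) (emit_tok x)"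

lemma runs_emit_counter:
  assumes "s r = ones n" "s 4 = []" "r \<noteq> 13" "r \<noteq> 4" "6 * n + 2 \<le> B"
  shows "runs (emit_counter r) s (s(13 := ones (2 * n) @ s 13)) B"
  unfolding emit_counter_def
proof (rule runs_Seq)
  let ?s = "s(r := [], 4 := ones n, 13 := ones (2 * n) @ s 13)"
  show "runs (loop1 r (Seq (PushC 4 True) (Seq (PushC 13 True) (PushC 13 True)))) s ?s (4 * n + 1)"
    by (rule runs_Loop_ones[where \<sigma>="\<lambda>k. s(r := ones (n - k), 4 := ones k, 13 := ones (2 * k) @ s 13)"
          and n=n and B=3])
      (use assms in \<open>auto simp: fun_eq_iff
         intro!: runs_Seq[OF runs_Push[OF refl] runs_Seq[OF runs_Push[OF refl] runs_Push]]\<close>)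
  have "runs (move 4 r) ?s (?s(4 := [], r := ones n @ ?s r)) (2 * n + 1)"
    by (rule runs_move) (use assms in auto)
  also have "?s(4 := [], r := ones n @ ?s r) = s(13 := ones (2 * n) @ s 13)"
    using assms by (auto simp: fun_eq_iff)
  finally show "runs (move 4 r) ?s \<dots> (2 * n + 1)" .
qed (use assms in simp)

lemma runs_emit:
  assumes "s 2 = ones i" "s 3 = ones t" "s 4 = []" "length xs * (6 * (i + t) + 2) \<le> B"
  shows "runs (emit xs) s (s(13 := render i t xs @ s 13)) B"
  using assms(4)
proof (induction xs arbitrary: B)
  case Nil
  then show ?case by (simp add: render_def runs_Skip)
next
  case (Cons x xs)
  let ?s = "s(13 := render i t xs @ s 13)"
  have "runs (emit_tok x) ?s (?s(13 := render_tok i t x @ ?s 13)) (6 * (i + t) + 2)"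
  proof (cases x)
    case (Bit b)
    then show ?thesis by (auto intro: runs_Push)
  next
    case TokI
    have "runs (emit_counter 2) ?s (?s(13 := ones (2 * i) @ ?s 13)) (6 * (i + t) + 2)"
      by (rule runs_emit_counter) (use assms in auto)
    with TokI show ?thesis by simp
  next
    case TokT
    have "runs (emit_counter 3) ?s (?s(13 := ones (2 * t) @ ?s 13)) (6 * (i + t) + 2)"
      by (rule runs_emit_counter) (use assms in auto)
    with TokT show ?thesis by simp
  qed
  then have "runs (emit_tok x) ?s (s(13 := render i t (x # xs) @ s 13)) (6 * (i + t) + 2)"
    by (simp add: render_def)
  then show ?case
    unfolding emit.simps by (rule runs_Seq[OF Cons.IH[OF order_refl]]) (use Cons.prems in simp)
qed


section \<open>The generator\<close>

text \<open>Stack 0 holds the input, 13 the output, 2 and 3 are counters, 5 and 6 hold the number of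
  rounds, 7 the input length, 8 the bound on the witness length and 9 the sum of the two;
  4 and 10 to 12 are scratch.\<close>

definition count_input :: com where
  "count_input = Seq
     (Loop 0 (Seq (PushC 12 False) (Seq (PushC 7 True) (PushC 9 True)))
             (Seq (PushC 12 True) (Seq (PushC 7 True) (PushC 9 True))))
     (Loop 12 (PushC 0 False) (PushC 0 True))"

text \<open>Stacks 0 and 8 lose one element per round as long as they have any. An empty stack 0
  therefore marks a position behind the input, and an empty stack 8 a position not below the witness
  bound.\<close>

definition init_body :: "(nat \<Rightarrow> tok list) \<Rightarrow> com" where
  "init_body bt = Seq (emit (bt 5)) (Seq (IfPop 0 (emit (bt 8)) (emit (bt 7)) (emit (bt 6)))
     (Seq (IfPop 8 (emit (bt 9)) Skip Skip) (PushC 2 True)))"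

text \<open>The inner loop transfers its own bound unit by unit from stack 5 to stack 2, where it
  serves as the index; moving it back prepares both stacks for the next row.\<close>

definition row_body :: "(nat \<Rightarrow> tok list) \<Rightarrow> com" where
  "row_body bt = Seq (emit (bt 2)) (Seq (emit (bt 4))
     (Seq (loop1 5 (Seq (emit (bt 3)) (PushC 2 True))) (Seq (move 2 5) (PushC 3 True))))"

text \<open>The number of rounds is computed twice because the rows loop over stack 6 contains a
  loop over stack 5. The header, template 10, is emitted last so that it stands first.\<close>

definition generator :: "(nat \<Rightarrow> tok list) \<Rightarrow> nat list \<Rightarrow> nat list \<Rightarrow> com" where
  "generator bt p q = Seq count_input (Seq (horner 7 8 p) (Seq (dup 8 9)
     (Seq (horner 9 5 q) (Seq (horner 9 6 q) (Seq (emit (bt 0)) (Seq (loop1 5 (init_body bt))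
     (Seq (move 2 5) (Seq (loop1 6 (row_body bt)) (Seq (emit (bt 2)) (Seq (emit (bt 1))
     (emit (bt 10))))))))))))"

text \<open>A block \<open>(b, i, t)\<close> is template number \<open>b\<close> filled in with the counters \<open>i\<close> and \<open>t\<close>.\<close>

type_synonym block = "nat \<times> nat \<times> nat"

definition init_blocks :: "bool list \<Rightarrow> nat \<Rightarrow> nat \<Rightarrow> block list" where
  "init_blocks w m i = (if m \<le> i then [(9, i, 0)] else []) @
     [(if i < length w then if w ! i then 6 else 7 else 8, i, 0), (5, i, 0)]"

definition row_blocks :: "nat \<Rightarrow> nat \<Rightarrow> block list" where
  "row_blocks T t = map (\<lambda>i. (3, i, t)) (rev [0..<T]) @ [(4, 0, t), (2, 0, t)]"

text \<open>The order is that of the text, opposite to the order of emission. The separate block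
  \<open>(2, 0, T)\<close> declares the labels of the final time, which has no row.\<close>

definition all_blocks :: "bool list \<Rightarrow> nat \<Rightarrow> nat \<Rightarrow> block list" where
  "all_blocks w m T = [(1, 0, T), (2, 0, T)] @ concat (map (row_blocks T) (rev [0..<T])) @
     concat (map (init_blocks w m) (rev [0..<T])) @ [(0, 0, 0)]"

definition render_blocks :: "(nat \<Rightarrow> tok list) \<Rightarrow> block list \<Rightarrow> bool list" where
  "render_blocks bt bs = concat (map (\<lambda>(b, i, t). render i t (bt b)) bs)"

lemma render_blocks_simps [simp]:
  "render_blocks bt [] = []"
  "render_blocks bt ((b, i, t) # bs) = render i t (bt b) @ render_blocks bt bs"
  "render_blocks bt (bs @ cs) = render_blocks bt bs @ render_blocks bt cs"
  by (simp_all add: render_blocks_def)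

section \<open>Output and running time of the generator\<close>

lemma runs_count_input:
  assumes "s 0 = w" "s 7 = []" "s 9 = []" "s 12 = []" "6 * length w + 2 \<le> B"
  shows "runs count_input s (s(7 := ones (length w), 9 := ones (length w))) B"
  unfolding count_input_def
proof (rule runs_Seq)
  let ?n = "length w"
  let ?s = "s(0 := [], 12 := rev w, 7 := ones ?n, 9 := ones ?n)"
  show "runs (Loop 0 (Seq (PushC 12 False) (Seq (PushC 7 True) (PushC 9 True)))
             (Seq (PushC 12 True) (Seq (PushC 7 True) (PushC 9 True)))) s ?s (4 * ?n + 1)"
    by (rule runs_Loop[where \<sigma>="\<lambda>k. s(0 := drop k w, 12 := rev (take k w), 7 := ones k, 9 := ones k)"
          and xs=w and B=3])
      (use assms in \<open>auto simp: fun_eq_iff take_Suc_conv_app_nth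
         intro!: runs_Seq[OF runs_Push[OF refl] runs_Seq[OF runs_Push[OF refl] runs_Push]]\<close>)
  have "drop (?n - Suc k) w = rev w ! k # drop (?n - k) w" if "k < ?n" for k
    using that by (simp add: rev_nth Cons_nth_drop_Suc Suc_diff_Suc[symmetric] del: Suc_diff_Suc)
  then show "runs (Loop 12 (PushC 0 False) (PushC 0 True)) ?s
      (s(7 := ones ?n, 9 := ones ?n)) (2 * ?n + 1)"
    by (intro runs_Loop[where \<sigma>="\<lambda>k. s(0 := drop (?n - k) w, 12 := drop k (rev w), 7 := ones ?n, 9 := ones ?n)"
          and xs="rev w" and B=1])
      (use assms in \<open>auto simp: fun_eq_iff intro!: runs_Push\<close>)
qed (use assms in simp)


text \<open>Between the commands of the generator all scratch stacks are empty and all counters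
  unary. Stores of this shape are kept by every command and can be rewritten symbolically.\<close>

definition st :: "bool list \<Rightarrow> bool list \<Rightarrow> nat \<Rightarrow> nat \<Rightarrow> nat \<Rightarrow> nat \<Rightarrow> nat \<Rightarrow> nat \<Rightarrow> nat \<Rightarrow> store" where
  "st w out i t a b n m l = (\<lambda>_. [])(0 := w, 13 := out, 2 := ones i, 3 := ones t, 5 := ones a,
     6 := ones b, 7 := ones n, 8 := ones m, 9 := ones l)"

lemma st_apply [simp]:
  "st w out i t a b n m l 0 = w"
  "st w out i t a b n m l 13 = out"
  "st w out i t a b n m l 2 = ones i"
  "st w out i t a b n m l 3 = ones t"
  "st w out i t a b n m l 5 = ones a"
  "st w out i t a b n m l 6 = ones b"
  "st w out i t a b n m l 7 = ones n"
  "st w out i t a b n m l 8 = ones m"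
  "st w out i t a b n m l 9 = ones l"
  "st w out i t a b n m l 4 = []"
  "st w out i t a b n m l 10 = []"
  "st w out i t a b n m l 11 = []"
  "st w out i t a b n m l 12 = []"
  by (simp_all add: st_def)

lemma st_upd [simp]:
  "(st w out i t a b n m l)(0 := w') = st w' out i t a b n m l"
  "(st w out i t a b n m l)(13 := out') = st w out' i t a b n m l"
  "(st w out i t a b n m l)(2 := ones i') = st w out i' t a b n m l"
  "(st w out i t a b n m l)(3 := ones t') = st w out i t' a b n m l"
  "(st w out i t a b n m l)(5 := ones a') = st w out i t a' b n m l"
  "(st w out i t a b n m l)(6 := ones b') = st w out i t a b' n m l"
  "(st w out i t a b n m l)(7 := ones n') = st w out i t a b n' m l"
  "(st w out i t a b n m l)(8 := ones m') = st w out i t a b n m' l"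
  "(st w out i t a b n m l)(9 := ones l') = st w out i t a b n m l'"
  by (simp_all add: st_def fun_eq_iff)

lemma st_upd_Nil [simp]:
  "(st w out i t a b n m l)(2 := []) = st w out 0 t a b n m l"
  "(st w out i t a b n m l)(5 := []) = st w out i t 0 b n m l"
  "(st w out i t a b n m l)(8 := []) = st w out i t a b n 0 l"
  using st_upd(3,5,8)[of w out i t a b n m l 0] by simp_all

lemma st_upd_Cons [simp]:
  "(st w out i t a b n m l)(2 := True # ones i) = st w out (Suc i) t a b n m l"
  "(st w out i t a b n m l)(3 := True # ones t) = st w out i (Suc t) a b n m l"
  using st_upd(3)[of w out i t a b n m l "Suc i"] st_upd(4)[of w out i t a b n m l "Suc t"]
  by simp_all

lemma runs_st_Push2:
  "runs (PushC 2 True) (st w out i t a b n m l) (st w out (Suc i) t a b n m l) 1"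
  by (rule runs_Push) simp_all

lemma runs_st_Push3:
  "runs (PushC 3 True) (st w out i t a b n m l) (st w out i (Suc t) a b n m l) 1"
  by (rule runs_Push) simp_all

lemma runs_st_move:
  "runs (move 2 5) (st w out i t 0 b n m l) (st w out 0 t i b n m l) (2 * i + 1)"
  using runs_move[of "st w out i t 0 b n m l" 2 i 5, OF _ _ order_refl] by simp

lemma runs_st_emit:
  assumes "length (bt b') \<le> K" "i \<le> T" "t \<le> T"
  shows "runs (emit (bt b')) (st w (render_blocks bt bs) i t a b n m l)
    (st w (render_blocks bt ((b', i, t) # bs)) i t a b n m l) (K * (12 * T + 2))"
proof -
  have "length (bt b') * (6 * (i + t) + 2) \<le> K * (12 * T + 2)"
    using assms by (intro mult_mono) auto
  from runs_emit[of "st w (render_blocks bt bs) i t a b n m l" i t, OF _ _ _ this]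
  show ?thesis by simp
qed

lemma runs_init_loop:
  assumes K: "\<And>b. length (bt b) \<le> K"
  shows "runs (loop1 5 (init_body bt)) (st w (render_blocks bt bs) 0 0 T b n m l)
    (st (drop T w) (render_blocks bt (concat (map (init_blocks w m) (rev [0..<T])) @ bs)) T 0 0 b n
      (m - T) l) (Suc (T * Suc (3 * (K * (12 * T + 2)) + 3)))"
proof (rule runs_Loop_ones[where n=T and B="3 * (K * (12 * T + 2)) + 3"
      and \<sigma>="\<lambda>k. st (drop k w) (render_blocks bt (concat (map (init_blocks w m) (rev [0..<k])) @ bs))
        k 0 (T - k) b n (m - k) l"])
  fix k assume k: "k < T"
  let ?E = "K * (12 * T + 2)"
  let ?bs = "concat (map (init_blocks w m) (rev [0..<k])) @ bs"
  let ?b = "if k < length w then if w ! k then 6 else 7 else (8::nat)"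
  let ?s0 = "st (drop k w) (render_blocks bt ?bs) k 0 (T - Suc k) b n (m - k) l"
  let ?s1 = "st (drop k w) (render_blocks bt ((5, k, 0) # ?bs)) k 0 (T - Suc k) b n (m - k) l"
  let ?s2 = "st (drop (Suc k) w) (render_blocks bt ((?b, k, 0) # (5, k, 0) # ?bs)) k 0
    (T - Suc k) b n (m - k) l"
  let ?s3 = "st (drop (Suc k) w) (render_blocks bt (init_blocks w m k @ ?bs)) k 0
    (T - Suc k) b n (m - Suc k) l"
  let ?s4 = "st (drop (Suc k) w) (render_blocks bt (init_blocks w m k @ ?bs)) (Suc k) 0
    (T - Suc k) b n (m - Suc k) l"
  have r1: "runs (emit (bt 5)) ?s0 ?s1 ?E"
    by (rule runs_st_emit) (use K k in auto)
  have r2: "runs (IfPop 0 (emit (bt 8)) (emit (bt 7)) (emit (bt 6))) ?s1 ?s2 (Suc ?E)"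
  proof (rule runs_IfPop)
    have "runs (emit (bt ?b)) (?s1(0 := drop (Suc k) w)) ?s2 ?E"
      unfolding st_upd by (rule runs_st_emit) (use K k in auto)
    moreover have "(case drop k w of [] \<Rightarrow> emit (bt 8) | b # v \<Rightarrow> if b then emit (bt 6) else emit (bt 7))
        = emit (bt ?b)"
      by (cases "k < length w") (auto simp: Cons_nth_drop_Suc[symmetric])
    ultimately show "runs (case ?s1 0 of [] \<Rightarrow> emit (bt 8) | b # v \<Rightarrow> if b then emit (bt 6) else emit (bt 7))
        (?s1(0 := tl (?s1 0))) ?s2 ?E"
      by (simp only: st_apply drop_Suc tl_drop)
  qed simp
  have r3: "runs (IfPop 8 (emit (bt 9)) Skip Skip) ?s2 ?s3 (Suc ?E)"
  proof (cases "m \<le> k")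
    case True
    then have i: "init_blocks w m k = (9, k, 0) # [(?b, k, 0), (5, k, 0)]" and "m - k = 0" "m - Suc k = 0"
      by (simp_all add: init_blocks_def)
    have "runs (emit (bt 9)) ?s2 ?s3 ?E"
      unfolding i \<open>m - k = 0\<close> \<open>m - Suc k = 0\<close> append_Cons append_Nil
      by (rule runs_st_emit) (use K k in auto)
    with True show ?thesis by (auto intro!: runs_IfPop)
  next
    case False
    then have "m - k = Suc (m - Suc k)" and i: "init_blocks w m k = [(?b, k, 0), (5, k, 0)]"
      by (simp_all add: init_blocks_def)
    then show ?thesis
      by (intro runs_IfPop[where B=0]) (simp_all add: runs_Skip i)
  qed
  have "runs (init_body bt) ?s0 ?s4 (3 * ?E + 3)"
    unfolding init_body_def
    by (rule runs_Seq[OF r1 runs_Seq[OF r2 runs_Seq[OF r3 runs_st_Push2 order_refl] order_refl]]) simp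
  then show "runs (init_body bt) ((st (drop k w) (render_blocks bt ?bs) k 0 (T - k) b n (m - k) l)
      (5 := ones (T - Suc k)))
    (st (drop (Suc k) w) (render_blocks bt (concat (map (init_blocks w m) (rev [0..<Suc k])) @ bs))
        (Suc k) 0 (T - Suc k) b n (m - Suc k) l) (3 * ?E + 3)"
    by simp
qed auto

lemma runs_row:
  assumes K: "\<And>b. length (bt b) \<le> K" and t: "t \<le> T"
  shows "runs (row_body bt) (st w (render_blocks bt bs) 0 t T b n m l)
    (st w (render_blocks bt (row_blocks T t @ bs)) 0 (Suc t) T b n m l)
    (2 * (K * (12 * T + 2)) + T * (K * (12 * T + 2) + 2) + 2 * T + 3)"
proof -
  let ?E = "K * (12 * T + 2)"
  let ?bs = "(4, 0, t) # (2, 0, t) # bs"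
  have r1: "runs (emit (bt 2)) (st w (render_blocks bt bs) 0 t T b n m l)
      (st w (render_blocks bt ((2, 0, t) # bs)) 0 t T b n m l) ?E"
    by (rule runs_st_emit) (use K t in auto)
  have r2: "runs (emit (bt 4)) (st w (render_blocks bt ((2, 0, t) # bs)) 0 t T b n m l)
      (st w (render_blocks bt ?bs) 0 t T b n m l) ?E"
    by (rule runs_st_emit) (use K t in auto)
  have r3: "runs (loop1 5 (Seq (emit (bt 3)) (PushC 2 True))) (st w (render_blocks bt ?bs) 0 t T b n m l)
      (st w (render_blocks bt (row_blocks T t @ bs)) T t 0 b n m l) (Suc (T * Suc (?E + 1)))"
  proof (rule runs_Loop_ones[where n=T and B="?E + 1" and
        \<sigma>="\<lambda>k. st w (render_blocks bt (map (\<lambda>i. (3, i, t)) (rev [0..<k]) @ ?bs)) k t (T - k) b n m l"])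
    fix k assume k: "k < T"
    let ?cs = "map (\<lambda>i. (3, i, t)) (rev [0..<k]) @ ?bs"
    have "runs (Seq (emit (bt 3)) (PushC 2 True))
        (st w (render_blocks bt ?cs) k t (T - Suc k) b n m l)
        (st w (render_blocks bt ((3, k, t) # ?cs)) (Suc k) t (T - Suc k) b n m l) (?E + 1)"
      by (rule runs_Seq[OF runs_st_emit runs_st_Push2 order_refl]) (use K k t in auto)
    then show "runs (Seq (emit (bt 3)) (PushC 2 True))
        ((st w (render_blocks bt ?cs) k t (T - k) b n m l)(5 := ones (T - Suc k)))
        (st w (render_blocks bt (map (\<lambda>i. (3, i, t)) (rev [0..<Suc k]) @ ?bs)) (Suc k) t (T - Suc k) b n m l)
        (?E + 1)"
      by simp
  qed (auto simp: row_blocks_def)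
  show ?thesis
    unfolding row_body_def
    by (rule runs_Seq[OF r1 runs_Seq[OF r2 runs_Seq[OF r3 runs_Seq[OF runs_st_move runs_st_Push3
          order_refl] order_refl] order_refl]]) simp
qed

lemma runs_rows:
  assumes K: "\<And>b. length (bt b) \<le> K"
  shows "runs (loop1 6 (row_body bt)) (st w (render_blocks bt bs) 0 0 T T n m l)
    (st w (render_blocks bt (concat (map (row_blocks T) (rev [0..<T])) @ bs)) 0 T T 0 n m l)
    (Suc (T * Suc (2 * (K * (12 * T + 2)) + T * (K * (12 * T + 2) + 2) + 2 * T + 3)))"
proof (rule runs_Loop_ones[where n=T
      and \<sigma>="\<lambda>k. st w (render_blocks bt (concat (map (row_blocks T) (rev [0..<k])) @ bs)) 0 k T (T - k) n m l"])
  fix k assume k: "k < T"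
  let ?cs = "concat (map (row_blocks T) (rev [0..<k])) @ bs"
  have "runs (row_body bt) (st w (render_blocks bt ?cs) 0 k T (T - Suc k) n m l)
      (st w (render_blocks bt (row_blocks T k @ ?cs)) 0 (Suc k) T (T - Suc k) n m l)
      (2 * (K * (12 * T + 2)) + T * (K * (12 * T + 2) + 2) + 2 * T + 3)"
    by (rule runs_row) (use K k in auto)
  then show "runs (row_body bt) ((st w (render_blocks bt ?cs) 0 k T (T - k) n m l)(6 := ones (T - Suc k)))
      (st w (render_blocks bt (concat (map (row_blocks T) (rev [0..<Suc k])) @ bs)) 0 (Suc k) T (T - Suc k) n m l)
      (2 * (K * (12 * T + 2)) + T * (K * (12 * T + 2) + 2) + 2 * T + 3)"
    by simp
qed auto

definition generator_time :: "nat \<Rightarrow> nat list \<Rightarrow> nat list \<Rightarrow> nat \<Rightarrow> nat" where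
  "generator_time K p q n =
     (let m = hval p n; l = m + n; T = hval q l; E = K * (12 * T + 2) in
      (6 * n + 2) + hcost p n + (5 * m + 2) + hcost q l + hcost q l + E +
      Suc (T * Suc (3 * E + 3)) + (2 * T + 1) +
      Suc (T * Suc (2 * E + T * (E + 2) + 2 * T + 3)) + E + E + E)"

lemma runs_generator:
  fixes w :: "bool list" and p q :: "nat list"
  defines "m \<equiv> hval p (length w)"
  defines "T \<equiv> hval q (m + length w)"
  assumes K: "\<And>b. length (bt b) \<le> K"
  shows "\<exists>s'. runs (generator bt p q) ((\<lambda>_. [])(0 := w)) s' (generator_time K p q (length w)) \<and>
    s' 13 = render 0 T (bt 10) @ render_blocks bt (all_blocks w m T)"
proof -
  let ?n = "length w"
  let ?l = "m + ?n"
  let ?E = "K * (12 * T + 2)"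
  let ?is = "concat (map (init_blocks w m) (rev [0..<T])) @ [(0, 0, 0)]"
  let ?rs = "concat (map (row_blocks T) (rev [0..<T])) @ ?is"
  let ?rb = "render_blocks bt"
  have "(\<lambda>_. [])(0 := w) = st w [] 0 0 0 0 0 0 0" by (auto simp: st_def fun_eq_iff)
  then have r1: "runs count_input ((\<lambda>_. [])(0 := w)) (st w (?rb []) 0 0 0 0 ?n 0 ?n) (6 * ?n + 2)"
    using runs_count_input[of "st w [] 0 0 0 0 0 0 0" w, OF _ _ _ _ order_refl] by simp
  have r2: "runs (horner 7 8 p) (st w (?rb []) 0 0 0 0 ?n 0 ?n) (st w (?rb []) 0 0 0 0 ?n m ?n) (hcost p ?n)"
    using runs_horner[of "st w (?rb []) 0 0 0 0 ?n 0 ?n" 7 ?n 8 p, OF _ _ _ _ _ _ _ order_refl]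
    by (simp add: m_def)
  have r3: "runs (dup 8 9) (st w (?rb []) 0 0 0 0 ?n m ?n) (st w (?rb []) 0 0 0 0 ?n m ?l) (5 * m + 2)"
    using runs_dup[of "st w (?rb []) 0 0 0 0 ?n m ?n" 8 m 9, OF _ _ _ _ _ order_refl]
    by (simp add: replicate_add[symmetric])
  have r4: "runs (horner 9 5 q) (st w (?rb []) 0 0 0 0 ?n m ?l) (st w (?rb []) 0 0 T 0 ?n m ?l) (hcost q ?l)"
    using runs_horner[of "st w (?rb []) 0 0 0 0 ?n m ?l" 9 ?l 5 q, OF _ _ _ _ _ _ _ order_refl]
    by (simp add: T_def)
  have r5: "runs (horner 9 6 q) (st w (?rb []) 0 0 T 0 ?n m ?l) (st w (?rb []) 0 0 T T ?n m ?l) (hcost q ?l)"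
    using runs_horner[of "st w (?rb []) 0 0 T 0 ?n m ?l" 9 ?l 6 q, OF _ _ _ _ _ _ _ order_refl]
    by (simp add: T_def)
  have r6: "runs (emit (bt 0)) (st w (?rb []) 0 0 T T ?n m ?l) (st w (?rb [(0, 0, 0)]) 0 0 T T ?n m ?l) ?E"
    by (rule runs_st_emit) (use K in auto)
  let ?w = "drop T w" and ?m = "m - T"
  have r7: "runs (loop1 5 (init_body bt)) (st w (?rb [(0, 0, 0)]) 0 0 T T ?n m ?l)
      (st ?w (?rb ?is) T 0 0 T ?n ?m ?l) (Suc (T * Suc (3 * ?E + 3)))"
    by (rule runs_init_loop) (rule K)
  have r8: "runs (move 2 5) (st ?w (?rb ?is) T 0 0 T ?n ?m ?l) (st ?w (?rb ?is) 0 0 T T ?n ?m ?l) (2 * T + 1)"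
    by (rule runs_st_move)
  have r9: "runs (loop1 6 (row_body bt)) (st ?w (?rb ?is) 0 0 T T ?n ?m ?l)
      (st ?w (?rb ?rs) 0 T T 0 ?n ?m ?l) (Suc (T * Suc (2 * ?E + T * (?E + 2) + 2 * T + 3)))"
    by (rule runs_rows) (rule K)
  have r10: "runs (emit (bt 2)) (st ?w (?rb ?rs) 0 T T 0 ?n ?m ?l)
      (st ?w (?rb ((2, 0, T) # ?rs)) 0 T T 0 ?n ?m ?l) ?E"
    by (rule runs_st_emit) (use K in auto)
  have r11: "runs (emit (bt 1)) (st ?w (?rb ((2, 0, T) # ?rs)) 0 T T 0 ?n ?m ?l)
      (st ?w (?rb ((1, 0, T) # (2, 0, T) # ?rs)) 0 T T 0 ?n ?m ?l) ?E"
    by (rule runs_st_emit) (use K in auto)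
  have r12: "runs (emit (bt 10)) (st ?w (?rb ((1, 0, T) # (2, 0, T) # ?rs)) 0 T T 0 ?n ?m ?l)
      (st ?w (?rb ((10, 0, T) # (1, 0, T) # (2, 0, T) # ?rs)) 0 T T 0 ?n ?m ?l) ?E"
    by (rule runs_st_emit) (use K in auto)
  have "runs (generator bt p q) ((\<lambda>_. [])(0 := w))
    (st ?w (?rb ((10, 0, T) # (1, 0, T) # (2, 0, T) # ?rs)) 0 T T 0 ?n ?m ?l)
    (generator_time K p q (length w))"
    unfolding generator_def
    by (rule runs_Seq[OF r1 runs_Seq[OF r2 runs_Seq[OF r3 runs_Seq[OF r4 runs_Seq[OF r5 runs_Seq[OF r6
       runs_Seq[OF r7 runs_Seq[OF r8 runs_Seq[OF r9 runs_Seq[OF r10 runs_Seq[OF r11 r12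
       order_refl] order_refl] order_refl] order_refl] order_refl] order_refl] order_refl] order_refl]
       order_refl] order_refl]])
      (simp add: generator_time_def Let_def m_def[symmetric] T_def[symmetric])
  moreover have "st ?w (?rb ((10, 0, T) # (1, 0, T) # (2, 0, T) # ?rs)) 0 T T 0 ?n ?m ?l 13 =
      render 0 T (bt 10) @ ?rb (all_blocks w m T)"
    by (simp add: all_blocks_def)
  ultimately show ?thesis by blast
qed


section \<open>Polynomial bounds\<close>

definition polybounded :: "(nat \<Rightarrow> nat) \<Rightarrow> bool" where
  "polybounded f \<longleftrightarrow> (\<exists>p. \<forall>n. f n \<le> poly p n)"

lemma poly_nat_mono: "m \<le> n \<Longrightarrow> poly p m \<le> poly p (n :: nat)"
  by (induction p) (auto intro!: add_mono mult_mono)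

lemma polybounded_const: "polybounded (\<lambda>n. c)"
  unfolding polybounded_def by (intro exI[of _ "[:c:]"]) simp

lemma polybounded_id: "polybounded (\<lambda>n. n)"
  unfolding polybounded_def by (intro exI[of _ "[:0, 1:]"]) simp

lemma polybounded_add: "polybounded f \<Longrightarrow> polybounded g \<Longrightarrow> polybounded (\<lambda>n. f n + g n)"
  unfolding polybounded_def by (metis add_mono poly_add)

lemma polybounded_mult: "polybounded f \<Longrightarrow> polybounded g \<Longrightarrow> polybounded (\<lambda>n. f n * g n)"
  unfolding polybounded_def by (metis mult_le_mono poly_mult)

lemma polybounded_Suc: "polybounded f \<Longrightarrow> polybounded (\<lambda>n. Suc (f n))"
  using polybounded_add[OF _ polybounded_const[of 1]] by simp

lemma polybounded_comp:
  assumes "polybounded f" "polybounded g"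
  shows "polybounded (\<lambda>n. f (g n))"
proof -
  obtain p q where p: "\<forall>n. f n \<le> poly p n" and q: "\<forall>n. g n \<le> poly q n"
    using assms unfolding polybounded_def by blast
  have "f (g n) \<le> poly (pcompose p q) n" for n
    using p q poly_nat_mono by (metis le_trans poly_pcompose)
  then show ?thesis unfolding polybounded_def by blast
qed

lemmas polybounded_intros = polybounded_const polybounded_id polybounded_add polybounded_mult
  polybounded_Suc

lemma polybounded_hval: "polybounded (hval as)"
proof (induction as)
  case Nil
  show ?case by (simp add: hval_def polybounded_const)
next
  case (Cons a as)
  have "hval (a # as) = (\<lambda>n. a + n * hval as n)" by (simp add: hval_def)
  then show ?case using Cons by (auto intro!: polybounded_intros)
qed

lemma polybounded_hcost: "polybounded (hcost as)"
proof (induction as)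
  case Nil
  have "hcost [] = (\<lambda>n. 0)" by auto
  then show ?case by (simp add: polybounded_const)
next
  case (Cons a as)
  have "hcost (a # as) = (\<lambda>m. hcost as m + (hval as m * (7 * m + 3) + 2) + a)" by auto
  then show ?case using Cons by (auto intro!: polybounded_intros polybounded_hval)
qed

lemma polybounded_generator_time: "polybounded (generator_time K p q)"
proof -
  have l: "polybounded (\<lambda>n. hval p n + n)"
    by (intro polybounded_intros polybounded_hval)
  have T: "polybounded (\<lambda>n. hval q (hval p n + n))"
    by (rule polybounded_comp[OF polybounded_hval l])
  have c: "polybounded (\<lambda>n. hcost q (hval p n + n))"
    by (rule polybounded_comp[OF polybounded_hcost l])
  have "generator_time K p q = (\<lambda>n. generator_time K p q n)" by simp
  then show ?thesis
    unfolding generator_time_def Let_def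
    by (auto intro!: polybounded_intros polybounded_hval polybounded_hcost T c)
qed

section \<open>Names and entries\<close>

fun val :: "bool list \<Rightarrow> nat" where
  "val [] = 0"
| "val (b # bs) = of_bool b + 2 * val bs"

lemma bin_val: "bs = [] \<or> last bs \<Longrightarrow> bin (val bs) = bs"
proof (induction bs)
  case Nil
  show ?case by (simp add: bin.simps)
next
  case (Cons b bs)
  then have IH: "bin (val bs) = bs" by (cases bs) auto
  have "val (b # bs) \<noteq> 0"
  proof
    assume z: "val (b # bs) = 0"
    then have "bs = []" using IH by (simp add: bin.simps[of 0])
    with z Cons.prems show False by simp
  qed
  then have "bin (val (b # bs)) = odd (val (b # bs)) # bin (val (b # bs) div 2)"
    by (subst bin.simps) (simp only: if_False)
  moreover have "odd (val (b # bs)) = b" "val (b # bs) div 2 = val bs" by auto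
  ultimately show ?case using IH by (simp only:)
qed

lemma val_less: "val bs < 2 ^ length bs"
  by (induction bs) auto

lemma Suc_val_ones: "Suc (val (ones n)) = 2 ^ n"
  by (induction n) auto

lemma bin_val_ones: "bin (val (ones n)) = ones n"
  by (rule bin_val) (cases n; simp)

type_synonym name = "nat \<times> nat \<times> nat \<times> nat"

text \<open>The components of a name are its kind, an index and two coordinates (stack position and time).\<close>

fun name_bits :: "name \<Rightarrow> bool list" where
  "name_bits (k, a, i, t) =
     ones k @ False # ones a @ False # ones i @ False # ones (Suc t)"

definition code :: "name \<Rightarrow> nat" where
  "code n = val (name_bits n)"

text \<open>The last block \<open>ones (Suc t)\<close> of a name is nonempty, so the most
  significant bit is set. The binary form of the code is thus the coordinate string itself and can
  be written without arithmetic.\<close>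

lemma bin_code: "bin (code n) = name_bits n"
  unfolding code_def by (rule bin_val) (cases n; simp)

lemma ones_False_inj: "ones m @ False # u = ones n @ False # v \<longleftrightarrow> m = n \<and> u = v"
proof (induction m arbitrary: n)
  case 0
  then show ?case by (cases n) auto
next
  case (Suc m)
  then show ?case by (cases n) auto
qed

lemma name_bits_inj: "name_bits n = name_bits n' \<Longrightarrow> n = n'"
  by (cases n; cases n') (simp add: ones_False_inj del: replicate_Suc)

lemma code_eq_iff [simp]: "code m = code n \<longleftrightarrow> m = n"
  using bin_code name_bits_inj by metis

lemma code_pos: "1 \<le> code n"
proof -
  have "bin (code n) \<noteq> []" unfolding bin_code by (cases n) simp
  then show ?thesis by (cases "code n") (auto simp: bin.simps[of 0])
qed

lemma code_le: "length (name_bits n) \<le> N \<Longrightarrow> code n \<le> val (ones N)"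
  using val_less[of "name_bits n"] power_increasing[of "length (name_bits n)" N "2::nat"]
  by (simp add: code_def Suc_val_ones[symmetric])

text \<open>An entry \<open>(x, y, z, h)\<close> requires outcome \<open>z\<close> of measurement \<open>y\<close> on state \<open>x\<close> to have
  probability \<open>1/2\<close> if \<open>h\<close> holds, and \<open>0\<close> otherwise.\<close>

type_synonym entry = "name \<times> name \<times> nat \<times> bool"

fun entry_key :: "entry \<Rightarrow> name \<times> name \<times> nat" where
  "entry_key (x, y, z, h) = (x, y, z)"

fun entry_pos :: "entry \<Rightarrow> nat \<times> nat \<times> nat" where
  "entry_pos (x, y, z, h) = (code x, code y, z)"

definition half_if :: "bool \<Rightarrow> rat" where
  "half_if h = (if h then 1 / 2 else 0)"

text \<open>\<open>val (ones N)\<close> is \<open>2 ^ N - 1\<close>: it bounds all codes of at most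
  \<open>N\<close> bits, and its binary form \<open>ones N\<close> can be written from unary
  counters. Numbers that are the code of no name occur in no entry.\<close>

definition instance_of :: "entry list \<Rightarrow> nat \<Rightarrow> mindim_instance" where
  "instance_of es N = \<lparr>nX = val (ones N), nY = val (ones N), nZ = 5, Omega = entry_pos ` set es,
     prob = (\<lambda>(x, y, z). half_if (\<exists>x' y'. (x', y', z, True) \<in> set es \<and> x = code x' \<and> y = code y'))\<rparr>"

fun entry_text :: "entry \<Rightarrow> bool list" where
  "entry_text (x, y, z, h) = nat_code (code x) @ nat_code (code y) @ nat_code z @ rat_code (half_if h)"

definition instance_text :: "entry list \<Rightarrow> nat \<Rightarrow> bool list" where
  "instance_text es N = nat_code (val (ones N)) @ nat_code (val (ones N)) @ nat_code 5 @
     concat (map entry_text es)"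

lemma prob_instance_of:
  assumes "distinct (map entry_key es)" "(x, y, z, h) \<in> set es"
  shows "prob (instance_of es N) (code x, code y, z) = half_if h"
proof -
  have "(x, y, z, True) \<in> set es \<longleftrightarrow> h"
  proof
    assume "(x, y, z, True) \<in> set es"
    then have "(x, y, z, True) = (x, y, z, h)"
      using assms by (intro inj_onD[of entry_key "set es"]) (auto simp: distinct_map)
    then show h by simp
  qed (use assms in auto)
  moreover have "(\<exists>x' y'. (x', y', z, True) \<in> set es \<and> code x = code x' \<and> code y = code y') \<longleftrightarrow>
      (x, y, z, True) \<in> set es"
    unfolding code_eq_iff by blast
  ultimately show ?thesis by (simp only: instance_of_def mindim_instance.simps prod.case)
qed

lemma instance_text_code:
  assumes "distinct (map entry_key es)"
  shows "instance_text es N \<in> instance_codes (instance_of es N)"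
proof -
  let ?I = "instance_of es N"
  have "entry_code (prob ?I) (entry_pos e) = entry_text e" if "e \<in> set es" for e
  proof -
    obtain x y z h where e: "e = (x, y, z, h)" by (cases e)
    with that prob_instance_of[OF assms, of x y z h N] show ?thesis by (simp add: entry_code_def)
  qed
  then have "map (entry_code (prob ?I)) (map entry_pos es) = map entry_text es" by simp
  then have "instance_text es N = nat_code (nX ?I) @ nat_code (nY ?I) @ nat_code (nZ ?I) @
      concat (map (entry_code (prob ?I)) (map entry_pos es))"
    by (simp only: instance_text_def) (simp add: instance_of_def)
  moreover have "distinct (map entry_pos es)"
  proof -
    have "inj_on entry_pos (set es)"
    proof (rule inj_onI)
      fix e e' assume "e \<in> set es" "e' \<in> set es" "entry_pos e = entry_pos e'"
      moreover from this(3) have "entry_key e = entry_key e'" by (cases e; cases e') simp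
      ultimately show "e = e'" using assms by (auto simp: distinct_map dest: inj_onD)
    qed
    then show ?thesis using assms by (simp add: distinct_map)
  qed
  moreover have "set (map entry_pos es) = Omega ?I" by (simp add: instance_of_def)
  ultimately show ?thesis unfolding instance_codes_def by blast
qed

section \<open>Templates\<close>

text \<open>A coordinate \<open>(v, c)\<close> stands for \<open>c\<close> plus, if \<open>v\<close> holds, the value of the counter.\<close>

type_synonym tname = "nat \<times> nat \<times> (bool \<times> nat) \<times> (bool \<times> nat)"

type_synonym tentry = "tname \<times> tname \<times> nat \<times> bool"

fun fill :: "nat \<Rightarrow> nat \<Rightarrow> tname \<Rightarrow> name" where
  "fill i t (k, a, (bi, ci), (bt, ct)) =
     (k, a, (if bi then i else 0) + ci, (if bt then t else 0) + ct)"

fun fill_entry :: "nat \<Rightarrow> nat \<Rightarrow> tentry \<Rightarrow> entry" where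
  "fill_entry i t (x, y, z, h) = (fill i t x, fill i t y, z, h)"

text \<open>\<open>field_code\<close> turns a bit \<open>True\<close> into two, hence the factor 2
  here and in \<open>render_tok\<close>.\<close>

definition unary_toks :: "nat \<Rightarrow> tok list" where
  "unary_toks n = replicate (2 * n) (Bit True)"

fun name_toks :: "tname \<Rightarrow> tok list" where
  "name_toks (k, a, (bi, ci), (bt, ct)) =
     unary_toks k @ [Bit True, Bit False] @ unary_toks a @ [Bit True, Bit False] @
     (if bi then [TokI] else []) @ unary_toks ci @ [Bit True, Bit False] @
     (if bt then [TokT] else []) @ unary_toks (Suc ct) @ [Bit False]"

fun entry_toks :: "tentry \<Rightarrow> tok list" where
  "entry_toks (x, y, z, h) =
     name_toks x @ name_toks y @ map Bit (nat_code z @ rat_code (half_if h))"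

definition block_toks :: "tentry list \<Rightarrow> tok list" where
  "block_toks es = concat (map entry_toks es)"

text \<open>Two \<open>TokT\<close> because a name has two coordinates of up to \<open>T\<close>
  each, whence \<open>N = 2 * t + c\<close>; the field is repeated for the equal numbers of states
  and measurements.\<close>

definition header_toks :: "nat \<Rightarrow> tok list" where
  "header_toks c = (let xs = [TokT, TokT] @ unary_toks c @ [Bit False] in
     xs @ xs @ map Bit (nat_code 5))"

lemma render_append [simp]: "render i t (xs @ ys) = render i t xs @ render i t ys"
  by (simp add: render_def)

lemma render_Cons [simp]: "render i t (x # ys) = render_tok i t x @ render i t ys"
  by (simp add: render_def)

lemma render_Nil [simp]: "render i t [] = []"
  by (simp add: render_def)

lemma render_map_Bit [simp]: "render i t (map Bit bs) = bs"
  by (induction bs) auto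

lemma render_unary_toks [simp]: "render i t (unary_toks n) = ones (2 * n)"
  unfolding unary_toks_def by (induction n) auto

lemma field_code_ones: "field_code (ones n @ bs) = ones (2 * n) @ field_code bs"
  by (induction n) (auto simp: field_code_def)

lemma field_code_Cons: "field_code (b # bs) = True # b # field_code bs"
  by (simp add: field_code_def)

lemma field_code_ones': "field_code (ones n) = ones (2 * n) @ [False]"
  using field_code_ones[of n "[]"] by (simp add: field_code_def)

lemma ones_append: "ones m @ ones n @ bs = ones (m + n) @ bs"
  by (simp add: replicate_add)

lemma render_name_toks: "render i t (name_toks n) = nat_code (code (fill i t n))"
proof -
  obtain k a bi ci bt ct where n: "n = (k, a, (bi, ci), (bt, ct))" by (metis prod.exhaust)
  show ?thesis
    unfolding nat_code_def bin_code n
    by (simp add: field_code_ones field_code_ones' field_code_Cons ones_append replicate_add[symmetric] add_mult_distrib2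
        del: replicate_Suc)
qed

lemma render_entry_toks: "render i t (entry_toks e) = entry_text (fill_entry i t e)"
  by (cases e) (simp add: render_name_toks del: map_append)

lemma render_block_toks:
  "render i t (block_toks es) = concat (map entry_text (map (fill_entry i t) es))"
  unfolding block_toks_def by (induction es) (auto simp: render_entry_toks)

lemma render_header_toks:
  "render i t (header_toks c) @ concat (map entry_text es) = instance_text es (2 * t + c)"
  by (simp add: header_toks_def Let_def instance_text_def nat_code_def[of "val _"] bin_val_ones
      field_code_ones' ones_append add_mult_distrib2 mult_2)

section \<open>Positive semidefinite matrices in dimension 2\<close>

lemma mat_trace_mult:
  assumes "A \<in> carrier_mat d d" "B \<in> carrier_mat d d"
  shows "mat_trace (A * B) = (\<Sum>i<d. \<Sum>j<d. A $$ (i, j) * B $$ (j, i))"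
  using assms by (auto simp: mat_trace_def scalar_prod_def atLeast0LessThan intro!: sum.cong)

lemma mat_trace_mult2:
  assumes "A \<in> carrier_mat 2 2" "B \<in> carrier_mat 2 2"
  shows "mat_trace (A * B) = A $$ (0, 0) * B $$ (0, 0) + A $$ (0, 1) * B $$ (1, 0)
    + A $$ (1, 0) * B $$ (0, 1) + A $$ (1, 1) * B $$ (1, 1)"
  using mat_trace_mult[OF assms] by (simp add: numeral_2_eq_2)

lemma index_mat_adjoint:
  assumes "A \<in> carrier_mat d d" "i < d" "j < d"
  shows "mat_adjoint A $$ (i, j) = cnj (A $$ (j, i))"
  using assms by (simp add: mat_adjoint_def mat_of_rows_def)

lemma quad_form2:
  assumes "A \<in> carrier_mat 2 2" "v \<in> carrier_vec 2"
  shows "(A *\<^sub>v v) \<bullet>c v =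
    (A $$ (0, 0) * v $ 0 + A $$ (0, 1) * v $ 1) * cnj (v $ 0) +
    (A $$ (1, 0) * v $ 0 + A $$ (1, 1) * v $ 1) * cnj (v $ 1)"
  using assms by (simp add: scalar_prod_def numeral_2_eq_2 row_def)

lemma psd2D:
  assumes "psd 2 A"
  obtains a b z where "A $$ (0, 0) = complex_of_real a" "A $$ (1, 1) = complex_of_real b"
    "A $$ (0, 1) = z" "A $$ (1, 0) = cnj z" "0 \<le> a" "0 \<le> b" "(cmod z)\<^sup>2 \<le> a * b"
proof -
  have A: "A \<in> carrier_mat 2 2" "mat_adjoint A = A"
    and form: "v \<in> carrier_vec 2 \<Longrightarrow> 0 \<le> Re ((A *\<^sub>v v) \<bullet>c v)" for v
    using assms by (auto simp: psd_def)
  have h: "A $$ (i, j) = cnj (A $$ (j, i))" if "i < 2" "j < 2" for i j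
    using index_mat_adjoint[OF A(1) that] A(2) by simp
  define a b z where "a = Re (A $$ (0, 0))" "b = Re (A $$ (1, 1))" "z = A $$ (0, 1)"
  have a: "A $$ (0, 0) = complex_of_real a" and b: "A $$ (1, 1) = complex_of_real b"
    using h[of 0 0] h[of 1 1] by (auto simp: a_b_z_def complex_eq_iff)
  have z: "A $$ (0, 1) = z" "A $$ (1, 0) = cnj z"
    using h[of 1 0] by (auto simp: a_b_z_def)
  have q: "0 \<le> a * (cmod x)\<^sup>2 + b * (cmod y)\<^sup>2 + 2 * Re (z * y * cnj x)" for x y
  proof -
    have "0 \<le> Re ((of_real a * x + z * y) * cnj x + (cnj z * x + of_real b * y) * cnj y)"
      using form[of "vec 2 (\<lambda>i. if i = 0 then x else y)"] quad_form2[OF A(1), of "vec 2 (\<lambda>i. if i = 0 then x else y)"]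
      by (simp add: a b[simplified] z[simplified])
    then show ?thesis
      by (simp only: cmod_power2) (simp add: algebra_simps power2_eq_square)
  qed
  have "0 \<le> a" "0 \<le> b" using q[of 1 0] q[of 0 1] by auto
  moreover have "(cmod z)\<^sup>2 \<le> a * b"
  proof (cases "a = 0")
    case True
    have "0 \<le> b - 2 * s * (cmod z)\<^sup>2" for s
      using q[of "- of_real s * z" 1] True by (simp only: cmod_power2) (simp add: algebra_simps power2_eq_square)
    \<comment> \<open>Unless \<open>z\<close> vanishes, this value of \<open>s\<close> turns the
      right-hand side into \<open>-1\<close>.\<close>
    from this[of "(b + 1) / (2 * (cmod z)\<^sup>2)"] have "cmod z = 0"
      by (cases "cmod z = 0") (auto simp: field_simps)
    then show ?thesis using True by simp
  next
    case False
    with \<open>0 \<le> a\<close> have "a > 0" by simp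
    \<comment> \<open>The test vector \<open>(- z, a)\<close> yields \<open>a\<close> times the
      determinant.\<close>
    have "0 \<le> a * (a * b - (cmod z)\<^sup>2)"
      using q[of "- z" "of_real a"]
      by (simp only: cmod_power2) (simp add: algebra_simps power2_eq_square)
    with \<open>a > 0\<close> show ?thesis by (simp add: zero_le_mult_iff)
  qed
  ultimately show thesis using that a b z by blast
qed

text \<open>In the basis of the Pauli matrices, a hermitian matrix \<open>(t + r \<cdot> \<sigma>) / 2\<close> is
  represented by its trace \<open>t\<close> and its Bloch vector \<open>r\<close>.\<close>

definition tr :: "complex mat \<Rightarrow> real" where
  "tr A = Re (A $$ (0, 0)) + Re (A $$ (1, 1))"

definition bloch :: "complex mat \<Rightarrow> complex \<times> real" where
  "bloch A = (2 * A $$ (0, 1), Re (A $$ (0, 0)) - Re (A $$ (1, 1)))"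

text \<open>The squared trace minus the squared norm of the Bloch vector is four times the
  determinant, so positivity means lying in the forward light cone.\<close>

lemma psd2_cone:
  assumes "psd 2 A"
  shows "norm (bloch A) \<le> tr A"
proof -
  obtain a b z where A: "A $$ (0, 0) = complex_of_real a" "A $$ (1, 1) = complex_of_real b"
    "A $$ (0, 1) = z" "A $$ (1, 0) = cnj z" "0 \<le> a" "0 \<le> b" "(cmod z)\<^sup>2 \<le> a * b"
    using psd2D[OF assms] .
  have "(norm (bloch A))\<^sup>2 = 4 * (cmod z)\<^sup>2 + (a - b)\<^sup>2"
    using A(1-4) by (simp add: bloch_def norm_Pair norm_mult power_mult_distrib)
  also have "\<dots> \<le> 4 * (a * b) + (a - b)\<^sup>2" using A by simp
  also have "\<dots> = (tr A)\<^sup>2" using A by (simp add: tr_def power2_eq_square algebra_simps)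
  finally show ?thesis
    by (rule power2_le_imp_le) (use A in \<open>simp add: tr_def\<close>)
qed

lemma psd2_trace_mult:
  assumes "psd 2 A" "psd 2 B"
  shows "mat_trace (A * B) = of_real ((tr A * tr B + inner (bloch A) (bloch B)) / 2)"
proof -
  obtain a b z where A: "A $$ (0, 0) = complex_of_real a" "A $$ (1, 1) = complex_of_real b"
    "A $$ (0, 1) = z" "A $$ (1, 0) = cnj z"
    using psd2D[OF assms(1)] .
  obtain c d w where B: "B $$ (0, 0) = complex_of_real c" "B $$ (1, 1) = complex_of_real d"
    "B $$ (0, 1) = w" "B $$ (1, 0) = cnj w"
    using psd2D[OF assms(2)] .
  have "A \<in> carrier_mat 2 2" "B \<in> carrier_mat 2 2" using assms by (auto simp: psd_def)
  then have "mat_trace (A * B) = A $$ (0, 0) * B $$ (0, 0) + A $$ (0, 1) * B $$ (1, 0)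
    + A $$ (1, 0) * B $$ (0, 1) + A $$ (1, 1) * B $$ (1, 1)" by (rule mat_trace_mult2)
  also have "\<dots> = of_real ((tr A * tr B + inner (bloch A) (bloch B)) / 2)"
    unfolding A B tr_def bloch_def by (auto simp: complex_eq_iff inner_complex_def field_simps)
  finally show ?thesis .
qed

text \<open>This is an equality case of Cauchy-Schwarz. With \<open>r\<close>, \<open>s\<close> the
  Bloch vectors and \<open>t\<close> the trace of \<open>B\<close>, the hypothesis gives
  \<open>inner r s = - t\<close>, while \<open>|s| \<le> t\<close> and \<open>|r| \<le> 1\<close>;
  so \<open>|s + t r|^2\<close> is at most 0, and its expansion also forces
  \<open>t^2 |r|^2 = t^2\<close>.\<close>

lemma orth_bloch:
  assumes "psd 2 A" "psd 2 B" "tr A = 1" "mat_trace (A * B) = 0"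
  shows "bloch B = - (tr B *\<^sub>R bloch A)" "tr B = 0 \<or> norm (bloch A) = 1"
proof -
  let ?r = "bloch A" and ?s = "bloch B" and ?t = "tr B"
  have "complex_of_real ((?t + inner ?r ?s) / 2) = 0"
    using psd2_trace_mult[OF assms(1,2)] assms(3,4) by simp
  then have i: "inner ?r ?s = - ?t" unfolding of_real_eq_0_iff by simp
  have c: "norm ?r \<le> 1" "norm ?s \<le> ?t" using psd2_cone assms by metis+
  then have t: "0 \<le> ?t" using norm_ge_zero order_trans by blast
  have "(norm ?s)\<^sup>2 \<le> ?t\<^sup>2" "(norm ?r)\<^sup>2 \<le> 1"
    using c by (auto simp: power_mono power_le_one)
  then have "?t\<^sup>2 * (norm ?r)\<^sup>2 \<le> ?t\<^sup>2" by (simp add: mult_left_le)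
  have "(norm (?s + ?t *\<^sub>R ?r))\<^sup>2 = (norm ?s)\<^sup>2 - 2 * ?t\<^sup>2 + ?t\<^sup>2 * (norm ?r)\<^sup>2"
    unfolding power2_norm_eq_inner using i
    by (simp add: inner_add inner_commute power2_eq_square algebra_simps)
  moreover have "0 \<le> (norm (?s + ?t *\<^sub>R ?r))\<^sup>2" by simp
  ultimately have *: "(norm (?s + ?t *\<^sub>R ?r))\<^sup>2 = 0" "?t\<^sup>2 * (norm ?r)\<^sup>2 = ?t\<^sup>2"
    using \<open>(norm ?s)\<^sup>2 \<le> ?t\<^sup>2\<close> \<open>?t\<^sup>2 * (norm ?r)\<^sup>2 \<le> ?t\<^sup>2\<close> by linarith+
  from *(1) show "?s = - (?t *\<^sub>R ?r)" by (simp add: eq_neg_iff_add_eq_0)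
  from *(2) have "?t = 0 \<or> (norm ?r)\<^sup>2 = 1" by simp
  then show "?t = 0 \<or> norm ?r = 1" by (simp add: power2_eq_1_iff) (smt (verit) norm_ge_zero)
qed

lemma measurement2_bloch:
  assumes "measurement 2 Z E"
  shows "(\<Sum>z=1..Z. tr (E z)) = 2" "(\<Sum>z=1..Z. bloch (E z)) = 0"
proof -
  have eq: "mat 2 2 (\<lambda>(i, j). \<Sum>z = 1..Z. E z $$ (i, j)) = 1\<^sub>m 2"
    using assms by (simp add: measurement_def)
  then have "(\<Sum>z = 1..Z. E z $$ (i, j)) = (if i = j then 1 else 0)" if "i < 2" "j < 2" for i j
  proof -
    have "(\<Sum>z = 1..Z. E z $$ (i, j)) = mat 2 2 (\<lambda>(i, j). \<Sum>z = 1..Z. E z $$ (i, j)) $$ (i, j)"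
      using that by simp
    also have "\<dots> = (if i = j then 1 else 0)" unfolding eq using that by simp
    finally show ?thesis .
  qed
  from this[of 0 0] this[of 0 1] this[of 1 1]
  have s: "(\<Sum>z = 1..Z. E z $$ (0, 0)) = 1" "(\<Sum>z = 1..Z. E z $$ (0, 1)) = 0"
    "(\<Sum>z = 1..Z. E z $$ (1, 1)) = 1" by auto
  have re: "(\<Sum>z = 1..Z. Re (E z $$ (0, 0))) = 1" "(\<Sum>z = 1..Z. Re (E z $$ (1, 1))) = 1"
    using arg_cong[OF s(1), of Re] arg_cong[OF s(3), of Re] by auto
  then show "(\<Sum>z=1..Z. tr (E z)) = 2" by (simp add: tr_def sum.distrib)
  show "(\<Sum>z=1..Z. bloch (E z)) = 0"
    using re s(2) by (simp add: bloch_def sum_prod sum_subtractf zero_prod_def sum_distrib_left[symmetric])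
qed

text \<open>In three dimensions a unit vector orthogonal to \<open>a\<close> and \<open>b\<close> is
  plus or minus their cross product.\<close>

lemma orthonormal_pair_complement:
  fixes a b r s :: "complex \<times> real"
  assumes "norm a = 1" "norm b = 1" "inner a b = 0"
    and "norm r = 1" "inner r a = 0" "inner r b = 0"
    and "norm s = 1" "inner s a = 0" "inner s b = 0"
  shows "s = r \<or> s = - r"
proof -
  obtain a1 a2 a3 where a: "a = (Complex a1 a2, a3)" by (metis complex_surj surj_pair)
  obtain b1 b2 b3 where b: "b = (Complex b1 b2, b3)" by (metis complex_surj surj_pair)
  obtain r1 r2 r3 where r: "r = (Complex r1 r2, r3)" by (metis complex_surj surj_pair)
  obtain s1 s2 s3 where s: "s = (Complex s1 s2, s3)" by (metis complex_surj surj_pair)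
  define c1 c2 c3 where c: "c1 = a2 * b3 - a3 * b2" "c2 = a3 * b1 - a1 * b3" "c3 = a1 * b2 - a2 * b1"
  have "a1 * a1 + a2 * a2 + a3 * a3 = 1" "b1 * b1 + b2 * b2 + b3 * b3 = 1"
    "a1 * b1 + a2 * b2 + a3 * b3 = 0"
    using assms(1-3) by (simp_all add: norm_eq_1 a b inner_complex_def)
  \<comment> \<open>Lagrange's identity for the cross product.\<close>
  moreover have "c1 * c1 + c2 * c2 + c3 * c3 = (a1 * a1 + a2 * a2 + a3 * a3) * (b1 * b1 + b2 * b2 + b3 * b3)
      - (a1 * b1 + a2 * b2 + a3 * b3) * (a1 * b1 + a2 * b2 + a3 * b3)"
    unfolding c by (simp add: algebra_simps)
  ultimately have cc: "c1 * c1 + c2 * c2 + c3 * c3 = 1" by simp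
  have axis: "(x1 = c1 \<and> x2 = c2 \<and> x3 = c3) \<or> (x1 = - c1 \<and> x2 = - c2 \<and> x3 = - c3)"
    if x: "x1 * x1 + x2 * x2 + x3 * x3 = 1" "x1 * a1 + x2 * a2 + x3 * a3 = 0"
      "x1 * b1 + x2 * b2 + x3 * b3 = 0" for x1 x2 x3
  proof -
    define k where "k = x1 * c1 + x2 * c2 + x3 * c3"
    \<comment> \<open>The double product \<open>x \<times> (a \<times> b)\<close>, which vanishes by
      orthogonality, so \<open>x\<close> is parallel to \<open>c\<close>.\<close>
    have "x2 * c3 - x3 * c2 = a1 * (x1 * b1 + x2 * b2 + x3 * b3) - b1 * (x1 * a1 + x2 * a2 + x3 * a3)"
      "x3 * c1 - x1 * c3 = a2 * (x1 * b1 + x2 * b2 + x3 * b3) - b2 * (x1 * a1 + x2 * a2 + x3 * a3)"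
      "x1 * c2 - x2 * c1 = a3 * (x1 * b1 + x2 * b2 + x3 * b3) - b3 * (x1 * a1 + x2 * a2 + x3 * a3)"
      unfolding c by (simp_all add: algebra_simps)
    then have p: "x2 * c3 = x3 * c2" "x3 * c1 = x1 * c3" "x1 * c2 = x2 * c1"
      unfolding x by simp_all
    have "k * c1 = x1 * (c1 * c1) + c2 * (x2 * c1) + c3 * (x3 * c1)"
      "k * c2 = x2 * (c2 * c2) + c1 * (x1 * c2) + c3 * (x3 * c2)"
      "k * c3 = x3 * (c3 * c3) + c1 * (x1 * c3) + c2 * (x2 * c3)"
      unfolding k_def by (simp_all add: algebra_simps)
    then have "k * c1 = x1 * (c1 * c1) + c2 * (x1 * c2) + c3 * (x1 * c3)"
      "k * c2 = x2 * (c2 * c2) + c1 * (x2 * c1) + c3 * (x2 * c3)"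
      "k * c3 = x3 * (c3 * c3) + c1 * (x3 * c1) + c2 * (x3 * c2)"
      using p by simp_all
    then have "k * c1 = x1 * (c1 * c1 + c2 * c2 + c3 * c3)"
      "k * c2 = x2 * (c1 * c1 + c2 * c2 + c3 * c3)" "k * c3 = x3 * (c1 * c1 + c2 * c2 + c3 * c3)"
      by (simp_all add: algebra_simps)
    then have k: "x1 = k * c1" "x2 = k * c2" "x3 = k * c3" unfolding cc by simp_all
    have "k * k * (c1 * c1 + c2 * c2 + c3 * c3) = 1"
      using x(1) unfolding k by (simp add: algebra_simps)
    then have "k * k = 1" unfolding cc by simp
    then have "k = 1 \<or> k = - 1" by (simp add: square_eq_1_iff)
    with k show ?thesis by auto
  qed
  have "r1 * r1 + r2 * r2 + r3 * r3 = 1" "r1 * a1 + r2 * a2 + r3 * a3 = 0"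
    "r1 * b1 + r2 * b2 + r3 * b3 = 0"
    using assms(4-6) by (simp_all add: norm_eq_1 a b r inner_complex_def)
  note R = axis[OF this]
  have "s1 * s1 + s2 * s2 + s3 * s3 = 1" "s1 * a1 + s2 * a2 + s3 * a3 = 0"
    "s1 * b1 + s2 * b2 + s3 * b3 = 0"
    using assms(7-9) by (simp_all add: norm_eq_1 a b s inner_complex_def)
  note S = axis[OF this]
  from R S show ?thesis by (auto simp: r s complex_eq_iff)
qed

section \<open>Literals\<close>

text \<open>The kind of a negated literal is odd. Kinds 2 to 5 are used for the measurement frame.\<close>

fun neg :: "nat \<times> 'a \<Rightarrow> nat \<times> 'a" where
  "neg (k, a) = (if even k then Suc k else k - 1, a)"

text \<open>The negation comes first so that the effect of outcome 1 is the projector onto the state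
  of \<open>x\<close>, against which other states can be tested.\<close>

definition decl :: "nat \<times> 'a \<Rightarrow> (nat \<times> 'a) list" where
  "decl x = [neg x, x, x, x, x]"

abbreviation plus_name :: name where "plus_name \<equiv> (2, 0, 0, 0)"
abbreviation imag_name :: name where "imag_name \<equiv> (4, 0, 0, 0)"
abbreviation true_name :: name where "true_name \<equiv> (0, 0, 0, 0)"
abbreviation meas_X :: name where "meas_X \<equiv> (0, 0, 0, 0)"
abbreviation meas_Y :: name where "meas_Y \<equiv> (0, 1, 0, 0)"

definition lit_val :: "(name \<Rightarrow> bool) \<Rightarrow> name \<Rightarrow> bool" where
  "lit_val v l = (if even (fst l) then v l else \<not> v (neg l))"

lemma neg_neg [simp]: "neg (neg l) = l"
  by (cases l) (auto elim: oddE)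

lemma lit_val_neg [simp]: "lit_val v (neg l) = (\<not> lit_val v l)"
  by (cases l) (auto simp: lit_val_def elim: oddE)

definition solves :: "nat \<Rightarrow> (name \<Rightarrow> complex mat) \<Rightarrow> (name \<Rightarrow> nat \<Rightarrow> complex mat) \<Rightarrow> entry list \<Rightarrow> bool" where
  "solves d \<rho> E es \<longleftrightarrow> (\<forall>(x, y, z, h) \<in> set es. quantum_state d (\<rho> x) \<and> measurement d 5 (E y) \<and>
     mat_trace (\<rho> x * E y z) = of_rat (half_if h))"

definition has_clause :: "entry list \<Rightarrow> name \<Rightarrow> name list \<Rightarrow> bool" where
  "has_clause es y ls \<longleftrightarrow> length ls = 5 \<and> (\<forall>z<5. (ls ! z, y, Suc z, False) \<in> set es)"

lemma has_clauseD:
  assumes "solves d \<rho> E es" "has_clause es y ls"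
  shows "measurement d 5 (E y)"
    "z < 5 \<Longrightarrow> quantum_state d (\<rho> (ls ! z))" "z < 5 \<Longrightarrow> psd d (E y (Suc z))"
    "z < 5 \<Longrightarrow> mat_trace (\<rho> (ls ! z) * E y (Suc z)) = 0"
proof -
  have a: "measurement d 5 (E y)" "quantum_state d (\<rho> (ls ! z))"
    "mat_trace (\<rho> (ls ! z) * E y (Suc z)) = 0" if "z < 5" for z
    using assms that unfolding solves_def has_clause_def half_if_def by force+
  from a(1)[of 0] show "measurement d 5 (E y)" by simp
  from a(2,3) show "z < 5 \<Longrightarrow> quantum_state d (\<rho> (ls ! z))"
    "z < 5 \<Longrightarrow> mat_trace (\<rho> (ls ! z) * E y (Suc z)) = 0" by blast+
  show "z < 5 \<Longrightarrow> psd d (E y (Suc z))"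
    using a(1) unfolding measurement_def by (auto simp: Ball_def)
qed

section \<open>Clauses as conditions on Bloch vectors\<close>

lemma sum_upto_5: "(\<Sum>z=1..5::nat. f z) = (\<Sum>z<5. f (Suc z))"
  by (simp add: sum.shift_bounds_Suc_ivl[symmetric] atLeast0LessThan[symmetric] atLeastLessThanSuc_atLeastAtMost[symmetric])

lemma quantum_state_tr: "quantum_state 2 \<rho> \<Longrightarrow> tr \<rho> = 1"
proof -
  assume a: "quantum_state 2 \<rho>"
  then have "dim_row \<rho> = 2" "mat_trace \<rho> = 1" by (auto simp: quantum_state_def psd_def)
  then have "\<rho> $$ (0, 0) + \<rho> $$ (1, 1) = 1" by (simp add: mat_trace_def numeral_2_eq_2)
  from arg_cong[OF this, of Re] show ?thesis by (simp add: tr_def)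
qed

lemma clause_bloch:
  assumes "solves 2 \<rho> E es" "has_clause es y ls"
  defines "t \<equiv> \<lambda>z. tr (E y (Suc z))"
  shows "(\<Sum>z<5. t z) = 2" "(\<Sum>z<5. t z *\<^sub>R bloch (\<rho> (ls ! z))) = 0"
    "z < 5 \<Longrightarrow> 0 \<le> t z" "z < 5 \<Longrightarrow> t z = 0 \<or> norm (bloch (\<rho> (ls ! z))) = 1"
    "z < 5 \<Longrightarrow> bloch (E y (Suc z)) = - (t z *\<^sub>R bloch (\<rho> (ls ! z)))"
proof -
  note c = has_clauseD[OF assms(1,2)]
  show "(\<Sum>z<5. t z) = 2"
    using measurement2_bloch(1)[OF c(1)] unfolding t_def sum_upto_5 .
  have o: "bloch (E y (Suc z)) = - (t z *\<^sub>R bloch (\<rho> (ls ! z)))"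
    "t z = 0 \<or> norm (bloch (\<rho> (ls ! z))) = 1" if "z < 5" for z
    using orth_bloch[of "\<rho> (ls ! z)" "E y (Suc z)"] c(2-4)[OF that] quantum_state_tr
    unfolding t_def quantum_state_def by blast+
  have "(\<Sum>z<5. - (t z *\<^sub>R bloch (\<rho> (ls ! z)))) = 0"
    using measurement2_bloch(2)[OF c(1)] o(1) unfolding sum_upto_5 by simp
  then show "(\<Sum>z<5. t z *\<^sub>R bloch (\<rho> (ls ! z))) = 0" by (simp add: sum_negf)
  show "z < 5 \<Longrightarrow> 0 \<le> t z"
    unfolding t_def using psd2_cone[OF c(3)] norm_ge_zero order_trans by blast
  show "z < 5 \<Longrightarrow> t z = 0 \<or> norm (bloch (\<rho> (ls ! z))) = 1"
    "z < 5 \<Longrightarrow> bloch (E y (Suc z)) = - (t z *\<^sub>R bloch (\<rho> (ls ! z)))"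
    using o by blast+
qed

lemma decl_bloch:
  assumes "solves 2 \<rho> E es" "has_clause es y (decl x)"
  shows "norm (bloch (\<rho> x)) = 1" "bloch (\<rho> (neg x)) = - bloch (\<rho> x)"
    "tr (E y 1) = 1" "bloch (E y 1) = bloch (\<rho> x)"
proof -
  define t where "t = (\<lambda>z. tr (E y (Suc z)))"
  note c = clause_bloch[OF assms]
  let ?r = "bloch (\<rho> x)" and ?s = "bloch (\<rho> (neg x))"
  have t: "t 0 + (t 1 + t 2 + t 3 + t 4) = 2"
    using c(1) by (simp add: eval_nat_numeral t_def)
  have v: "t 0 *\<^sub>R ?s + (t 1 + t 2 + t 3 + t 4) *\<^sub>R ?r = 0"
    using c(2) by (simp add: decl_def eval_nat_numeral algebra_simps t_def)
  have pos: "0 \<le> t 0" "0 \<le> t 1" "0 \<le> t 2" "0 \<le> t 3" "0 \<le> t 4"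
    using c(3)[of 0] c(3)[of 1] c(3)[of 2] c(3)[of 3] c(3)[of 4] by (simp_all add: t_def)
  have s1: "t 0 = 0 \<or> norm ?s = 1" using c(4)[of 0] by (simp add: decl_def t_def)
  have r1: "t 1 + t 2 + t 3 + t 4 = 0 \<or> norm ?r = 1"
    using c(4)[of 1] c(4)[of 2] c(4)[of 3] c(4)[of 4] by (auto simp: decl_def t_def eval_nat_numeral)
  have "t 1 + t 2 + t 3 + t 4 = 2 - t 0" using t by linarith
  then have v': "t 0 *\<^sub>R ?s = - ((2 - t 0) *\<^sub>R ?r)"
    using v by (simp only: eq_neg_iff_add_eq_0)
  have n: "t 0 * norm ?s = (2 - t 0) * norm ?r"
    using arg_cong[OF v', of norm] pos t by simp
  \<comment> \<open>Neither state can carry the whole weight 2: the weighted sum would be twice a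
    unit vector instead of 0. So both have positive weight and hence norm 1.\<close>
  have "norm ?r = 1 \<and> norm ?s = 1"
  proof (cases "t 0 = 0")
    case True
    with r1 t n show ?thesis by auto
  next
    case False
    with s1 r1 t n show ?thesis by auto
  qed
  then show r: "norm ?r = 1" by simp
  from n r \<open>norm ?r = 1 \<and> norm ?s = 1\<close> have t0: "t 0 = 1" by simp
  with v' show s: "?s = - ?r" by simp
  from t0 show "tr (E y 1) = 1" by (simp add: t_def)
  show "bloch (E y 1) = ?r" using c(5)[of 0] t0 s by (simp add: decl_def t_def)
qed

text \<open>The first effect of the measurement is the projector onto the state of \<open>x\<close>,
  so the probability is half of 1 plus the inner product of the two Bloch vectors.\<close>

lemma half_entry_bloch:
  assumes "solves 2 \<rho> E es" "has_clause es y (decl x)" "(v, y, 1, True) \<in> set es"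
  shows "inner (bloch (\<rho> v)) (bloch (\<rho> x)) = 0"
proof -
  have q: "quantum_state 2 (\<rho> v)" and m: "mat_trace (\<rho> v * E y 1) = 1 / 2"
    using assms(1,3) unfolding solves_def half_if_def by (force simp: of_rat_divide)+
  have "psd 2 (\<rho> v)" "psd 2 (E y 1)"
    using q has_clauseD(3)[OF assms(1,2), of 0] by (auto simp: quantum_state_def)
  from psd2_trace_mult[OF this] have
    "complex_of_real ((1 + inner (bloch (\<rho> v)) (bloch (\<rho> x))) / 2) = complex_of_real (1 / 2)"
    using m quantum_state_tr[OF q] decl_bloch[OF assms(1,2)] by simp
  then show ?thesis unfolding of_real_eq_iff by simp
qed

definition aligned_in :: "entry list \<Rightarrow> name \<Rightarrow> bool" where
  "aligned_in es x \<longleftrightarrow> even (fst x) \<and> (\<exists>y. has_clause es y (decl x)) \<and>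
     (x, meas_X, 1, True) \<in> set es \<and> (x, meas_Y, 1, True) \<in> set es"

text \<open>All aligned states lie on the axis orthogonal to the frame vectors; a variable is read as
  true if its state points in the direction of the state of \<open>true_name\<close>.\<close>

lemma solves_imp_assignment:
  assumes "solves 2 \<rho> E es"
    and "has_clause es meas_X (decl plus_name)" "has_clause es meas_Y (decl imag_name)"
    and "(plus_name, meas_Y, 1, True) \<in> set es" "aligned_in es true_name"
  obtains v where "v true_name"
    and "\<And>y ls. has_clause es y ls \<Longrightarrow> (\<And>l. l \<in> set ls \<Longrightarrow> aligned_in es l \<or> aligned_in es (neg l)) \<Longrightarrow>
      \<exists>l \<in> set ls. \<exists>l' \<in> set ls. lit_val v l \<and> \<not> lit_val v l'"
proof -
  let ?r = "\<lambda>x. bloch (\<rho> x)"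
  define v where "v x \<longleftrightarrow> ?r x = ?r true_name" for x
  note X = decl_bloch[OF assms(1,2)] and Y = decl_bloch[OF assms(1,3)]
  have XY: "inner (?r plus_name) (?r imag_name) = 0"
    by (rule half_entry_bloch[OF assms(1,3,4)])
  have al: "norm (?r x) = 1" "?r (neg x) = - ?r x" "inner (?r x) (?r plus_name) = 0"
    "inner (?r x) (?r imag_name) = 0" "even (fst x)" if "aligned_in es x" for x
    using that decl_bloch[OF assms(1)] half_entry_bloch[OF assms(1,2)] half_entry_bloch[OF assms(1,3)]
    unfolding aligned_in_def by blast+
  let ?c = "?r true_name"
  have c: "norm ?c = 1" by (rule al[OF assms(5)])
  have c0: "?c \<noteq> - ?c"
  proof
    assume "?c = - ?c"
    then have "?c = 0" by (simp add: eq_neg_iff_add_eq_0 flip: scaleR_2)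
    with c show False by simp
  qed
  have ax: "?r x = (if v x then ?c else - ?c)" if "aligned_in es x" for x
    using orthonormal_pair_complement[OF X(1) Y(1) XY al(1,3,4)[OF assms(5)] al(1,3,4)[OF that]]
    by (auto simp: v_def)
  have lit: "?r l = (if lit_val v l then ?c else - ?c)"
    if "aligned_in es l \<or> aligned_in es (neg l)" for l
    using that
  proof
    assume "aligned_in es l"
    with ax al(5) show ?thesis by (simp add: lit_val_def)
  next
    assume a: "aligned_in es (neg l)"
    have "?r l = - ?r (neg l)" using al(2)[OF a] by simp
    moreover have "lit_val v (neg l) = v (neg l)" using al(5)[OF a] by (simp add: lit_val_def)
    ultimately show ?thesis using ax[OF a] by (auto simp: lit_val_neg)
  qed
  show thesis
  proof (rule that[of v])
    show "v true_name" by (simp add: v_def)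
    fix y ls
    assume h: "has_clause es y ls" and l: "\<And>l. l \<in> set ls \<Longrightarrow> aligned_in es l \<or> aligned_in es (neg l)"
    have len: "length ls = 5" using h by (simp add: has_clause_def)
    note cl = clause_bloch[OF assms(1) h]
    \<comment> \<open>Five equal unit vectors \<open>d\<close> would have the weighted sum
      \<open>2 d\<close>.\<close>
    have const: False if "\<forall>l \<in> set ls. ?r l = d" "norm d = 1" for d
    proof -
      have "?r (ls ! z) = d" if "z < 5" for z using that len \<open>\<forall>l \<in> set ls. ?r l = d\<close> by simp
      then have "(\<Sum>z<5. tr (E y (Suc z)) *\<^sub>R d) = 0" using cl(2) by simp
      then have "2 *\<^sub>R d = 0" using cl(1) by (simp flip: scaleR_sum_left)
      with that(2) show False by simp
    qed
    show "\<exists>l \<in> set ls. \<exists>l' \<in> set ls. lit_val v l \<and> \<not> lit_val v l'"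
    proof (rule ccontr)
      assume "\<not> ?thesis"
      then have "(\<forall>l \<in> set ls. lit_val v l) \<or> (\<forall>l \<in> set ls. \<not> lit_val v l)" by blast
      then have "(\<forall>l \<in> set ls. ?r l = ?c) \<or> (\<forall>l \<in> set ls. ?r l = - ?c)"
        using lit[OF l] by auto
      with const[of ?c] const[of "- ?c"] c show False by auto
    qed
  qed
qed

text \<open>In dimension 1 the only state is the number 1, so the zeros annihilate all five effects,
  which then cannot sum to 1. In dimension 0 no matrix has trace 1.\<close>

lemma solves_imp_dim_ge_2:
  assumes "solves d \<rho> E es" "has_clause es y ls"
  shows "2 \<le> d"
proof (rule ccontr)
  assume "\<not> 2 \<le> d"
  note c = has_clauseD[OF assms]
  have "quantum_state d (\<rho> (ls ! 0))" using c(2)[of 0] by simp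
  then have "d \<noteq> 0" by (intro notI) (auto simp: quantum_state_def psd_def mat_trace_def)
  with \<open>\<not> 2 \<le> d\<close> have d: "d = 1" by simp
  have "E y (Suc z) $$ (0, 0) = 0" if "z < 5" for z
  proof -
    have q: "\<rho> (ls ! z) \<in> carrier_mat 1 1" "E y (Suc z) \<in> carrier_mat 1 1"
      "mat_trace (\<rho> (ls ! z)) = 1"
      using c(2,3)[OF that] by (auto simp: d quantum_state_def psd_def)
    then have "\<rho> (ls ! z) $$ (0, 0) = 1" by (auto simp: mat_trace_def)
    with mat_trace_mult[OF q(1,2)] c(4)[OF that] show ?thesis by simp
  qed
  then have "(\<Sum>z=1..5. E y z $$ (0, 0)) = 0" unfolding sum_upto_5 by simp
  moreover have eq: "mat d d (\<lambda>(i, j). \<Sum>z = 1..5. E y z $$ (i, j)) = 1\<^sub>m d"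
    using c(1) by (simp add: measurement_def)
  have "(\<Sum>z=1..5. E y z $$ (0, 0)) = mat d d (\<lambda>(i, j). \<Sum>z = 1..5. E y z $$ (i, j)) $$ (0, 0)"
    by (simp add: d)
  then have "(\<Sum>z=1..5. E y z $$ (0, 0)) = 1" unfolding eq by (simp add: d)
  ultimately show False by simp
qed


section \<open>Realisation by pure states\<close>

text \<open>The factor \<open>c\<close> stands outside the vector so that the frame states can be
  normalised without square roots.\<close>

definition pure :: "real \<Rightarrow> complex \<Rightarrow> complex \<Rightarrow> complex mat" where
  "pure c u v = mat 2 2 (\<lambda>(i, j). of_real c * (if i = 0 then u else v) * cnj (if j = 0 then u else v))"

lemma pure_index [simp]:
  "pure c u v \<in> carrier_mat 2 2"
  "pure c u v $$ (0, 0) = of_real c * u * cnj u" "pure c u v $$ (0, Suc 0) = of_real c * u * cnj v"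
  "pure c u v $$ (Suc 0, 0) = of_real c * v * cnj u" "pure c u v $$ (Suc 0, Suc 0) = of_real c * v * cnj v"
  by (auto simp: pure_def)

lemma psd_pure:
  assumes "0 \<le> c"
  shows "psd 2 (pure c u v)"
proof -
  have "mat_adjoint (pure c u v) = pure c u v"
  proof (rule eq_matI)
    fix i j assume "i < dim_row (pure c u v)" "j < dim_col (pure c u v)"
    then have "i < 2" "j < 2" by (simp_all add: pure_def)
    then show "mat_adjoint (pure c u v) $$ (i, j) = pure c u v $$ (i, j)"
      by (subst index_mat_adjoint[OF pure_index(1)]) (simp_all add: pure_def)
  qed (simp_all add: pure_def mat_adjoint_def)
  moreover have "0 \<le> Re ((pure c u v *\<^sub>v w) \<bullet>c w)" if w: "w \<in> carrier_vec 2" for w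
  proof -
    have "(pure c u v *\<^sub>v w) \<bullet>c w =
        of_real c * ((cnj u * w $ 0 + cnj v * w $ 1) * cnj (cnj u * w $ 0 + cnj v * w $ 1))"
      by (subst quad_form2[OF pure_index(1) w]) (simp add: algebra_simps)
    also have "\<dots> = of_real (c * (cmod (cnj u * w $ 0 + cnj v * w $ 1))\<^sup>2)"
      by (simp only: complex_norm_square[symmetric] of_real_mult)
    finally show ?thesis using assms by simp
  qed
  ultimately show ?thesis by (simp add: psd_def)
qed

lemma psd_zero: "psd 2 (0\<^sub>m 2 2)"
proof -
  have "pure 0 0 0 = 0\<^sub>m 2 2" by (rule eq_matI) (auto simp: pure_def)
  with psd_pure[of 0 0 0] show ?thesis by simp
qed

fun base_state :: "bool \<Rightarrow> complex mat" where
  "base_state True = pure 1 1 0"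
| "base_state False = pure 1 0 1"

text \<open>Kinds 2 to 5 get the eigenstates of the Pauli matrices X and Y, all other names one of
  the two eigenstates of Z: three mutually orthogonal axes.\<close>

definition state_of :: "(name \<Rightarrow> bool) \<Rightarrow> name \<Rightarrow> complex mat" where
  "state_of v x = (if fst x = 2 then pure (1 / 2) 1 1 else if fst x = 3 then pure (1 / 2) 1 (- 1)
     else if fst x = 4 then pure (1 / 2) 1 \<i> else if fst x = 5 then pure (1 / 2) 1 (- \<i>)
     else base_state (lit_val v x))"

definition regular :: "nat \<times> 'a \<Rightarrow> bool" where
  "regular x \<longleftrightarrow> fst x \<notin> {2, 3, 4, 5}"

lemma quantum_state_pure:
  "0 \<le> c \<Longrightarrow> of_real c * u * cnj u + of_real c * v * cnj v = 1 \<Longrightarrow> quantum_state 2 (pure c u v)"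
  unfolding quantum_state_def
  by (intro conjI psd_pure) (simp_all add: mat_trace_def pure_def numeral_2_eq_2)

lemma trace_pure:
  "mat_trace (pure c u v * pure c' u' v') =
     of_real (c * c') * ((u * cnj u' + v * cnj v') * (cnj u * u' + cnj v * v'))"
  by (subst mat_trace_mult2[OF pure_index(1) pure_index(1)]) (simp add: algebra_simps)

lemma quantum_state_of: "quantum_state 2 (state_of v x)"
  unfolding state_of_def
  by (cases "lit_val v x") (auto intro!: quantum_state_pure)

text \<open>What is used of opposite pure states: they are the two effects of a measurement, and
  each effect has probability 0 on the other state.\<close>

definition antipodal :: "complex mat \<Rightarrow> complex mat \<Rightarrow> bool" where
  "antipodal A B \<longleftrightarrow> psd 2 A \<and> psd 2 B \<and> mat_trace (A * B) = 0 \<and> mat_trace (B * A) = 0 \<and>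
     (\<forall>i<2. \<forall>j<2. A $$ (i, j) + B $$ (i, j) = (if i = j then 1 else 0))"

lemma antipodal_sym: "antipodal A B \<Longrightarrow> antipodal B A"
  by (auto simp: antipodal_def add.commute)

lemma antipodal_pure:
  assumes "0 \<le> c" "0 \<le> c'" "u * cnj u' + v * cnj v' = 0"
    and "of_real c * u * cnj u + of_real c' * u' * cnj u' = 1"
    and "of_real c * v * cnj v + of_real c' * v' * cnj v' = 1"
    and "of_real c * u * cnj v + of_real c' * u' * cnj v' = 0"
  shows "antipodal (pure c u v) (pure c' u' v')"
proof -
  have "cnj u * u' + cnj v * v' = 0" using arg_cong[OF assms(3), of cnj] by simp
  then have "mat_trace (pure c u v * pure c' u' v') = 0" "mat_trace (pure c' u' v' * pure c u v) = 0"
    using assms(3) by (simp_all add: trace_pure mult.commute)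
  moreover have "of_real c * v * cnj u + of_real c' * v' * cnj u' = 0"
    using arg_cong[OF assms(6), of cnj] by (simp add: mult.commute mult.left_commute)
  ultimately show ?thesis
    using assms by (auto simp: antipodal_def psd_pure less_2_cases_iff)
qed

lemma antipodal_base: "antipodal (base_state True) (base_state False)"
  by (auto intro!: antipodal_pure)

lemma antipodal_neg: "antipodal (state_of v (neg x)) (state_of v x)"
proof -
  obtain k a where x: "x = (k, a)" by (cases x)
  consider "k = 2" | "k = 3" | "k = 4" | "k = 5" | "k \<notin> {2, 3, 4, 5}" by blast
  then show ?thesis
  proof cases
    case 5
    then have "fst (neg x) \<notin> {2, 3, 4, 5}" unfolding x by (auto elim!: oddE evenE)
    then have "state_of v (neg x) = base_state (\<not> lit_val v x)"
      by (simp add: state_of_def)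
    moreover have "state_of v x = base_state (lit_val v x)" using 5 by (simp add: state_of_def x)
    ultimately show ?thesis
      using antipodal_base antipodal_sym[OF antipodal_base] by (cases "lit_val v x") simp_all
  qed (auto simp: state_of_def x intro!: antipodal_pure)
qed

lemma antipodal_regular:
  assumes "regular l" "regular l'" "lit_val v l" "\<not> lit_val v l'"
  shows "antipodal (state_of v l) (state_of v l')"
  using assms antipodal_base by (auto simp: state_of_def regular_def)

text \<open>Outcome \<open>j\<close> gets \<open>\<rho> k\<close> and outcome \<open>k\<close> gets
  \<open>\<rho> j\<close>, so each of the two states meets the effect orthogonal to it; the other
  three effects are zero.\<close>

lemma antipodal_measurement:
  assumes "j < 5" "k < 5" "j \<noteq> k" "antipodal (\<rho> j) (\<rho> k)"
    and "\<And>z. \<rho> z \<in> carrier_mat 2 2"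
  shows "\<exists>F. measurement 2 5 F \<and> (\<forall>z. mat_trace (\<rho> z * F (Suc z)) = 0) \<and> F (Suc j) = \<rho> k"
proof -
  define F where "F z = (if z = Suc j then \<rho> k else if z = Suc k then \<rho> j else 0\<^sub>m 2 2)" for z
  have "(\<Sum>z=1..5. F z $$ (i, l)) = (if i = l then 1 else 0)" if "i < 2" "l < 2" for i l
  proof -
    have "(\<Sum>z=1..5. F z $$ (i, l)) = (\<Sum>z<5. F (Suc z) $$ (i, l))" by (rule sum_upto_5)
    also have "\<dots> = (\<Sum>z\<in>{j, k}. F (Suc z) $$ (i, l))"
      using assms(1,2) that by (intro sum.mono_neutral_right) (auto simp: F_def)
    also have "\<dots> = (if i = l then 1 else 0)"
      using assms(3,4) that by (auto simp: F_def antipodal_def add.commute)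
    finally show ?thesis .
  qed
  then have "mat 2 2 (\<lambda>(i, l). \<Sum>z=1..5. F z $$ (i, l)) = 1\<^sub>m 2"
    by (intro eq_matI) (simp_all del: One_nat_def)
  then have m: "measurement 2 5 F"
    using assms(4) by (auto simp: measurement_def F_def antipodal_def psd_zero)
  have z: "mat_trace (\<rho> z * F (Suc z)) = 0" for z
  proof -
    have "mat_trace (\<rho> z * 0\<^sub>m 2 2) = 0"
      using assms(5)[of z] by (simp add: mat_trace_def)
    then show ?thesis
      using assms(3,4) by (auto simp: F_def antipodal_def)
  qed
  show ?thesis using m z by (intro exI[of _ F]) (simp add: F_def)
qed

text \<open>Every clause is realised independently, from a true and a false literal or from a pair
  \<open>neg x\<close>, \<open>x\<close>. For such a pair \<open>Q\<close> also records the first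
  effect, on which the entries with probability 1/2 depend.\<close>

lemma assignment_imp_solves:
  assumes X: "cl meas_X = decl plus_name" and Y: "cl meas_Y = decl imag_name"
    and len: "\<And>y. length (cl y) = 5"
    and sat: "\<And>y. (\<exists>x. cl y = decl x) \<or> (\<exists>l \<in> set (cl y). \<exists>l' \<in> set (cl y).
      regular l \<and> regular l' \<and> lit_val v l \<and> \<not> lit_val v l')"
    and es: "\<And>x y z h. (x, y, z, h) \<in> set es \<Longrightarrow>
      \<not> h \<and> (\<exists>j<5. z = Suc j \<and> x = cl y ! j) \<or>
      h \<and> z = 1 \<and> (y = meas_X \<and> regular x \<or> y = meas_Y \<and> (regular x \<or> x = plus_name))"
  shows "\<exists>E. solves 2 (state_of v) E es"
proof -
  have car: "state_of v x \<in> carrier_mat 2 2" for x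
    using quantum_state_of[of v x] by (simp add: quantum_state_def psd_def)
  define Q where "Q y F \<longleftrightarrow> measurement 2 5 F \<and>
      (\<forall>z<5. mat_trace (state_of v (cl y ! z) * F (Suc z)) = 0) \<and>
      (\<forall>x. cl y = decl x \<longrightarrow> F 1 = state_of v x)" for y F
  have "\<exists>F. Q y F" for y
  proof (cases "\<exists>x. cl y = decl x")
    case True
    then obtain x where x: "cl y = decl x" by blast
    then have x': "x' = x" if "cl y = decl x'" for x' using that by (simp add: decl_def)
    have "antipodal (state_of v (cl y ! 0)) (state_of v (cl y ! 1))"
      unfolding x using antipodal_neg by (simp add: decl_def)
    with antipodal_measurement[of 0 1 "\<lambda>z. state_of v (cl y ! z)"] car
    obtain F where F: "measurement 2 5 F"
      "\<And>z. mat_trace (state_of v (cl y ! z) * F (Suc z)) = 0" "F (Suc 0) = state_of v (cl y ! 1)"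
      by auto
    have "F 1 = state_of v x" using F(3) x by (simp add: decl_def)
    with F(1,2) x' show ?thesis unfolding Q_def by blast
  next
    case False
    then obtain l l' where l: "l \<in> set (cl y)" "l' \<in> set (cl y)" "regular l" "regular l'"
      "lit_val v l" "\<not> lit_val v l'" using sat by blast
    obtain j k where jk: "j < 5" "k < 5" "l = cl y ! j" "l' = cl y ! k"
      using l(1,2) len[of y] by (metis in_set_conv_nth)
    have "j \<noteq> k" using l(5,6) jk(3,4) by auto
    have "antipodal (state_of v (cl y ! j)) (state_of v (cl y ! k))"
      using antipodal_regular[OF l(3-6)] jk by simp
    with antipodal_measurement[of j k "\<lambda>z. state_of v (cl y ! z)"] jk(1,2) \<open>j \<noteq> k\<close> car
    obtain F where "measurement 2 5 F"
      "\<And>z. mat_trace (state_of v (cl y ! z) * F (Suc z)) = 0"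
      by blast
    with False show ?thesis unfolding Q_def by blast
  qed
  then have "\<exists>E. \<forall>y. Q y (E y)" by (intro choice allI)
  then obtain E where E: "\<And>y. measurement 2 5 (E y)"
    "\<And>y z. z < 5 \<Longrightarrow> mat_trace (state_of v (cl y ! z) * E y (Suc z)) = 0"
    "\<And>y x. cl y = decl x \<Longrightarrow> E y 1 = state_of v x"
    unfolding Q_def by blast
  have half: "mat_trace (state_of v x * pure (1 / 2) 1 1) = 1 / 2"
    "mat_trace (state_of v x * pure (1 / 2) 1 \<i>) = 1 / 2" if "regular x" for x
    using that by (cases "lit_val v x"; simp add: state_of_def trace_pure regular_def)+
  have half': "mat_trace (state_of v plus_name * pure (1 / 2) 1 \<i>) = 1 / 2"
    by (simp add: state_of_def trace_pure algebra_simps)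
  have E1: "E meas_X 1 = pure (1 / 2) 1 1" "E meas_Y 1 = pure (1 / 2) 1 \<i>"
    using E(3)[OF X] E(3)[OF Y] by (simp_all add: state_of_def)
  have "solves 2 (state_of v) E es"
    unfolding solves_def
  proof (rule ballI)
    fix e assume e: "e \<in> set es"
    obtain x y z h where xyz: "e = (x, y, z, h)" by (cases e)
    have "mat_trace (state_of v x * E y z) = of_rat (half_if h)"
    proof (cases h)
      case True
      then have "z = 1" "y = meas_X \<and> regular x \<or> y = meas_Y \<and> (regular x \<or> x = plus_name)"
        using es[of x y z h] e xyz by blast+
      then have "mat_trace (state_of v x * E y z) = 1 / 2"
        using E1 half half' by metis
      with True show ?thesis by (simp add: half_if_def of_rat_divide)
    next
      case False
      then obtain j where "j < 5" "z = Suc j" "x = cl y ! j"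
        using es[of x y z h] e xyz by blast
      with False E(2) show ?thesis by (simp add: half_if_def)
    qed
    with quantum_state_of E(1) show "case e of (x, y, z, h) \<Rightarrow> quantum_state 2 (state_of v x) \<and>
        measurement 2 5 (E y) \<and> mat_trace (state_of v x * E y z) = of_rat (half_if h)"
      by (simp add: xyz)
  qed
  then show ?thesis by blast
qed

section \<open>The tableau of a computation\<close>

abbreviation T_true :: tname where "T_true \<equiv> (0, 0, (False, 0), (False, 0))"
abbreviation T_false :: tname where "T_false \<equiv> (1, 0, (False, 0), (False, 0))"
abbreviation T_plus :: tname where "T_plus \<equiv> (2, 0, (False, 0), (False, 0))"
abbreviation T_imag :: tname where "T_imag \<equiv> (4, 0, (False, 0), (False, 0))"
abbreviation T_X :: tname where "T_X \<equiv> (0, 0, (False, 0), (False, 0))"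
abbreviation T_Y :: tname where "T_Y \<equiv> (0, 1, (False, 0), (False, 0))"

text \<open>\<open>pc_at l dt\<close>: the program counter is \<open>l\<close> at time \<open>t + dt\<close>. \<open>cell b r di dt\<close>: at time
  \<open>t + dt\<close>, stack \<open>r\<close> has a position \<open>i + di\<close> counted from the top, and it contains \<open>b\<close>.\<close>

definition pc_at :: "nat \<Rightarrow> nat \<Rightarrow> tname" where
  "pc_at l dt = (6, l, (False, 0), (True, dt))"

definition cell_kind :: "bool \<Rightarrow> nat" where
  "cell_kind b = (if b then 10 else 8)"

definition cell :: "bool \<Rightarrow> nat \<Rightarrow> nat \<Rightarrow> nat \<Rightarrow> tname" where
  "cell b r di dt = (cell_kind b, r, (True, di), (True, dt))"

text \<open>Only the set of literals matters, so repeating the last one fills the five outcomes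
  without changing the disjunction.\<close>

definition or_clause :: "tname list \<Rightarrow> tname list" where
  "or_clause ls = T_false # ls @ replicate (4 - length ls) (last ls)"

text \<open>Position \<open>i + shift_from\<close> before an instruction and position
  \<open>i + shift_to\<close> after it hold the same bit, or are both beyond the end of the
  stack.\<close>

fun shift_from :: "instr \<Rightarrow> nat \<Rightarrow> nat" where
  "shift_from (Pop r e l0 l1) r' = (if r = r' then 1 else 0)"
| "shift_from _ r' = 0"

fun shift_to :: "instr \<Rightarrow> nat \<Rightarrow> nat" where
  "shift_to (Push r b l) r' = (if r = r' then 1 else 0)"
| "shift_to _ r' = 0"

text \<open>Both directions are needed for each bit, since the absence of a cell must be carried
  along as well as its content.\<close>

definition copy_clauses :: "nat \<Rightarrow> instr \<Rightarrow> nat \<Rightarrow> tname list list" where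
  "copy_clauses l ins r = concat (map (\<lambda>b.
     [[neg (pc_at l 0), neg (cell b r (shift_from ins r) 0), cell b r (shift_to ins r) 1],
      [neg (pc_at l 0), cell b r (shift_from ins r) 0, neg (cell b r (shift_to ins r) 1)]]) [False, True])"

text \<open>A pop branches on the cell at position 0; an empty stack is the absence of both cells,
  and this case uses all four literals.\<close>

fun step_clauses :: "nat \<Rightarrow> instr \<Rightarrow> tname list list" where
  "step_clauses l (Push r b l') =
     [[neg (pc_at l 0), pc_at l' 1], [neg (pc_at l 0), cell b r 0 1], [neg (pc_at l 0), neg (cell (\<not> b) r 0 1)]]"
| "step_clauses l (Pop r e l0 l1) =
     [[neg (pc_at l 0), neg (cell True r 0 0), pc_at l1 1], [neg (pc_at l 0), neg (cell False r 0 0), pc_at l0 1],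
      [neg (pc_at l 0), cell True r 0 0, cell False r 0 0, pc_at e 1]]"
| "step_clauses l (Halt b) = [[neg (pc_at l 0), pc_at l 1]]"
| "step_clauses l (Query r l') = []"

text \<open>Template 0 contains the frame and the start label, 1 acceptance at the last time. Templates 2
  and 3 declare the variables for labels and cells; 3 also moves the cells, and 4 treats the
  successor label and a pushed top. Templates 5 to 9 concern time 0: 5 says that stack 1 has no gaps
  and the stacks from 2 on are empty, 6 to 8 fix a position of stack 0, and 9 bounds the witness.\<close>

definition disjs :: "program \<Rightarrow> nat \<Rightarrow> nat \<Rightarrow> tname list list" where
  "disjs V R k =
    (if k = 0 then [[pc_at 0 0]]
     else if k = 1 then map (\<lambda>l. [neg (pc_at l 0)]) (filter (\<lambda>l. V ! l \<noteq> Halt True) [0..<length V])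
     else if k = 3 then concat (map (\<lambda>l. concat (map (copy_clauses l (V ! l)) [0..<R])) [0..<length V])
     else if k = 4 then concat (map (\<lambda>l. step_clauses l (V ! l)) [0..<length V])
     else if k = 5 then
       concat (map (\<lambda>r. [[neg (cell True r 0 0)], [neg (cell False r 0 0)]]) [2..<R]) @
       [[neg (cell True 1 0 0), neg (cell False 1 0 0)],
        [neg (cell True 1 1 0), cell True 1 0 0, cell False 1 0 0],
        [neg (cell False 1 1 0), cell True 1 0 0, cell False 1 0 0]]
     else if k = 6 then [[cell True 0 0 0], [neg (cell False 0 0 0)]]
     else if k = 7 then [[cell False 0 0 0], [neg (cell True 0 0 0)]]
     else if k = 8 then [[neg (cell True 0 0 0)], [neg (cell False 0 0 0)]]
     else if k = 9 then [[neg (cell True 1 0 0)], [neg (cell False 1 0 0)]]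
     else [])"

definition aligned :: "program \<Rightarrow> nat \<Rightarrow> nat \<Rightarrow> tname list" where
  "aligned V R k =
    (if k = 0 then [T_true]
     else if k = 2 then map (\<lambda>l. pc_at l 0) [0..<length V]
     else if k = 3 then map (\<lambda>(b, r). cell b r 0 0) (List.product [False, True] [0..<R])
     else [])"

definition clauses :: "program \<Rightarrow> nat \<Rightarrow> nat \<Rightarrow> tname list list" where
  "clauses V R k = map decl ((if k = 0 then [T_plus, T_imag] else []) @ aligned V R k) @
     map or_clause (disjs V R k)"

text \<open>A measurement is named by template, clause number and the two counters, hence is new in
  every block. The first two clauses of template 0, filled with zeros, thereby belong to
  \<open>meas_X\<close> and \<open>meas_Y\<close>.\<close>

definition clause_entries :: "nat \<Rightarrow> nat \<Rightarrow> tname list \<Rightarrow> tentry list" where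
  "clause_entries k j ls = map (\<lambda>z. (ls ! z, (k, j, (True, 0), (True, 0)), Suc z, False)) [0..<5]"

definition template :: "program \<Rightarrow> nat \<Rightarrow> nat \<Rightarrow> tentry list" where
  "template V R k =
     concat (map (\<lambda>j. clause_entries k j (clauses V R k ! j)) [0..<length (clauses V R k)]) @
     concat (map (\<lambda>x. [(x, T_X, 1, True), (x, T_Y, 1, True)]) (aligned V R k)) @
     (if k = 0 then [(T_plus, T_Y, 1, True)] else [])"

definition entries :: "program \<Rightarrow> nat \<Rightarrow> block list \<Rightarrow> entry list" where
  "entries V R bs = concat (map (\<lambda>(k, i, t). map (fill_entry i t) (template V R k)) bs)"

lemma fill_neg [simp]: "fill i t (neg x) = neg (fill i t x)"
  by (cases "(i, t, x)" rule: fill.cases) auto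

lemma map_fill_decl: "map (fill i t) (decl x) = decl (fill i t x)"
  by (simp add: decl_def)

lemma length_decl [simp]: "length (decl x) = 5"
  by (simp add: decl_def)

lemma disjs_length: "ls \<in> set (disjs V R k) \<Longrightarrow> ls \<noteq> [] \<and> length ls \<le> 4"
proof -
  have "ls \<in> set (step_clauses l ins) \<Longrightarrow> ls \<noteq> [] \<and> length ls \<le> 4" for l ins
    by (cases "(l, ins)" rule: step_clauses.cases) auto
  then show "ls \<in> set (disjs V R k) \<Longrightarrow> ls \<noteq> [] \<and> length ls \<le> 4"
    by (auto simp: disjs_def copy_clauses_def split: if_splits)
qed

lemma length_clause: "ls \<in> set (clauses V R k) \<Longrightarrow> length ls = 5"
  using disjs_length by (fastforce simp: clauses_def or_clause_def)

lemma set_or_clause: "ls \<noteq> [] \<Longrightarrow> set (or_clause ls) = insert T_false (set ls)"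
  by (auto simp: or_clause_def)

lemma regular_pc_at [simp]: "regular (pc_at l dt)" "regular (neg (pc_at l dt))"
  "regular (cell b r di dt)" "regular (neg (cell b r di dt))"
  by (auto simp: regular_def pc_at_def cell_def cell_kind_def)

lemma disjs_regular: "ls \<in> set (disjs V R k) \<Longrightarrow> x \<in> set ls \<Longrightarrow> regular x"
proof -
  have "ls \<in> set (step_clauses l ins) \<Longrightarrow> x \<in> set ls \<Longrightarrow> regular x" for l ins
    by (cases "(l, ins)" rule: step_clauses.cases) (auto)
  then show "ls \<in> set (disjs V R k) \<Longrightarrow> x \<in> set ls \<Longrightarrow> regular x"
    unfolding disjs_def copy_clauses_def by (auto split: if_splits)
qed

lemma fst_fill [simp]: "fst (fill i t x) = fst x"
  by (cases "(i, t, x)" rule: fill.cases) auto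

lemma aligned_regular: "x \<in> set (aligned V R k) \<Longrightarrow> even (fst x) \<and> regular x"
  by (auto simp: regular_def aligned_def pc_at_def cell_def cell_kind_def split: if_splits)

section \<open>The instance determines a satisfiability problem\<close>

lemma fill_entry_in_entries:
  "(k, i, t) \<in> set bs \<Longrightarrow> e \<in> set (template V R k) \<Longrightarrow> fill_entry i t e \<in> set (entries V R bs)"
  by (auto simp: entries_def intro!: bexI[of _ "(k, i, t)"])

lemma clause_in_entries:
  assumes "(k, i, t) \<in> set bs" "j < length (clauses V R k)"
  shows "has_clause (entries V R bs) (k, j, i, t) (map (fill i t) (clauses V R k ! j))"
  unfolding has_clause_def
proof (intro conjI allI impI)
  have len: "length (clauses V R k ! j) = 5" using length_clause[OF nth_mem[OF assms(2)]] .
  then show "length (map (fill i t) (clauses V R k ! j)) = 5" by simp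
  fix z :: nat assume z: "z < 5"
  then have "(clauses V R k ! j ! z, (k, j, (True, 0), (True, 0)), Suc z, False) \<in> set (template V R k)"
    using assms(2) unfolding template_def clause_entries_def by (auto intro!: bexI[of _ j])
  then have "fill_entry i t (clauses V R k ! j ! z, (k, j, (True, 0), (True, 0)), Suc z, False)
      \<in> set (entries V R bs)"
    using fill_entry_in_entries[OF assms(1)] by blast
  with z len show "(map (fill i t) (clauses V R k ! j) ! z, (k, j, i, t), Suc z, False) \<in> set (entries V R bs)"
    by simp
qed

lemma decl_in_entries:
  assumes "(k, i, t) \<in> set bs" "x \<in> set (aligned V R k)"
  shows "aligned_in (entries V R bs) (fill i t x)"
proof -
  have "decl x \<in> set (clauses V R k)" using assms(2) by (simp add: clauses_def)
  then obtain j where j: "j < length (clauses V R k)" "clauses V R k ! j = decl x"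
    by (metis in_set_conv_nth)
  from clause_in_entries[OF assms(1) j(1)] have
    "has_clause (entries V R bs) (k, j, i, t) (decl (fill i t x))" by (simp add: j map_fill_decl)
  moreover have "(x, T_X, 1, True) \<in> set (template V R k)" "(x, T_Y, 1, True) \<in> set (template V R k)"
    using assms(2) by (auto simp: template_def)
  then have "fill_entry i t (x, T_X, 1, True) \<in> set (entries V R bs)"
    "fill_entry i t (x, T_Y, 1, True) \<in> set (entries V R bs)"
    using fill_entry_in_entries[OF assms(1)] by blast+
  moreover have "even (fst (fill i t x))" using aligned_regular[OF assms(2)] by (simp add: regular_def)
  ultimately show ?thesis unfolding aligned_in_def by auto
qed

definition sat_disjs :: "program \<Rightarrow> nat \<Rightarrow> block list \<Rightarrow> (name \<Rightarrow> bool) \<Rightarrow> bool" where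
  "sat_disjs V R bs v \<longleftrightarrow> (\<forall>(k, i, t) \<in> set bs. \<forall>ls \<in> set (disjs V R k). \<exists>x \<in> set ls. lit_val v (fill i t x))"

definition declared :: "program \<Rightarrow> nat \<Rightarrow> block list \<Rightarrow> name set" where
  "declared V R bs = (\<Union>(k, i, t) \<in> set bs. fill i t ` set (aligned V R k))"

text \<open>Only declared variables are bound to the axis. A disjunction that mentions, say, a cell
  at time \<open>T\<close> or a label outside the program contains a state that may point anywhere,
  hence the restriction to declared literals.\<close>

lemma solves_entries_imp_sat:
  assumes "solves 2 \<rho> E (entries V R bs)" "(0, 0, 0) \<in> set bs"
  obtains v where "\<And>k i t ls. (k, i, t) \<in> set bs \<Longrightarrow> ls \<in> set (disjs V R k) \<Longrightarrow>
      (\<And>x. x \<in> set ls \<Longrightarrow> fill i t x \<in> declared V R bs \<or> neg (fill i t x) \<in> declared V R bs) \<Longrightarrow>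
      \<exists>x \<in> set ls. lit_val v (fill i t x)"
proof -
  let ?es = "entries V R bs"
  have al: "aligned_in ?es x" if "x \<in> declared V R bs" for x
    using that decl_in_entries unfolding declared_def by blast
  have c: "clauses V R 0 = decl T_plus # decl T_imag # decl T_true # map or_clause (disjs V R 0)"
    by (simp add: clauses_def aligned_def)
  have X: "has_clause ?es meas_X (decl plus_name)" "has_clause ?es meas_Y (decl imag_name)"
    using clause_in_entries[OF assms(2), of 0 V R] clause_in_entries[OF assms(2), of 1 V R]
    by (simp_all add: c map_fill_decl)
  have "(T_plus, T_Y, 1, True) \<in> set (template V R 0)" by (simp add: template_def)
  then have "fill_entry 0 0 (T_plus, T_Y, 1, True) \<in> set ?es"
    using fill_entry_in_entries[OF assms(2)] by blast
  then have XY: "(plus_name, meas_Y, 1, True) \<in> set ?es" by simp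
  have "fill 0 0 T_true \<in> declared V R bs"
    using assms(2) unfolding declared_def by (intro UN_I[of "(0, 0, 0)"]) (simp_all add: aligned_def)
  then have t: "true_name \<in> declared V R bs" by simp
  obtain v where v: "v true_name"
    "\<And>y ls. has_clause ?es y ls \<Longrightarrow> (\<And>l. l \<in> set ls \<Longrightarrow> aligned_in ?es l \<or> aligned_in ?es (neg l)) \<Longrightarrow>
      \<exists>l \<in> set ls. \<exists>l' \<in> set ls. lit_val v l \<and> \<not> lit_val v l'"
    using solves_imp_assignment[OF assms(1) X XY al[OF t]] by blast
  show thesis
  proof (rule that[of v])
    fix k i t ls
    assume b: "(k, i, t) \<in> set bs" and ls: "ls \<in> set (disjs V R k)"
      and d: "\<And>x. x \<in> set ls \<Longrightarrow> fill i t x \<in> declared V R bs \<or> neg (fill i t x) \<in> declared V R bs"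
    have "or_clause ls \<in> set (clauses V R k)" using ls by (simp add: clauses_def)
    then obtain j where j: "j < length (clauses V R k)" "clauses V R k ! j = or_clause ls"
      by (metis in_set_conv_nth)
    have "has_clause ?es (k, j, i, t) (map (fill i t) (or_clause ls))"
      using clause_in_entries[OF b j(1)] j(2) by simp
    moreover have s: "set (map (fill i t) (or_clause ls)) = insert (neg true_name) (fill i t ` set ls)"
      using disjs_length[OF ls] by (auto simp: set_or_clause)
    moreover have "aligned_in ?es l \<or> aligned_in ?es (neg l)"
      if "l \<in> insert (neg true_name) (fill i t ` set ls)" for l
      using that
    proof
      assume "l = neg true_name"
      with al[OF t] show ?thesis by (metis neg_neg)
    next
      assume "l \<in> fill i t ` set ls"
      with d al show ?thesis by blast
    qed
    ultimately obtain l where "l \<in> insert (neg true_name) (fill i t ` set ls)" "lit_val v l"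
      using v(2) by (metis (no_types, lifting))
    moreover have "\<not> lit_val v (neg true_name)" using v(1) by (simp add: lit_val_def)
    ultimately show "\<exists>x \<in> set ls. lit_val v (fill i t x)" by auto
  qed
qed

lemma sat_imp_solves_entries:
  assumes sat: "sat_disjs V R bs v" and "v true_name" and "(0, 0, 0) \<in> set bs"
  shows "\<exists>E. solves 2 (state_of v) E (entries V R bs)"
proof -
  \<comment> \<open>Names that belong to no clause get \<open>decl true_name\<close>, which every
    assignment realises.\<close>
  define cl where "cl = (\<lambda>(k, j, i, t). if (k, i, t) \<in> set bs \<and> j < length (clauses V R k)
    then map (fill i t) (clauses V R k ! j) else decl true_name)"
  have c0: "clauses V R 0 = decl T_plus # decl T_imag # decl T_true # map or_clause (disjs V R 0)"
    by (simp add: clauses_def aligned_def)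
  show ?thesis
  proof (rule assignment_imp_solves[of cl])
    show "cl meas_X = decl plus_name" "cl meas_Y = decl imag_name"
      using assms(3) by (simp_all add: cl_def c0 map_fill_decl)
    fix y :: name
    obtain k j i t where y: "y = (k, j, i, t)" by (cases y)
    show "length (cl y) = 5" using length_clause[OF nth_mem] by (auto simp: cl_def y)
    show "(\<exists>x. cl y = decl x) \<or> (\<exists>l \<in> set (cl y). \<exists>l' \<in> set (cl y).
      regular l \<and> regular l' \<and> lit_val v l \<and> \<not> lit_val v l')"
    proof (cases "(k, i, t) \<in> set bs \<and> j < length (clauses V R k)")
      case True
      then have cl: "cl y = map (fill i t) (clauses V R k ! j)" by (simp add: cl_def y)
      have "clauses V R k ! j \<in> set (clauses V R k)" using True by simp
      then consider x where "clauses V R k ! j = decl x"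
        | ls where "ls \<in> set (disjs V R k)" "clauses V R k ! j = or_clause ls"
        unfolding clauses_def by auto
      then show ?thesis
      proof cases
        case 1
        then have "cl y = decl (fill i t x)" by (simp add: cl map_fill_decl)
        then show ?thesis by blast
      next
        case 2
        have s: "set (cl y) = insert (neg true_name) (fill i t ` set ls)"
          using disjs_length[OF 2(1)] by (auto simp: cl 2(2) set_or_clause)
        obtain x where x: "x \<in> set ls" "lit_val v (fill i t x)"
          using sat True 2(1) unfolding sat_disjs_def by blast
        have "regular (fill i t x)" using disjs_regular[OF 2(1) x(1)] by (simp add: regular_def)
        moreover have "regular (neg true_name)" "\<not> lit_val v (neg true_name)"
          using assms(2) by (simp_all add: lit_val_def regular_def)
        ultimately show ?thesis using x s by blast
      qed
    next
      case False
      then have "cl y = decl true_name" unfolding cl_def y by (simp only: prod.case if_False)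
      then show ?thesis by blast
    qed
  next
    fix x y :: name and z h
    assume "(x, y, z, h) \<in> set (entries V R bs)"
    then obtain k i t e where b: "(k, i, t) \<in> set bs" and e: "e \<in> set (template V R k)"
      "(x, y, z, h) = fill_entry i t e" unfolding entries_def by auto
    from e(1) consider j where "j < length (clauses V R k)" "e \<in> set (clause_entries k j (clauses V R k ! j))"
      | u where "u \<in> set (aligned V R k)" "e \<in> {(u, T_X, 1, True), (u, T_Y, 1, True)}"
      | "e = (T_plus, T_Y, 1, True)"
      unfolding template_def by (auto split: if_splits)
    then show "\<not> h \<and> (\<exists>j<5. z = Suc j \<and> x = cl y ! j) \<or>
      h \<and> z = 1 \<and> (y = meas_X \<and> regular x \<or> y = meas_Y \<and> (regular x \<or> x = plus_name))"
    proof cases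
      case 1
      have "length (clauses V R k ! j) = 5" using length_clause[OF nth_mem[OF 1(1)]] .
      with 1 b e(2) show ?thesis by (auto simp: clause_entries_def cl_def)
    next
      case 2
      have "regular (fill i t u)" using aligned_regular[OF 2(1)] by (simp add: regular_def)
      with 2 e(2) show ?thesis by auto
    next
      case 3
      with e(2) show ?thesis by simp
    qed
  qed
qed

section \<open>Runs of the verifier\<close>

definition holds :: "store \<Rightarrow> nat \<Rightarrow> nat \<Rightarrow> bool \<Rightarrow> bool" where
  "holds s r i b \<longleftrightarrow> i < length (s r) \<and> s r ! i = b"

definition run :: "program \<Rightarrow> bool list list \<Rightarrow> nat \<Rightarrow> config" where
  "run V ws t = (step id V ^^ t) (init_config ws)"

fun uses_below :: "nat \<Rightarrow> instr \<Rightarrow> bool" where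
  "uses_below R (Push r b l) = (r < R)"
| "uses_below R (Pop r e l0 l1) = (r < R)"
| "uses_below R _ = True"

text \<open>\<open>2 \<le> R\<close> keeps both input stacks of the verifier among the tracked
  ones.\<close>

lemma ex_uses_below: "\<exists>R\<ge>2. \<forall>ins \<in> set V. uses_below R ins"
proof (induction V)
  case Nil
  show ?case by auto
next
  case (Cons ins V)
  then obtain R where R: "2 \<le> R" "\<forall>ins \<in> set V. uses_below R ins" by blast
  obtain m where m: "\<And>R. m \<le> R \<Longrightarrow> uses_below R ins"
  proof (rule that)
    fix R' assume "(case ins of Push r b l \<Rightarrow> Suc r | Pop r e l0 l1 \<Rightarrow> Suc r | _ \<Rightarrow> 0) \<le> R'"
    then show "uses_below R' ins" by (cases ins) auto
  qed
  have "uses_below (max m R) i" if "uses_below R i" for i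
    using that by (cases i) auto
  with R m have "\<forall>i \<in> set (ins # V). uses_below (max m R) i" by auto
  then show ?case using R(1) by (metis max.coboundedI2)
qed

lemma run_0: "run V ws 0 = init_config ws"
  by (simp add: run_def)

lemma run_Suc: "run V ws (Suc t) = step id V (run V ws t)"
  by (simp add: run_def)

lemma run_Suc_exec:
  "run V ws t = (pc, s) \<Longrightarrow> pc < length V \<Longrightarrow> run V ws (Suc t) = exec id (V ! pc) (pc, s)"
  by (simp add: run_Suc step_def)

lemma outcome_at_run:
  "outcome_at id V ws t b \<longleftrightarrow> fst (run V ws t) < length V \<and> V ! fst (run V ws t) = Halt b"
  by (simp add: outcome_at_def run_def Let_def)

lemma run_stuck: "length V \<le> fst (run V ws t) \<Longrightarrow> length V \<le> fst (run V ws (t + k))"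
  by (induction k) (auto simp: run_Suc step_def)

lemma run_halted:
  "outcome_at id V ws t b \<Longrightarrow> run V ws (t + k) = run V ws t"
  unfolding outcome_at_run
proof (induction k)
  case (Suc k)
  then show ?case by (cases "run V ws t") (simp add: run_Suc step_def)
qed simp

text \<open>Leaving the program is permanent, so a run with an outcome stays inside it at all times,
  and after halting it idles.\<close>

lemma decided_run:
  assumes "outcome_at id V ws t b"
  shows "fst (run V ws t') < length V" "t \<le> t' \<Longrightarrow> V ! fst (run V ws t') = Halt b"
proof -
  have later: "run V ws t' = run V ws t" if "t \<le> t'"
    using run_halted[OF assms, of "t' - t"] that by simp
  have h: "fst (run V ws t) < length V" "V ! fst (run V ws t) = Halt b"
    using assms by (auto simp: outcome_at_run)
  show "t \<le> t' \<Longrightarrow> V ! fst (run V ws t') = Halt b" using later h by simp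
  show "fst (run V ws t') < length V"
  proof (cases "t \<le> t'")
    case True
    with later h show ?thesis by simp
  next
    case False
    then have "run V ws (t' + (t - t')) = run V ws t" by simp
    with run_stuck[of V ws t' "t - t'"] h show ?thesis by (metis not_le)
  qed
qed

lemma holds_shift:
  assumes "\<And>r l. ins \<noteq> Query r l"
  shows "holds (snd (exec f ins (pc, s))) r (i + shift_to ins r) b = holds s r (i + shift_from ins r) b"
  using assms by (cases ins) (auto simp: holds_def nth_tl split: list.splits)

lemma holds_push: "holds (snd (exec f (Push r b l) (pc, s))) r 0 b' \<longleftrightarrow> b = b'"
  by (auto simp: holds_def)

lemma fst_exec_Pop: "fst (exec f (Pop r e l0 l1) (pc, s)) =
    (if holds s r 0 True then l1 else if holds s r 0 False then l0 else e)"
  by (cases "s r") (auto simp: holds_def)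

lemma holds_init: "holds (snd (init_config ws)) r i b \<longleftrightarrow> r < length ws \<and> i < length (ws ! r) \<and> ws ! r ! i = b"
  by (auto simp: holds_def init_config_def)

section \<open>Membership in the block list\<close>

lemma in_rows:
  "(k, i, t) \<in> set (concat (map (row_blocks T) (rev [0..<T]))) \<longleftrightarrow>
     t < T \<and> (k = 3 \<and> i < T \<or> k = 4 \<and> i = 0 \<or> k = 2 \<and> i = 0)"
proof -
  have A: "(k, i, t) \<in> set (concat (map (row_blocks T) (rev [0..<T]))) \<longleftrightarrow>
      (\<exists>t'<T. (k, i, t) \<in> set (row_blocks T t'))" by (auto simp: atLeast0LessThan)
  have B: "(k, i, t) \<in> set (row_blocks T t') \<longleftrightarrow>
      t = t' \<and> (k = 3 \<and> i < T \<or> k = 4 \<and> i = 0 \<or> k = 2 \<and> i = 0)" for t'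
    unfolding row_blocks_def by (auto simp: image_iff)
  show ?thesis unfolding A B by blast
qed

lemma in_inits:
  "(k, i, t) \<in> set (concat (map (init_blocks w m) (rev [0..<T]))) \<longleftrightarrow>
     t = 0 \<and> i < T \<and> (k = 5 \<or> k = (if i < length w then if w ! i then 6 else 7 else 8) \<or> k = 9 \<and> m \<le> i)"
proof -
  have A: "(k, i, t) \<in> set (concat (map (init_blocks w m) (rev [0..<T]))) \<longleftrightarrow>
      (\<exists>i'<T. (k, i, t) \<in> set (init_blocks w m i'))" by (auto simp: atLeast0LessThan)
  have B: "(k, i, t) \<in> set (init_blocks w m i') \<longleftrightarrow> i = i' \<and>
      t = 0 \<and> (k = 5 \<or> k = (if i < length w then if w ! i then 6 else 7 else 8) \<or> k = 9 \<and> m \<le> i)" for i'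
    unfolding init_blocks_def by (cases "m \<le> i'") auto
  show ?thesis unfolding A B by blast
qed

lemma in_all_blocks:
  "(k, i, t) \<in> set (all_blocks w m T) \<longleftrightarrow>
     k = 0 \<and> i = 0 \<and> t = 0 \<or> k = 1 \<and> i = 0 \<and> t = T \<or> k = 2 \<and> i = 0 \<and> t \<le> T \<or>
     k = 3 \<and> i < T \<and> t < T \<or> k = 4 \<and> i = 0 \<and> t < T \<or>
     t = 0 \<and> i < T \<and> (k = 5 \<or> k = (if i < length w then if w ! i then 6 else 7 else 8) \<or> k = 9 \<and> m \<le> i)"
proof -
  have "(k, i, t) \<in> set (all_blocks w m T) \<longleftrightarrow> (k, i, t) = (1, 0, T) \<or> (k, i, t) = (2, 0, T) \<or>
      (k, i, t) \<in> set (concat (map (row_blocks T) (rev [0..<T]))) \<or>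
      (k, i, t) \<in> set (concat (map (init_blocks w m) (rev [0..<T]))) \<or> (k, i, t) = (0, 0, 0)"
    unfolding all_blocks_def by (auto simp del: set_concat)
  then show ?thesis unfolding in_rows in_inits prod.inject le_less by blast
qed

lemma fill_pc_at [simp]: "fill i t (pc_at l dt) = (6, l, 0, t + dt)"
  by (simp add: pc_at_def)

lemma fill_cell [simp]: "fill i t (cell b r di dt) = (cell_kind b, r, i + di, t + dt)"
  by (simp add: cell_def)

lemma lit_val_pos [simp]:
  "lit_val v (6, l, i, t) = v (6, l, i, t)" "lit_val v (cell_kind b, r, i, t) = v (cell_kind b, r, i, t)"
  by (simp_all add: lit_val_def cell_kind_def)

section \<open>Accepting runs satisfy the tableau\<close>

definition run_val :: "program \<Rightarrow> bool list list \<Rightarrow> name \<Rightarrow> bool" where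
  "run_val V ws = (\<lambda>(k, a, i, t). k = 0 \<or> k = 6 \<and> fst (run V ws t) = a \<or>
     (\<exists>b. k = cell_kind b \<and> holds (snd (run V ws t)) a i b))"

lemma run_val_simps [simp]:
  "run_val V ws (6, l, i, t) \<longleftrightarrow> fst (run V ws t) = l"
  "run_val V ws (cell_kind b, r, i, t) \<longleftrightarrow> holds (snd (run V ws t)) r i b"
  by (auto simp: run_val_def cell_kind_def)

text \<open>Runs are total and idle after halting, so their true description satisfies all
  disjunctions, also those at the boundary, and acceptance by time \<open>T\<close> is still visible
  at \<open>T\<close>.\<close>

lemma accepting_run_sat:
  assumes qf: "query_free V" and below: "\<forall>ins \<in> set V. uses_below R ins"
    and acc: "outcome_at id V [w, c] \<tau> True" "\<tau> \<le> T" and c: "length c \<le> m"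
  shows "sat_disjs V R (all_blocks w m T) (run_val V [w, c])"
  unfolding sat_disjs_def
proof (intro ballI, clarify)
  fix k i t ls
  assume b: "(k, i, t) \<in> set (all_blocks w m T)" and ls: "ls \<in> set (disjs V R k)"
  let ?run = "run V [w, c]"
  define L where "L x \<longleftrightarrow> lit_val (run_val V [w, c]) (fill i t x)" for x
  have L [simp]: "L (neg x) \<longleftrightarrow> \<not> L x" "L (pc_at l dt) \<longleftrightarrow> fst (?run (t + dt)) = l"
    "L (cell b r di dt) \<longleftrightarrow> holds (snd (?run (t + dt))) r (i + di) b" for x l dt b r di
    by (simp_all add: L_def)
  have len: "fst (?run t') < length V" for t' by (rule decided_run(1)[OF acc(1)])
  have exec: "?run (Suc t) = exec id (V ! fst (?run t)) (fst (?run t), snd (?run t))"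
    by (rule run_Suc_exec) (simp_all add: len)
  have init: "t = 0 \<Longrightarrow> holds (snd (?run t)) r j b \<longleftrightarrow>
      (r = 0 \<and> j < length w \<and> w ! j = b \<or> r = 1 \<and> j < length c \<and> c ! j = b)" for r j b
    by (auto simp: run_0 holds_init less_2_cases_iff nth_Cons split: nat.splits)
  have "\<exists>x \<in> set ls. L x"
  proof -
    consider "k = 0" "i = 0" "t = 0" | "k = 1" "t = T" | "k = 2" | "k = 3" | "k = 4" "i = 0"
      | "k = 5" "t = 0" | "k = 6" "t = 0" "i < length w" "w ! i" | "k = 7" "t = 0" "i < length w" "\<not> w ! i"
      | "k = 8" "t = 0" "length w \<le> i" | "k = 9" "t = 0" "m \<le> i"
      using b unfolding in_all_blocks by (auto split: if_splits)
    then show ?thesis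
    proof cases
      case 1
      then show ?thesis using ls by (simp add: disjs_def run_0 init_config_def)
    next
      case 2
      have "V ! fst (?run T) = Halt True" using decided_run(2)[OF acc] .
      with 2 show ?thesis using ls by (auto simp: disjs_def)
    next
      case 3
      then show ?thesis using ls by (simp add: disjs_def)
    next
      case 4
      then obtain l r where l: "l < length V" "ls \<in> set (copy_clauses l (V ! l) r)"
        using ls by (auto simp: disjs_def)
      show ?thesis
      proof (cases "fst (?run t) = l")
        case True
        have "V ! l \<noteq> Query r' l'" for r' l' using qf l(1) unfolding query_free_def by (metis nth_mem)
        from holds_shift[OF this, of id l "snd (?run t)" r i] exec True have
          "holds (snd (?run (Suc t))) r (i + shift_to (V ! l) r) b =
            holds (snd (?run t)) r (i + shift_from (V ! l) r) b" for b by simp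
        then show ?thesis using l(2) by (auto simp: copy_clauses_def)
      next
        case False
        then show ?thesis using l(2) by (auto simp: copy_clauses_def)
      qed
    next
      case 5
      then obtain l where l: "l < length V" "ls \<in> set (step_clauses l (V ! l))"
        using ls by (auto simp: disjs_def)
      show ?thesis
      proof (cases "fst (?run t) = l")
        case True
        have e: "?run (Suc t) = exec id (V ! l) (l, snd (?run t))" using exec True by simp
        show ?thesis
        proof (cases "V ! l")
          case (Push r b l')
          with l(2) e 5 holds_push[of id r b l' l "snd (?run t)"] show ?thesis by auto
        next
          case (Pop r e l0 l1)
          have "\<not> (holds (snd (?run t)) r 0 True \<and> holds (snd (?run t)) r 0 False)"
            by (auto simp: holds_def)
          with l(2) e 5 Pop fst_exec_Pop[of id r e l0 l1 l "snd (?run t)"] show ?thesis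
            by (auto split: if_splits)
        next
          case (Halt b)
          with l(2) e 5 show ?thesis by auto
        next
          case (Query r l')
          with l(2) show ?thesis by simp
        qed
      next
        case False
        with l(2) show ?thesis by (cases "V ! l") auto
      qed
    next
      case 6
      then show ?thesis using ls init by (auto simp: disjs_def)
    qed (use ls init c in \<open>auto simp: disjs_def\<close>)
  qed
  then show "\<exists>x \<in> set ls. lit_val (run_val V [w, c]) (fill i t x)" by (simp add: L_def)
qed


section \<open>Models of the tableau are accepting runs\<close>

lemmas [simp del] = neg.simps

lemma declared_pc:
  "l < length V \<Longrightarrow> t \<le> T \<Longrightarrow> (6, l, 0, t) \<in> declared V R (all_blocks w m T)"
  unfolding declared_def
  by (rule UN_I[of "(2, 0, t)"]) (auto simp: in_all_blocks aligned_def image_iff)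

lemma declared_cell:
  assumes "r < R" "i < T" "t < T"
  shows "(cell_kind b, r, i, t) \<in> declared V R (all_blocks w m T)"
proof -
  have "cell b r 0 0 \<in> set (aligned V R 3)" using assms by (cases b) (auto simp: aligned_def)
  then have "fill i t (cell b r 0 0) \<in> fill i t ` set (aligned V R 3)" by (rule imageI)
  then show ?thesis
    unfolding declared_def
    by (intro UN_I[of "(3, i, t)"]) (use assms in \<open>auto simp: in_all_blocks simp del: image_iff\<close>)
qed

text \<open>A cell depends on cells at most one position deeper one step earlier. So the cells with
  \<open>i + t < T\<close> are determined by each other, and they suffice to follow the label up to time \<open>T\<close>;
  no clauses are needed for the boundary \<open>i = T\<close>.\<close>

lemma sat_imp_accepting_run:
  assumes qf: "query_free V" and R: "2 \<le> R" and below: "\<forall>ins \<in> set V. uses_below R ins"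
    and dec: "\<And>c. length c \<le> m \<Longrightarrow> \<exists>\<tau>\<le>T. outcome_at id V [w, c] \<tau> (A c)"
    and sat: "\<And>k i t ls. (k, i, t) \<in> set (all_blocks w m T) \<Longrightarrow> ls \<in> set (disjs V R k) \<Longrightarrow>
      (\<And>x. x \<in> set ls \<Longrightarrow> fill i t x \<in> declared V R (all_blocks w m T) \<or>
        neg (fill i t x) \<in> declared V R (all_blocks w m T)) \<Longrightarrow>
      \<exists>x \<in> set ls. lit_val v (fill i t x)"
  shows "\<exists>c. length c \<le> m \<and> A c"
proof -
  let ?bs = "all_blocks w m T"
  let ?cell = "\<lambda>b r i t. v (cell_kind b, r, i, t)"
  have sat': "\<exists>x \<in> set ls. lit_val v (fill i t x)"
    if "(k, i, t) \<in> set ?bs" "ls \<in> set (disjs V R k)"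
      "\<forall>x \<in> set ls. fill i t x \<in> declared V R ?bs \<or> neg (fill i t x) \<in> declared V R ?bs" for k i t ls
    using sat that by blast
  have s5: "\<not> (?cell True 1 i 0 \<and> ?cell False 1 i 0)"
    "\<And>r b. 2 \<le> r \<Longrightarrow> r < R \<Longrightarrow> \<not> ?cell b r i 0" if i: "i < T" for i
  proof -
    have b: "(5, i, 0) \<in> set ?bs" using i by (simp add: in_all_blocks)
    show "\<not> (?cell True 1 i 0 \<and> ?cell False 1 i 0)"
      using sat'[OF b, of "[neg (cell True 1 0 0), neg (cell False 1 0 0)]"] i R
      by (simp add: disjs_def declared_cell)
    show "\<not> ?cell b r i 0" if "2 \<le> r" "r < R" for r b
    proof -
      have "[neg (cell b r 0 0)] \<in> set (disjs V R 5)"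
        using that by (cases b) (auto simp: disjs_def)
      then show ?thesis using sat'[OF \<open>(5, i, 0) \<in> set ?bs\<close>, of "[neg (cell b r 0 0)]"] i that
        by (simp add: declared_cell)
    qed
  qed
  have mono: "?cell True 1 i 0 \<or> ?cell False 1 i 0"
    if i: "Suc i < T" and c: "?cell True 1 (Suc i) 0 \<or> ?cell False 1 (Suc i) 0" for i
  proof -
    have b: "(5, i, 0) \<in> set ?bs" using i by (simp add: in_all_blocks)
    show ?thesis
      using sat'[OF b, of "[neg (cell True 1 1 0), cell True 1 0 0, cell False 1 0 0]"]
        sat'[OF b, of "[neg (cell False 1 1 0), cell True 1 0 0, cell False 1 0 0]"] i R c
      by (auto simp: disjs_def declared_cell)
  qed
  \<comment> \<open>The witness ends at the first position without a cell. Positions from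
    \<open>T\<close> on count as ends, so the least one exists and is at most
    \<open>T\<close>.\<close>
  define E where "E i \<longleftrightarrow> T \<le> i \<or> \<not> (?cell True 1 i 0 \<or> ?cell False 1 i 0)" for i
  define n where "n = (LEAST i. E i)"
  have "E T" by (simp add: E_def)
  then have n: "E n" "n \<le> T" unfolding n_def by (rule LeastI, rule Least_le)
  have below_n: "\<not> E i" if "i < n" for i using that unfolding n_def by (rule not_less_Least)
  have above_n: "E i" if "n \<le> i" for i
    using that
  proof (induction i rule: dec_induct)
    case base
    show ?case by (rule n)
  next
    case (step i)
    show ?case
    proof (cases "Suc i < T")
      case True
      with step mono[OF True] show ?thesis unfolding E_def by (meson Suc_lessD not_le)
    qed (simp add: E_def)
  qed
  have "n \<le> m"
  proof (cases "m < T")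
    case True
    then have b: "(9, m, 0) \<in> set ?bs" by (simp add: in_all_blocks)
    have "E m"
      using sat'[OF b, of "[neg (cell True 1 0 0)]"] sat'[OF b, of "[neg (cell False 1 0 0)]"] True R
      by (auto simp: disjs_def declared_cell E_def)
    then show ?thesis using below_n not_less by blast
  qed (use n in simp)
  \<comment> \<open>Below \<open>n\<close> exactly one of the two cells holds: one by minimality of
    \<open>n\<close>, and not both by \<open>s5\<close>.\<close>
  define c where "c = map (\<lambda>i. ?cell True 1 i 0) [0..<n]"
  have c: "length c \<le> m" using \<open>n \<le> m\<close> by (simp add: c_def)
  obtain \<tau> where \<tau>: "\<tau> \<le> T" "outcome_at id V [w, c] \<tau> (A c)" using dec[OF c] by blast
  let ?run = "run V [w, c]"
  have len: "fst (?run t) < length V" for t by (rule decided_run(1)[OF \<tau>(2)])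
  have inv: "v (6, fst (?run t), 0, t) \<and>
      (\<forall>r<R. \<forall>b i. i + t < T \<longrightarrow> ?cell b r i t = holds (snd (?run t)) r i b)" if "t \<le> T" for t
    using that
  proof (induction t)
    case 0
    have "fst (?run 0) = 0" by (simp add: run_0 init_config_def)
    moreover from this len[of 0] have "0 < length V" by simp
    then have "v (6, 0, 0, 0)"
      using sat'[of 0 0 0 "[pc_at 0 0]"] by (simp add: in_all_blocks disjs_def declared_pc)
    moreover have "?cell b r i 0 = holds (snd (?run 0)) r i b" if "r < R" "i < T" for r b i
    proof -
      consider "r = 0" "i < length w" | "r = 0" "length w \<le> i" | "r = 1" "i < n" | "r = 1" "n \<le> i" | "2 \<le> r"
        by linarith
      then show ?thesis
      proof cases
        case 1
        let ?k = "if w ! i then 6 else 7 :: nat"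
        have b: "(?k, i, 0) \<in> set ?bs" using 1 that by (simp add: in_all_blocks)
        have d: "set (disjs V R ?k) = {[cell (w ! i) 0 0 0], [neg (cell (\<not> w ! i) 0 0 0)]}"
          by (simp add: disjs_def)
        have "?cell (w ! i) 0 i 0" "\<not> ?cell (\<not> w ! i) 0 i 0"
          using sat'[OF b, of "[cell (w ! i) 0 0 0]"] sat'[OF b, of "[neg (cell (\<not> w ! i) 0 0 0)]"] that 1
          by (simp_all add: d declared_cell)
        then show ?thesis using 1 by (cases "b = w ! i") (auto simp: run_0 holds_init)
      next
        case 2
        have b: "(8, i, 0) \<in> set ?bs" using 2 that by (simp add: in_all_blocks)
        have "\<not> ?cell b 0 i 0"
          using sat'[OF b, of "[neg (cell b 0 0 0)]"] that 2 by (cases b) (simp_all add: disjs_def declared_cell)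
        then show ?thesis using 2 by (simp add: run_0 holds_init)
      next
        case 3
        have "?cell b 1 i 0 \<longleftrightarrow> ?cell True 1 i 0 = b"
          using below_n[OF 3(2)] s5(1)[OF that(2)] by (cases b) (auto simp: E_def)
        then show ?thesis using 3 by (simp add: run_0 holds_init c_def)
      next
        case 4
        have "\<not> ?cell b 1 i 0" using above_n[OF 4(2)] that by (cases b) (auto simp: E_def)
        then show ?thesis using 4 by (simp add: run_0 holds_init c_def)
      next
        case 5
        then show ?thesis using s5(2)[OF that(2) 5 that(1)] by (simp add: run_0 holds_init)
      qed
    qed
    ultimately show ?case by simp
  next
    case (Suc t)
    then have t: "t < T" by simp
    define l where "l = fst (?run t)"
    define s where "s = snd (?run t)"
    have run: "?run t = (l, s)" by (simp add: l_def s_def)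
    have l: "l < length V" unfolding l_def by (rule len)
    have run': "?run (Suc t) = exec id (V ! l) (l, s)" by (rule run_Suc_exec[OF run l])
    have IH: "v (6, l, 0, t)" "\<And>r b i. r < R \<Longrightarrow> i + t < T \<Longrightarrow> ?cell b r i t = holds s r i b"
      using Suc t by (auto simp: l_def s_def)
    have nq: "V ! l \<noteq> Query r' l'" for r' l' using qf l unfolding query_free_def by (metis nth_mem)
    have ub: "uses_below R (V ! l)" using below l by simp
    have b4: "(4, 0, t) \<in> set ?bs" using t by (simp add: in_all_blocks)
    have d4: "ls \<in> set (disjs V R 4)" if "ls \<in> set (step_clauses l (V ! l))" for ls
      using that l by (auto simp: disjs_def)
    note sat4 = sat'[OF b4 d4]
    have copy: "?cell b r (i + shift_to (V ! l) r) (Suc t) = holds (snd (?run (Suc t))) r (i + shift_to (V ! l) r) b"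
      if "r < R" "i + shift_to (V ! l) r + Suc t < T" for r b i
    proof -
      have f1: "shift_from (V ! l) r \<le> 1" by (cases "V ! l") auto
      have b: "(3, i, t) \<in> set ?bs" using that by (simp add: in_all_blocks)
      have d: "set (copy_clauses l (V ! l) r) \<subseteq> set (disjs V R 3)"
      proof -
        have "l \<in> {0..<length V}" "r \<in> {0..<R}" using that l by simp_all
        then show ?thesis by (simp add: disjs_def del: atLeastLessThan_iff) blast
      qed
      have "?cell b r (i + shift_from (V ! l) r) t = ?cell b r (i + shift_to (V ! l) r) (Suc t)"
        using sat'[OF b, of "[neg (pc_at l 0), neg (cell b r (shift_from (V ! l) r) 0), cell b r (shift_to (V ! l) r) 1]"]
          sat'[OF b, of "[neg (pc_at l 0), cell b r (shift_from (V ! l) r) 0, neg (cell b r (shift_to (V ! l) r) 1)]"]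
          subsetD[OF d] IH(1) that l f1 t
        by (cases b) (auto simp: copy_clauses_def declared_pc declared_cell)
      also have "?cell b r (i + shift_from (V ! l) r) t = holds s r (i + shift_from (V ! l) r) b"
        using IH(2) that f1 by simp
      also have "\<dots> = holds (snd (?run (Suc t))) r (i + shift_to (V ! l) r) b"
        unfolding run' using holds_shift[OF nq] by simp
      finally show ?thesis by simp
    qed
    have "?cell b r i (Suc t) = holds (snd (?run (Suc t))) r i b" if r: "r < R" "i + Suc t < T" for r b i
    proof (cases "shift_to (V ! l) r \<le> i")
      case True
      then show ?thesis using copy[of r "i - shift_to (V ! l) r" b] r by simp
    next
      case False
      \<comment> \<open>Only a freshly pushed top is not the image of an older cell.\<close>
      then obtain b' l' where push: "V ! l = Push r b' l'" and i: "i = 0"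
        by (cases "V ! l") (auto split: if_splits)
      have "?cell b' r 0 (Suc t)" "\<not> ?cell (\<not> b') r 0 (Suc t)"
        using sat4[of "[neg (pc_at l 0), cell b' r 0 1]"] sat4[of "[neg (pc_at l 0), neg (cell (\<not> b') r 0 1)]"]
          IH(1) push l t r by (auto simp: declared_pc declared_cell)
      then show ?thesis unfolding run' push i using holds_push by (cases "b = b'") auto
    qed
    moreover have "v (6, fst (?run (Suc t)), 0, Suc t)"
    proof -
      \<comment> \<open>The run never leaves the program, so the label actually taken is declared.
        As each clause names a single successor, the other targets of a pop may lie outside the
        program.\<close>
      have l': "fst (exec id (V ! l) (l, s)) < length V" using len[of "Suc t"] run' by simp
      show ?thesis
      proof (cases "V ! l")
        case (Push r b k)
        with sat4[of "[neg (pc_at l 0), pc_at k 1]"] IH(1) l t l' show ?thesis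
          by (simp add: run' declared_pc)
      next
        case (Pop r e l0 l1)
        then have r: "r < R" using ub by simp
        have cells: "?cell b r 0 t = holds s r 0 b" for b using IH(2)[OF r] t by simp
        have e: "fst (?run (Suc t)) = (if holds s r 0 True then l1 else if holds s r 0 False then l0 else e)"
          unfolding run' Pop by (rule fst_exec_Pop)
        show ?thesis
          using sat4[of "[neg (pc_at l 0), neg (cell True r 0 0), pc_at l1 1]"]
            sat4[of "[neg (pc_at l 0), neg (cell False r 0 0), pc_at l0 1]"]
            sat4[of "[neg (pc_at l 0), cell True r 0 0, cell False r 0 0, pc_at e 1]"]
            IH(1) l t r l' cells e len[of "Suc t"] Pop
          by (auto simp: declared_pc declared_cell split: if_splits)
      next
        case (Halt b)
        with sat4[of "[neg (pc_at l 0), pc_at l 1]"] IH(1) l t l' show ?thesis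
          by (simp add: run' declared_pc)
      next
        case (Query r k)
        with nq[of r k] show ?thesis by simp
      qed
    qed
    ultimately show ?case by blast
  qed
  have "V ! fst (?run T) = Halt True"
  proof (rule ccontr)
    assume a: "V ! fst (?run T) \<noteq> Halt True"
    have b: "(1, 0, T) \<in> set ?bs" by (simp add: in_all_blocks)
    show False
      using sat'[OF b, of "[neg (pc_at (fst (?run T)) 0)]"] a inv[of T] len[of T]
      by (auto simp: disjs_def declared_pc)
  qed
  with decided_run(2)[OF \<tau>(2) \<tau>(1)] have "A c" by simp
  with c show ?thesis by blast
qed

section \<open>Entries occur only once\<close>

text \<open>\<open>tag\<close> recovers from an element the piece it comes from, so the pieces are
  disjoint.\<close>

lemma distinct_concat_tagged:
  assumes "distinct xs" "\<And>x. x \<in> set xs \<Longrightarrow> distinct (f x)"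
    and "\<And>x y. x \<in> set xs \<Longrightarrow> y \<in> set (f x) \<Longrightarrow> tag y = x"
  shows "distinct (concat (map f xs))"
  using assms
proof (induction xs)
  case (Cons x xs)
  have "False" if "y \<in> set (f x)" "x' \<in> set xs" "y \<in> set (f x')" for y x'
    using Cons.prems(3)[of x y] Cons.prems(3)[of x' y] Cons.prems(1) that by auto
  with Cons show ?case by auto
qed simp

lemma fill_inj: "fill i t x = fill i t x' \<Longrightarrow> x \<in> set (aligned V R k) \<Longrightarrow> x' \<in> set (aligned V R k) \<Longrightarrow> x = x'"
  by (auto simp: aligned_def pc_at_def cell_def cell_kind_def split: if_splits)

lemma distinct_aligned: "distinct (aligned V R k)"
  by (auto simp: aligned_def distinct_map inj_on_def pc_at_def cell_def cell_kind_def distinct_product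
      split: if_splits)

lemma clauses_0: "clauses V R 0 = [decl T_plus, decl T_imag, decl T_true, or_clause [pc_at 0 0]]"
  by (simp add: clauses_def aligned_def disjs_def)

text \<open>Zero entries of the frame clauses share their measurements with the entries of
  probability 1/2; the kind of the state tells the two apart.\<close>

lemma frame_clause_kinds:
  assumes "z < 5"
  shows "fst (clauses V R 0 ! 0 ! z) \<in> {2, 3}" "fst (clauses V R 0 ! 1 ! z) \<in> {4, 5}"
proof -
  have "fst x \<in> {2, 3}" if "x \<in> set (decl T_plus)" for x using that by (auto simp: decl_def neg.simps)
  moreover have "fst x \<in> {4, 5}" if "x \<in> set (decl T_imag)" for x using that by (auto simp: decl_def neg.simps)
  ultimately show "fst (clauses V R 0 ! 0 ! z) \<in> {2, 3}" "fst (clauses V R 0 ! 1 ! z) \<in> {4, 5}"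
    using assms by (auto simp: clauses_0)
qed

lemma distinct_template: "distinct (map entry_key (map (fill_entry i t) (template V R k)))"
proof -
  let ?key = "\<lambda>e. entry_key (fill_entry i t e)"
  let ?cs = "concat (map (\<lambda>j. map ?key (clause_entries k j (clauses V R k ! j))) [0..<length (clauses V R k)])"
  let ?as = "concat (map (\<lambda>x. map ?key [(x, T_X, 1, True), (x, T_Y, 1, True)]) (aligned V R k))"
  let ?fs = "map ?key (if k = 0 then [(T_plus, T_Y, 1, True)] else [])"
  have eq: "map entry_key (map (fill_entry i t) (template V R k)) = ?cs @ ?as @ ?fs"
    by (simp add: template_def map_concat comp_def)
  have cs: "distinct ?cs"
  proof (rule distinct_concat_tagged[where tag="\<lambda>(x, (k, j, i, t), z). j"])
    fix j
    show "distinct (map ?key (clause_entries k j (clauses V R k ! j)))"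
      by (simp add: clause_entries_def distinct_map inj_on_def)
  qed (auto simp: clause_entries_def)
  have as: "distinct ?as"
  proof (rule distinct_concat_tagged[where tag="\<lambda>(x, y, z). THE u. u \<in> set (aligned V R k) \<and> x = fill i t u"])
    show "distinct (aligned V R k)" by (rule distinct_aligned)
    fix u assume u: "u \<in> set (aligned V R k)"
    show "distinct (map ?key [(u, T_X, 1, True), (u, T_Y, 1, True)])" by simp
    fix e assume "e \<in> set (map ?key [(u, T_X, 1, True), (u, T_Y, 1, True)])"
    moreover have "(THE u'. u' \<in> set (aligned V R k) \<and> fill i t u = fill i t u') = u"
      using u fill_inj by blast
    ultimately show "(case e of (x, y, z) \<Rightarrow> THE u. u \<in> set (aligned V R k) \<and> x = fill i t u) = u"
      by auto
  qed
  have c: "k = 0 \<and> (y = meas_X \<longrightarrow> fst x \<in> {2, 3}) \<and> (y = meas_Y \<longrightarrow> fst x \<in> {4, 5})"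
    if xyz: "(x, y, z) \<in> set ?cs" and "y = meas_X \<or> y = meas_Y" for x y z
  proof -
    obtain j z' where j: "j < length (clauses V R k)" "z' < 5" "x = fill i t (clauses V R k ! j ! z')"
      "y = (k, j, i, t)"
      using xyz by (auto simp: clause_entries_def)
    with that(2) have "k = 0" "j = 0 \<or> j = 1" by auto
    with j frame_clause_kinds[OF j(2), of V R] show ?thesis by auto
  qed
  have a: "(y = meas_X \<or> y = meas_Y) \<and> regular x" if "(x, y, z) \<in> set ?as" for x y z
    using that aligned_regular by (auto simp: regular_def)
  have f: "x = plus_name \<and> y = meas_Y" if "(x, y, z) \<in> set ?fs" for x y z
    using that by (auto split: if_splits)
  have "False" if "e \<in> set ?cs" "e \<in> set ?as \<or> e \<in> set ?fs" for e
  proof -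
    obtain x y z where e: "e = (x, y, z)" by (cases e)
    from that(2) have "(y = meas_X \<or> y = meas_Y) \<and> (regular x \<or> x = plus_name \<and> y = meas_Y)"
      unfolding e using a[of x y z] f[of x y z] by argo
    moreover note c[OF that(1)[unfolded e]]
    ultimately show False by (auto simp: regular_def)
  qed
  moreover have "False" if "e \<in> set ?as" "e \<in> set ?fs" for e
  proof -
    obtain x y z where e: "e = (x, y, z)" by (cases e)
    show False using a[OF that(1)[unfolded e]] f[OF that(2)[unfolded e]] by (simp add: regular_def)
  qed
  moreover have "distinct ?fs" by simp
  ultimately show ?thesis unfolding eq distinct_append set_append using cs as by blast
qed


lemma distinct_all_blocks: "distinct (all_blocks w m T)"
proof -
  have rows: "distinct (concat (map (row_blocks T) (rev [0..<T])))"
    by (rule distinct_concat_tagged[where tag="\<lambda>(k, i, t). t"])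
      (auto simp: row_blocks_def distinct_map inj_on_def)
  have inits: "distinct (concat (map (init_blocks w m) (rev [0..<T])))"
    by (rule distinct_concat_tagged[where tag="\<lambda>(k, i, t). i"])
      (auto simp: init_blocks_def split: if_splits)
  let ?rows = "set (concat (map (row_blocks T) (rev [0..<T])))"
  let ?inits = "set (concat (map (init_blocks w m) (rev [0..<T])))"
  have "b \<notin> ?inits" if "b \<in> ?rows" for b
   
  proof -
    obtain k i t where b: "b = (k, i, t)" by (cases b)
    show ?thesis using that unfolding b in_rows in_inits by (auto split: if_splits)
  qed
  then have "?rows \<inter> ?inits = {}" by blast
  moreover have "(1, 0, T) \<notin> ?rows" "(2, 0, T) \<notin> ?rows" "(0, 0, 0) \<notin> ?rows"
    "(1, 0, T) \<notin> ?inits" "(2, 0, T) \<notin> ?inits" "(0, 0, 0) \<notin> ?inits"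
    unfolding in_rows in_inits by auto
  ultimately show ?thesis
    unfolding all_blocks_def distinct_append set_append using rows inits by auto
qed

text \<open>Usually the name of the measurement carries the block. Entries of probability 1/2 use
  the common frame measurements, so there the block is read off the state: kind 6 is a label,
  declared by template 2, and the cells are declared by template 3.\<close>

fun entry_block :: "name \<times> name \<times> nat \<Rightarrow> block" where
  "entry_block ((k', a, i', t'), (k, j, i, t), z) =
     (if k = 0 \<and> 6 \<le> k' \<and> j \<le> 1 then if k' = 6 then (2, 0, t') else (3, i', t') else (k, i, t))"

lemma entry_block_template:
  assumes "(k, i, t) \<in> set (all_blocks w m T)" "e \<in> set (template V R k)"
  shows "entry_block (entry_key (fill_entry i t e)) = (k, i, t)"
proof -
  have k0: "k = 0 \<Longrightarrow> i = 0 \<and> t = 0" "k = 2 \<Longrightarrow> i = 0"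
    using assms(1) by (auto simp: in_all_blocks split: if_splits)
  from assms(2) consider j z where "j < length (clauses V R k)" "z < 5"
      "e = (clauses V R k ! j ! z, (k, j, (True, 0), (True, 0)), Suc z, False)"
    | u where "u \<in> set (aligned V R k)" "e = (u, T_X, 1, True) \<or> e = (u, T_Y, 1, True)"
    | "k = 0" "e = (T_plus, T_Y, 1, True)"
    unfolding template_def clause_entries_def by (auto split: if_splits)
  then show ?thesis
  proof cases
    case 1
    obtain k' a' i' t' where x: "fill i t (clauses V R k ! j ! z) = (k', a', i', t')" by (metis prod.exhaust)
    then have "k' = fst (clauses V R k ! j ! z)" by (metis fst_conv fst_fill)
    then have "\<not> (k = 0 \<and> 6 \<le> k' \<and> j \<le> 1)"
      using frame_clause_kinds[OF 1(2), of V R] by (cases "j = 0"; cases "j = 1") auto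
    then show ?thesis using x 1(3) by auto
  next
    case 2
    have "(u = T_true \<and> k = 0) \<or> (\<exists>l. u = pc_at l 0 \<and> k = 2) \<or> (\<exists>b r. u = cell b r 0 0 \<and> k = 3)"
      using 2(1) by (auto simp: aligned_def split: if_splits)
    then show ?thesis using 2(2) k0 by (auto simp: cell_kind_def)
  next
    case 3
    then show ?thesis using k0 by simp
  qed
qed

lemma distinct_entries: "distinct (map entry_key (entries V R (all_blocks w m T)))"
proof -
  let ?f = "\<lambda>(k, i, t). map entry_key (map (fill_entry i t) (template V R k))"
  have "map entry_key (entries V R (all_blocks w m T)) = concat (map ?f (all_blocks w m T))"
    by (simp add: entries_def map_concat comp_def case_prod_unfold)
  also have "distinct \<dots>"
  proof (rule distinct_concat_tagged[where tag=entry_block])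
    show "distinct (all_blocks w m T)" by (rule distinct_all_blocks)
    fix b assume b: "b \<in> set (all_blocks w m T)"
    obtain k i t where kit: "b = (k, i, t)" by (cases b)
    show "distinct (?f b)"
      unfolding kit prod.case by (rule distinct_template)
    fix e assume "e \<in> set (?f b)"
    then show "entry_block e = b" using entry_block_template b unfolding kit by auto
  qed
  finally show ?thesis .
qed

section \<open>The instance\<close>

fun tname_size :: "tname \<Rightarrow> nat" where
  "tname_size (k, a, (bi, ci), (bt, ct)) = k + a + ci + ct + 4"

lemma length_name_bits_fill:
  assumes "i \<le> T" "t \<le> T"
  shows "length (name_bits (fill i t x)) \<le> tname_size x + 2 * T"
proof -
  obtain k a bi ci bt ct where x: "x = (k, a, (bi, ci), (bt, ct))" by (metis prod.exhaust)
  show ?thesis using assms unfolding x by (cases bi; cases bt) simp_all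
qed

text \<open>The ten templates are finite and depend on the verifier alone, so one constant serves
  all inputs.\<close>

lemma ex_tname_size_bound:
  "\<exists>C. \<forall>k\<le>9. \<forall>(x, y, z, h) \<in> set (template V R k). tname_size x \<le> C \<and> tname_size y \<le> C"
proof -
  define S where "S = (\<Union>k\<in>{..9::nat}. (\<lambda>(x, y, z, h). tname_size x + tname_size y) ` set (template V R k))"
  have "finite S" by (simp add: S_def)
  then obtain C where C: "\<forall>s \<in> S. s \<le> C" using finite_nat_set_iff_bounded_le by metis
  have "tname_size x \<le> C \<and> tname_size y \<le> C"
    if "k \<le> 9" "(x, y, z, h) \<in> set (template V R k)" for k x y z h
  proof -
    have "tname_size x + tname_size y \<in> S" unfolding S_def using that by force
    with C show ?thesis by fastforce
  qed
  then have "\<forall>k\<le>9. \<forall>(x, y, z, h) \<in> set (template V R k). tname_size x \<le> C \<and> tname_size y \<le> C"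
    by (intro allI impI ballI) (simp only: split_paired_all prod.case)
  then show ?thesis by blast
qed

lemma all_blocks_bounds:
  "(k, i, t) \<in> set (all_blocks w m T) \<Longrightarrow> k \<le> 9 \<and> i \<le> T \<and> t \<le> T"
  by (auto simp: in_all_blocks split: if_splits)

lemma entries_bounds:
  assumes C: "\<forall>k\<le>9. \<forall>(x, y, z, h) \<in> set (template V R k). tname_size x \<le> C \<and> tname_size y \<le> C"
    and e: "(x, y, z, h) \<in> set (entries V R (all_blocks w m T))"
  shows "code x \<le> val (ones (2 * T + C))" "code y \<le> val (ones (2 * T + C))" "1 \<le> z" "z \<le> 5"
proof -
  obtain k i t x' y' where b: "(k, i, t) \<in> set (all_blocks w m T)"
    and t: "(x', y', z, h) \<in> set (template V R k)" and xy: "x = fill i t x'" "y = fill i t y'"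
    using e unfolding entries_def by auto
  note bd = all_blocks_bounds[OF b]
  have "tname_size x' \<le> C" "tname_size y' \<le> C" using C t bd by fastforce+
  then have "length (name_bits x) \<le> 2 * T + C" "length (name_bits y) \<le> 2 * T + C"
    using length_name_bits_fill[of i T t x'] length_name_bits_fill[of i T t y'] bd xy by auto
  then show "code x \<le> val (ones (2 * T + C))" "code y \<le> val (ones (2 * T + C))"
    by (auto intro: code_le)
  show "1 \<le> z" "z \<le> 5"
    using t unfolding template_def clause_entries_def by (auto split: if_splits)
qed

lemma frame_entry: "(plus_name, meas_Y, 1, True) \<in> set (entries V R (all_blocks w m T))"
proof -
  have "(T_plus, T_Y, 1, True) \<in> set (template V R 0)" by (simp add: template_def)
  moreover have "(0, 0, 0) \<in> set (all_blocks w m T)" by (simp add: in_all_blocks)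
  ultimately have "fill_entry 0 0 (T_plus, T_Y, 1, True) \<in> set (entries V R (all_blocks w m T))"
    by (intro fill_entry_in_entries)
  then show ?thesis by simp
qed

section \<open>Names versus numbered states and measurements\<close>

lemma realizable_imp_solves:
  assumes "distinct (map entry_key es)" "valid_instance (instance_of es N)"
    and "realizable (instance_of es N) d"
  shows "\<exists>\<rho> E. solves d \<rho> E es"
proof -
  let ?I = "instance_of es N"
  obtain \<rho> E where \<rho>: "\<forall>x \<in> {1..nX ?I}. quantum_state d (\<rho> x)"
    and E: "\<forall>y \<in> {1..nY ?I}. measurement d 5 (E y)"
    and p: "\<forall>(x, y, z) \<in> Omega ?I. of_rat (prob ?I (x, y, z)) = mat_trace (\<rho> x * E y z)"
    using assms(3) unfolding realizable_def by (auto simp: instance_of_def)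
  have "quantum_state d (\<rho> (code x)) \<and> measurement d 5 (E (code y)) \<and>
      mat_trace (\<rho> (code x) * E (code y) z) = of_rat (half_if h)" if e: "(x, y, z, h) \<in> set es" for x y z h
  proof -
    have "entry_pos (x, y, z, h) \<in> Omega ?I" using imageI[OF e, of entry_pos] by (simp add: instance_of_def)
    then have o: "(code x, code y, z) \<in> Omega ?I" by simp
    then have "code x \<in> {1..nX ?I}" "code y \<in> {1..nY ?I}"
      using assms(2) unfolding valid_instance_def by auto
    moreover have "of_rat (prob ?I (code x, code y, z)) = mat_trace (\<rho> (code x) * E (code y) z)"
      using p o by blast
    ultimately show ?thesis using \<rho> E prob_instance_of[OF assms(1) e, of N] by simp
  qed
  then have "solves d (\<lambda>x. \<rho> (code x)) (\<lambda>y. E (code y)) es"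
    unfolding solves_def by auto
  then show ?thesis by blast
qed

lemma solves_imp_realizable:
  assumes "distinct (map entry_key es)" "solves d \<rho> E es" "\<And>x. quantum_state d (\<rho> x)"
    and "(x0, y0, z0, h0) \<in> set es"
  shows "realizable (instance_of es N) d"
proof -
  let ?I = "instance_of es N"
  define \<rho>' where "\<rho>' n = \<rho> (inv_into UNIV code n)" for n
  \<comment> \<open>Every number needs a measurement, but \<open>solves\<close> provides one only
    for names that occur in an entry; \<open>E y0\<close> fills the gaps.\<close>
  define E' where "E' n = (if measurement d 5 (E (inv_into UNIV code n)) then E (inv_into UNIV code n) else E y0)" for n
  have inv: "inv_into UNIV code (code x) = x" for x by (rule inv_into_f_f) (auto intro: injI)
  have sol: "measurement d 5 (E y)" "mat_trace (\<rho> x * E y z) = of_rat (half_if h)"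
    if "(x, y, z, h) \<in> set es" for x y z h
    using assms(2) that unfolding solves_def by auto
  have m: "measurement d (nZ ?I) (E' n)" for n
    using sol(1)[OF assms(4)] by (simp add: E'_def instance_of_def)
  have q: "quantum_state d (\<rho>' n)" for n unfolding \<rho>'_def by (rule assms(3))
  have p: "of_rat (prob ?I (a, b, z)) = mat_trace (\<rho>' a * E' b z)" if "(a, b, z) \<in> Omega ?I" for a b z
  proof -
    have "(a, b, z) \<in> entry_pos ` set es" using that by (simp add: instance_of_def)
    then obtain e where e: "e \<in> set es" "entry_pos e = (a, b, z)" by force
    obtain x y z' h where "e = (x, y, z', h)" by (cases e)
    with e have e: "(x, y, z, h) \<in> set es" "a = code x" "b = code y" by auto
    show ?thesis
      using prob_instance_of[OF assms(1) e(1), of N] sol[OF e(1)] by (simp add: e \<rho>'_def E'_def inv)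
  qed
  show ?thesis
    unfolding realizable_def
  proof (intro exI[of _ \<rho>'] exI[of _ E'] conjI ballI q m)
    fix e assume "e \<in> Omega ?I"
    then show "case e of (x, y, z) \<Rightarrow> of_rat (prob ?I (x, y, z)) = mat_trace (\<rho>' x * E' y z)"
      using p by (cases e) (simp only: prod.case)
  qed
qed

text \<open>A nonempty infimum in \<open>enat\<close> is attained and the empty one is infinite, so
  the value 2 means that dimension 2 is realised.\<close>

lemma min_dim_eq_2_iff:
  assumes "\<And>d. realizable I d \<Longrightarrow> 2 \<le> d"
  shows "min_dim I = enat 2 \<longleftrightarrow> realizable I 2"
proof
  assume a: "min_dim I = enat 2"
  then have "{enat d | d. realizable I d} \<noteq> {}" by (intro notI) (simp add: min_dim_def Inf_enat_def)
  then have "Inf {enat d | d. realizable I d} \<in> {enat d | d. realizable I d}"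
    by (metis (no_types, lifting) LeastI_ex Inf_enat_def ex_in_conv)
  with a show "realizable I 2" by (auto simp: min_dim_def)
next
  assume "realizable I 2"
  then show "min_dim I = enat 2"
    unfolding min_dim_def by (intro antisym Inf_lower Inf_greatest) (auto dest: assms)
qed

lemma value_code_eq_2_iff: "value_code v = [True, False, True] \<longleftrightarrow> v = enat 2"
proof (cases v)
  case (enat d)
  have "bin 2 = [False, True]" by (simp add: bin.simps)
  then have "bin d = [False, True] \<longleftrightarrow> d = 2" using bin_inj by metis
  with enat show ?thesis by simp
qed simp

lemma instance_correct:
  fixes V :: program and A :: "bool list \<Rightarrow> bool"
  assumes qf: "query_free V" and R: "2 \<le> R" and below: "\<forall>ins \<in> set V. uses_below R ins"
    and dec: "\<And>c. length c \<le> m \<Longrightarrow> \<exists>\<tau>\<le>T. outcome_at id V [w, c] \<tau> (A c)"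
    and C: "\<forall>k\<le>9. \<forall>(x, y, z, h) \<in> set (template V R k).
      tname_size x \<le> C \<and> tname_size y \<le> C"
    and f: "answers f MinDim"
  shows "f (instance_text (entries V R (all_blocks w m T)) (2 * T + C)) = [True, False, True] \<longleftrightarrow>
    (\<exists>c. length c \<le> m \<and> A c)"
proof -
  let ?bs = "all_blocks w m T"
  let ?es = "entries V R ?bs"
  let ?N = "2 * T + C"
  let ?I = "instance_of ?es ?N"
  have b0: "(0, 0, 0) \<in> set ?bs" by (simp add: in_all_blocks)
  note dist = distinct_entries[of V R w m T]
  note bounds = entries_bounds[OF C, of _ _ _ _ w m T]
  have valid: "valid_instance ?I"
  proof -
    have "1 \<le> val (ones ?N)" using order_trans[OF code_pos bounds(1)[OF frame_entry]] .
    moreover have "Omega ?I \<subseteq> {1..nX ?I} \<times> {1..nY ?I} \<times> {1..nZ ?I}"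
      using bounds code_pos by (auto simp: instance_of_def)
    ultimately show ?thesis by (simp add: valid_instance_def instance_of_def)
  qed
  have ge2: "2 \<le> d" if r: "realizable ?I d" for d
  proof -
    obtain \<rho> E where s: "solves d \<rho> E ?es" using realizable_imp_solves[OF dist valid r] by blast
    have "0 < length (clauses V R 0)" by (simp add: clauses_0)
    from solves_imp_dim_ge_2[OF s clause_in_entries[OF b0 this]] show ?thesis .
  qed
  have "realizable ?I 2 \<longleftrightarrow> (\<exists>c. length c \<le> m \<and> A c)"
  proof
    assume "realizable ?I 2"
    then obtain \<rho> E where s: "solves 2 \<rho> E ?es" using realizable_imp_solves[OF dist valid] by blast
    obtain v where sat: "\<And>k i t ls. (k, i, t) \<in> set ?bs \<Longrightarrow> ls \<in> set (disjs V R k) \<Longrightarrow>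
      (\<And>x. x \<in> set ls \<Longrightarrow> fill i t x \<in> declared V R ?bs \<or> neg (fill i t x) \<in> declared V R ?bs) \<Longrightarrow>
      \<exists>x \<in> set ls. lit_val v (fill i t x)"
      using solves_entries_imp_sat[OF s b0] by blast
    show "\<exists>c. length c \<le> m \<and> A c"
      by (rule sat_imp_accepting_run[where T=T and w=w and v=v, OF qf R below]) (fact dec, rule sat)
  next
    assume "\<exists>c. length c \<le> m \<and> A c"
    then obtain c \<tau> where c: "length c \<le> m" "\<tau> \<le> T" "outcome_at id V [w, c] \<tau> True"
      using dec by metis
    note sat = accepting_run_sat[OF qf below c(3,2,1)]
    have "run_val V [w, c] true_name" by (simp add: run_val_def)
    then obtain E where "solves 2 (state_of (run_val V [w, c])) E ?es"
      using sat_imp_solves_entries[OF sat _ b0] by blast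
    from solves_imp_realizable[OF dist this quantum_state_of frame_entry] show "realizable ?I 2" .
  qed
  moreover have "f (instance_text ?es ?N) = value_code (min_dim ?I)"
  proof -
    have "(instance_text ?es ?N, value_code (min_dim ?I)) \<in> MinDim"
      unfolding MinDim_def using valid instance_text_code[OF dist] by blast
    from bspec[OF f[unfolded answers_def] this] show ?thesis by simp
  qed
  ultimately show ?thesis using min_dim_eq_2_iff[OF ge2] value_code_eq_2_iff by simp
qed

section \<open>The reduction\<close>

definition reduction_toks :: "program \<Rightarrow> nat \<Rightarrow> nat \<Rightarrow> nat \<Rightarrow> tok list" where
  "reduction_toks V R C k =
     (if k \<le> 9 then block_toks (template V R k) else if k = 10 then header_toks C else [])"

lemma render_reduction:
  "render 0 T (reduction_toks V R C 10) @ render_blocks (reduction_toks V R C) (all_blocks w m T) =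
    instance_text (entries V R (all_blocks w m T)) (2 * T + C)"
proof -
  have "render_blocks (reduction_toks V R C) bs = concat (map entry_text (entries V R bs))"
    if "\<forall>(k, i, t) \<in> set bs. k \<le> 9" for bs
    using that by (induction bs) (auto simp: entries_def reduction_toks_def render_block_toks)
  then have "render_blocks (reduction_toks V R C) (all_blocks w m T) =
      concat (map entry_text (entries V R (all_blocks w m T)))"
    using all_blocks_bounds by blast
  then show ?thesis by (simp add: reduction_toks_def render_header_toks)
qed

text \<open>\<open>[True, False, True]\<close> is the encoded answer 2.\<close>

definition query_code :: "nat \<Rightarrow> instr list" where
  "query_code n = [Query 13 (n + 1), Pop 13 (n + 6) (n + 6) (n + 2), Pop 13 (n + 6) (n + 3) (n + 6),
     Pop 13 (n + 6) (n + 6) (n + 4), Pop 13 (n + 5) (n + 6) (n + 6), Halt True, Halt False]"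

lemma query_code_outcome:
  assumes "code_at P n (query_code n)"
  shows "\<exists>j\<le>6. let pc = fst ((step f P ^^ j) (n, s)) in
    pc < length P \<and> P ! pc = Halt (f (s 13) = [True, False, True])"
proof -
  have len: "n + 6 < length P" using assms by (simp add: code_at_def query_code_def)
  have P: "P ! n = Query 13 (n + 1)" "P ! (n + 1) = Pop 13 (n + 6) (n + 6) (n + 2)"
    "P ! (n + 2) = Pop 13 (n + 6) (n + 3) (n + 6)" "P ! (n + 3) = Pop 13 (n + 6) (n + 6) (n + 4)"
    "P ! (n + 4) = Pop 13 (n + 5) (n + 6) (n + 6)" "P ! (n + 5) = Halt True" "P ! (n + 6) = Halt False"
    using assms by (simp_all add: query_code_def code_at_Cons eval_nat_numeral)
  \<comment> \<open>\<open>g j s'\<close> says that the correct verdict is reached from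
    \<open>s'\<close> within \<open>j\<close> steps. The claims \<open>g4\<close> to
    \<open>g1\<close> go backwards through the tests and compare the rest of the answer with a
    suffix of the code of 2.\<close>
  define g where "g j s' = (\<exists>i\<le>j. let pc = fst ((step f P ^^ i) s') in
    pc < length P \<and> P ! pc = Halt (f (s 13) = [True, False, True]))" for j s'
  have stepI: "g (Suc j) s'" if "g j (step f P s')" for j s'
    using that unfolding g_def by (metis Suc_le_mono funpow_Suc_right o_apply)
  have acc: "g j (n + 5, s')" if "f (s 13) = [True, False, True]" for j s'
    using that len P unfolding g_def by (intro exI[of _ 0]) simp
  have rej: "g j (n + 6, s')" if "f (s 13) \<noteq> [True, False, True]" for j s'
    using that len P unfolding g_def by (intro exI[of _ 0]) simp
  have st_exec: "step f P (a, s') = exec f (P ! a) (a, s')" if "a \<le> n + 6" for a s'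
    using that len by (simp add: step_def)
  have st: "step f P (n, s') = (n + 1, s'(13 := f (s' 13)))"
    "step f P (n + 1, s') = (case s' 13 of [] \<Rightarrow> (n + 6, s') | b # w \<Rightarrow> (if b then n + 2 else n + 6, s'(13 := w)))"
    "step f P (n + 2, s') = (case s' 13 of [] \<Rightarrow> (n + 6, s') | b # w \<Rightarrow> (if b then n + 6 else n + 3, s'(13 := w)))"
    "step f P (n + 3, s') = (case s' 13 of [] \<Rightarrow> (n + 6, s') | b # w \<Rightarrow> (if b then n + 4 else n + 6, s'(13 := w)))"
    "step f P (n + 4, s') = (case s' 13 of [] \<Rightarrow> (n + 5, s') | b # w \<Rightarrow> (n + 6, s'(13 := w)))" for s'
    by (subst st_exec, simp, simp only: P exec.simps if_cancel)+
  let ?acc = "f (s 13) = [True, False, True]"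
  have g4: "g (Suc j) (n + 4, s')" if "s' 13 = [] \<longleftrightarrow> ?acc" for j s'
  proof (rule stepI, cases "s' 13")
    case (Cons b w)
    with that rej show "g j (step f P (n + 4, s'))" unfolding st by simp
  qed (unfold st, use that acc in simp)
  have g3: "g (Suc (Suc j)) (n + 3, s')" if "s' 13 = [True] \<longleftrightarrow> ?acc" for j s'
  proof (rule stepI, cases "s' 13")
    case (Cons b w)
    with that show "g (Suc j) (step f P (n + 3, s'))"
      using g4[where j=j and s'="s'(13 := w)"] rej[where j="Suc j" and s'="s'(13 := w)"] unfolding st by (cases b) auto
  qed (unfold st, use that rej in simp)
  have g2: "g (Suc (Suc (Suc j))) (n + 2, s')" if "s' 13 = [False, True] \<longleftrightarrow> ?acc" for j s'
  proof (rule stepI, cases "s' 13")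
    case (Cons b w)
    with that show "g (Suc (Suc j)) (step f P (n + 2, s'))"
      using g3[where j=j and s'="s'(13 := w)"] rej[where j="Suc (Suc j)" and s'="s'(13 := w)"] unfolding st by (cases b) auto
  qed (unfold st, use that rej in simp)
  have g1: "g (Suc (Suc (Suc (Suc j)))) (n + 1, s')" if "s' 13 = [True, False, True] \<longleftrightarrow> ?acc" for j s'
  proof (rule stepI, cases "s' 13")
    case (Cons b w)
    with that show "g (Suc (Suc (Suc j))) (step f P (n + 1, s'))"
      using g2[where j=j and s'="s'(13 := w)"] rej[where j="Suc (Suc (Suc j))" and s'="s'(13 := w)"] unfolding st by (cases b) auto
  qed (unfold st, use that rej in simp)
  have "g (Suc (Suc (Suc (Suc (Suc 1))))) (n, s)"
    by (rule stepI) (unfold st, rule g1, simp)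
  then have "g 6 (n, s)" by (simp add: eval_nat_numeral)
  then show ?thesis unfolding g_def .
qed


theorem theorem1:
  shows "NP_hard MinDim"
  unfolding NP_hard_def
proof (intro ballI)
  fix L assume "L \<in> NP"
  then obtain A V q p where qf: "query_free V" and dec: "decides_in_time id V q 2 A"
    and L: "\<And>w. w \<in> L \<longleftrightarrow> (\<exists>c. length c \<le> poly p (length w) \<and> A [w, c])"
    unfolding NP_def by blast
  obtain R where R: "2 \<le> R" "\<forall>ins \<in> set V. uses_below R ins" using ex_uses_below by blast
  obtain C where C: "\<forall>k\<le>9. \<forall>(x, y, z, h) \<in> set (template V R k).
      tname_size x \<le> C \<and> tname_size y \<le> C"
    using ex_tname_size_bound by blast
  let ?bt = "reduction_toks V R C"
  define K where "K = (\<Sum>k\<le>10. length (?bt k))"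
  have K: "length (?bt k) \<le> K" for k
  proof (cases "k \<le> 10")
    case True
    then show ?thesis unfolding K_def by (intro member_le_sum) auto
  qed (simp add: reduction_toks_def)
  let ?g = "generator ?bt (coeffs p) (coeffs q)"
  let ?n = "size_com ?g"
  define P where "P = comp ?g 0 ?n @ query_code ?n"
  \<comment> \<open>The 6 covers the query and the at most four pops that inspect its
    answer.\<close>
  obtain u where u: "\<And>n. generator_time K (coeffs p) (coeffs q) n + 6 \<le> poly u n"
    using polybounded_add[OF polybounded_generator_time polybounded_const] unfolding polybounded_def by blast
  have "code_at P 0 P" by (simp add: code_at_def)
  then have code: "code_at P 0 (comp ?g 0 ?n)" "code_at P ?n (query_code ?n)"
    using code_at_append[of P 0 "comp ?g 0 ?n" "query_code ?n"] by (simp_all add: P_def)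
  have "decides_in_time f P u 1 (\<lambda>ws. hd ws \<in> L)" if f: "answers f MinDim" for f
    unfolding decides_in_time_def
  proof (intro allI impI)
    fix ws :: "bool list list" assume "length ws = 1"
    then obtain w where ws: "ws = [w]" by (metis length_0_conv length_Suc_conv One_nat_def)
    define m where "m = poly p (length w)"
    \<comment> \<open>\<open>m + length w\<close> bounds the joint length of \<open>w\<close> and an
      admissible witness; polynomials over the naturals are monotone, so one \<open>T\<close> bounds
      the halting times for all witnesses.\<close>
    define T where "T = poly q (m + length w)"
    obtain s' where s': "runs ?g ((\<lambda>_. [])(0 := w)) s' (generator_time K (coeffs p) (coeffs q) (length w))"
      "s' 13 = instance_text (entries V R (all_blocks w m T)) (2 * T + C)"
      using runs_generator[of ?bt K "coeffs p" "coeffs q" w, OF K]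
      unfolding hval_coeffs m_def[symmetric] T_def[symmetric] render_reduction by blast
    then obtain j where j: "j \<le> generator_time K (coeffs p) (coeffs q) (length w)"
      "big ?g ((\<lambda>_. [])(0 := w)) j s'" unfolding runs_def by blast
    have "entry ?g 0 ?n = 0" by (simp add: entry_def generator_def count_input_def)
    with comp_correct[OF j(2) code(1), of f] have
      "(step f P ^^ j) (0, (\<lambda>_. [])(0 := w)) = (?n, s')" by simp
    moreover have "init_config ws = (0, (\<lambda>_. [])(0 := w))"
      by (auto simp: init_config_def ws fun_eq_iff)
    ultimately have run: "(step f P ^^ j) (init_config ws) = (?n, s')" by simp
    have d: "\<exists>\<tau>\<le>T. outcome_at id V [w, c] \<tau> (A [w, c])" if "length c \<le> m" for c
    proof -
      obtain \<tau> where "\<tau> \<le> poly q (length w + length c)" "outcome_at id V [w, c] \<tau> (A [w, c])"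
        using dec unfolding decides_in_time_def by (auto dest!: spec[of _ "[w, c]"])
      moreover have "poly q (length w + length c) \<le> T"
        unfolding T_def using that by (intro poly_nat_mono) simp
      ultimately show ?thesis by (meson le_trans)
    qed
    have ans: "f (s' 13) = [True, False, True] \<longleftrightarrow> w \<in> L"
      using instance_correct[of V R m T w "\<lambda>c. A [w, c]", OF qf R d C f] L[of w] s'(2)
      by (simp add: m_def)
    obtain i where i: "i \<le> 6" "let pc = fst ((step f P ^^ i) (?n, s')) in
        pc < length P \<and> P ! pc = Halt (w \<in> L)"
      using query_code_outcome[OF code(2), of f s'] ans by auto
    have "outcome_at f P ws (i + j) (hd ws \<in> L)"
      unfolding outcome_at_def funpow_add o_apply run using i(2) by (simp add: ws)
    moreover have "i + j \<le> poly u (sum_list (map length ws))"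
      using i(1) j(1) u[of "length w"] by (simp add: ws)
    ultimately show "\<exists>t\<le>poly u (sum_list (map length ws)). outcome_at f P ws t (hd ws \<in> L)" by blast
  qed
  then show "\<exists>P q. \<forall>f. answers f MinDim \<longrightarrow> decides_in_time f P q 1 (\<lambda>ws. hd ws \<in> L)" by blast
qed

end
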